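(* Let $s\in(0,1)$, $n>2s$, let $\Omega\subset\mathbb{R}^n$ be a bounded domain with smooth (at least $C^2$) boundary, and assume $1<q<2$ and $0<\mu<n$. Put $2^*_\mu=\frac{2n-\mu}{n-2s}$. For $\lambda,\delta>0$ consider the system $$(P_{\lambda,\delta})\quad\begin{cases}(-\Delta)^su=\lambda|u|^{q-2}u+\left(\int_\Omega\frac{|v(y)|^{2^*_\mu}}{|x-y|^\mu}\,dy\right)|u|^{2^*_\mu-2}u & \text{in }\Omega,\\ (-\Delta)^sv=\delta|v|^{q-2}v+\left(\int_\Omega\frac{|u(y)|^{2^*_\mu}}{|x-y|^\mu}\,dy\right)|v|^{2^*_\mu-2}v & \text{in }\Omega,\\ u=v=0 & \text{in }\mathbb{R}^n\setminus\Omega.\end{cases}$$ Then there exist positive constants $\Theta$ and $\Theta_0$ such that: 1. if $\mu\le 4s$ and $0<\lambda^{\frac{2}{2-q}}+\delta^{\frac{2}{2-q}}<\Theta$, then $(P_{\lambda,\delta})$ admits at least two nontrivial (weak) solutions; 2. if $\mu>4s$ and $0<\lambda^{\frac{2}{2-q}}+\delta^{\frac{2}{2-q}}<\Theta_0$, then $(P_{\lambda,\delta})$ admits at least two nontrivial (weak) solutions. Moreover, in these cases there exists a positive solution of $(P_{\lambda,\delta})$, i.e. a solution $(u,v)$ with $u>0$ and $v>0$ in $\Omega$.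
   Context: The fractional Laplacian is $(-\Delta)^su(x)=2C^n_s\,\mathrm{P.V.}\int_{\mathbb{R}^n}\frac{u(x)-u(y)}{|x-y|^{n+2s}}\,dy$ with $C^n_s=\pi^{-n/2}2^{2s-1}s\,\frac{\Gamma(\frac{n+2s}{2})}{\Gamma(1-s)}$. Let $Q=\mathbb{R}^{2n}\setminus\big((\mathbb{R}^n\setminus\Omega)\times(\mathbb{R}^n\setminus\Omega)\big)$ and let $X_0$ be the Hilbert space of measurable $u:\mathbb{R}^n\to\mathbb{R}$ with $u\in L^2(\Omega)$, $u=0$ in $\mathbb{R}^n\setminus\Omega$ and $\int_Q\frac{|u(x)-u(y)|^2}{|x-y|^{n+2s}}\,dx\,dy<\infty$, with inner product $\langle u,v\rangle=\int_Q\frac{(u(x)-u(y))(v(x)-v(y))}{|x-y|^{n+2s}}\,dx\,dy$. Let $Y=X_0\times X_0$. A pair $(u,v)\in Y$ is a (weak) solution of $(P_{\lambda,\delta})$ if for every $(\phi,\psi)\in Y$, $$C^n_s(\langle u,\phi\rangle+\langle v,\psi\rangle)=\int_\Omega(\lambda|u|^{q-2}u\phi+\delta|v|^{q-2}v\psi)\,dx+\int_\Omega(|x|^{-\mu}*|v|^{2^*_\mu})|u|^{2^*_\mu-2}u\phi\,dx+\int_\Omega(|x|^{-\mu}*|u|^{2^*_\mu})|v|^{2^*_\mu-2}v\psi\,dx .$$ A solution is nontrivial if $(u,v)\ne(0,0)$. *)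

theory Defs
  imports "HOL-Analysis.Analysis"
begin

definition C2_fun :: "('a::real_normed_vector \<Rightarrow> real) \<Rightarrow> bool" where
  "C2_fun h \<longleftrightarrow>
     (\<exists>(h' :: 'a \<Rightarrow> 'a \<Rightarrow>\<^sub>L real) (h'' :: 'a \<Rightarrow> 'a \<Rightarrow>\<^sub>L ('a \<Rightarrow>\<^sub>L real)).
        (\<forall>x. (h has_derivative blinfun_apply (h' x)) (at x)) \<and>
        (\<forall>x. (h' has_derivative blinfun_apply (h'' x)) (at x)) \<and>
        continuous_on UNIV h'')"

text \<open>Near each boundary point, in suitable orthonormal coordinates, the set is the
  strict subgraph of a \<open>C\<^sup>2\<close> function of the remaining \<open>n - 1\<close> coordinates: \<open>e\<close> is the
  direction of the last axis, and \<open>h\<close> is only evaluated at the projection of \<open>x\<close> to the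
  hyperplane orthogonal to \<open>e\<close>.\<close>

definition C2_boundary :: "'a::euclidean_space set \<Rightarrow> bool" where
  "C2_boundary \<Omega> \<longleftrightarrow>
     (\<forall>p \<in> frontier \<Omega>. \<exists>r e h. 0 < r \<and> norm e = 1 \<and> C2_fun h \<and>
        \<Omega> \<inter> ball p r = {x \<in> ball p r. x \<bullet> e < h (x - (x \<bullet> e) *\<^sub>R e)})"

definition bounded_C2_domain :: "'a::euclidean_space set \<Rightarrow> bool" where
  "bounded_C2_domain \<Omega> \<longleftrightarrow>
     open \<Omega> \<and> connected \<Omega> \<and> \<Omega> \<noteq> {} \<and> bounded \<Omega> \<and> C2_boundary \<Omega>"

text \<open>The constant \<open>C\<^sup>n\<^sub>s\<close>, with the dimension \<open>n\<close> as a real argument.\<close>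

definition frac_const :: "real \<Rightarrow> real \<Rightarrow> real" where
  "frac_const n s =
     pi powr (- n / 2) * 2 powr (2 * s - 1) * s * Gamma ((n + 2 * s) / 2) / Gamma (1 - s)"

definition crit_exp :: "real \<Rightarrow> real \<Rightarrow> real \<Rightarrow> real" where
  "crit_exp n s \<mu> = (2 * n - \<mu>) / (n - 2 * s)"

definition Q_set :: "'a set \<Rightarrow> ('a \<times> 'a) set" where
  "Q_set \<Omega> = UNIV - (UNIV - \<Omega>) \<times> (UNIV - \<Omega>)"

text \<open>Elements of \<open>X\<^sub>0\<close> are represented by functions rather than by classes of functions
  that agree almost everywhere. In the integrands below, \<open>z / 0 = 0\<close> and \<open>0 powr a = 0\<close>
  settle the values on the diagonal, which is a null set.\<close>

definition X0 :: "real \<Rightarrow> 'a::euclidean_space set \<Rightarrow> ('a \<Rightarrow> real) set" where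
  "X0 s \<Omega> = {u. u \<in> borel_measurable lebesgue \<and>
      set_integrable lebesgue \<Omega> (\<lambda>x. (u x)\<^sup>2) \<and>
      (\<forall>x. x \<notin> \<Omega> \<longrightarrow> u x = 0) \<and>
      set_integrable lebesgue (Q_set \<Omega>)
        (\<lambda>(x, y). \<bar>u x - u y\<bar>\<^sup>2 / norm (x - y) powr (real DIM('a) + 2 * s))}"

definition X0_inner ::
    "real \<Rightarrow> 'a::euclidean_space set \<Rightarrow> ('a \<Rightarrow> real) \<Rightarrow> ('a \<Rightarrow> real) \<Rightarrow> real" where
  "X0_inner s \<Omega> u v =
     set_lebesgue_integral lebesgue (Q_set \<Omega>)
       (\<lambda>(x, y). (u x - u y) * (v x - v y) / norm (x - y) powr (real DIM('a) + 2 * s))"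

definition Y_space ::
    "real \<Rightarrow> 'a::euclidean_space set \<Rightarrow> (('a \<Rightarrow> real) \<times> ('a \<Rightarrow> real)) set" where
  "Y_space s \<Omega> = X0 s \<Omega> \<times> X0 s \<Omega>"

text \<open>The convolution \<open>|x|\<^sup>-\<^sup>\<mu> * g\<close> over the whole space. It is only used for functions \<open>g\<close>
  that vanish outside \<open>\<Omega>\<close>, where it is the integral over \<open>\<Omega>\<close> of \<open>g y / |x - y|\<^sup>\<mu>\<close>.\<close>

definition riesz_conv :: "real \<Rightarrow> ('a::euclidean_space \<Rightarrow> real) \<Rightarrow> 'a \<Rightarrow> real" where
  "riesz_conv \<mu> g x = (LINT y|lebesgue. norm (x - y) powr (- \<mu>) * g y)"

definition weak_solution ::
    "real \<Rightarrow> real \<Rightarrow> real \<Rightarrow> 'a::euclidean_space set \<Rightarrow> real \<Rightarrow> real \<Rightarrow>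
     ('a \<Rightarrow> real) \<times> ('a \<Rightarrow> real) \<Rightarrow> bool" where
  "weak_solution s q \<mu> \<Omega> lam del = (\<lambda>(u, v).
     (u, v) \<in> Y_space s \<Omega> \<and>
     (let n = real DIM('a); p = crit_exp n s \<mu> in
      \<forall>(\<phi>, \<psi>) \<in> Y_space s \<Omega>.
        frac_const n s * (X0_inner s \<Omega> u \<phi> + X0_inner s \<Omega> v \<psi>) =
          (LINT x:\<Omega>|lebesgue. lam * \<bar>u x\<bar> powr (q - 2) * u x * \<phi> x
                             + del * \<bar>v x\<bar> powr (q - 2) * v x * \<psi> x)
        + (LINT x:\<Omega>|lebesgue. riesz_conv \<mu> (\<lambda>y. \<bar>v y\<bar> powr p) x
                             * \<bar>u x\<bar> powr (p - 2) * u x * \<phi> x)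
        + (LINT x:\<Omega>|lebesgue. riesz_conv \<mu> (\<lambda>y. \<bar>u y\<bar> powr p) x
                             * \<bar>v x\<bar> powr (p - 2) * v x * \<psi> x)))"

definition ae_equal_pair ::
    "('a::euclidean_space \<Rightarrow> real) \<times> ('a \<Rightarrow> real) \<Rightarrow> ('a \<Rightarrow> real) \<times> ('a \<Rightarrow> real) \<Rightarrow> bool" where
  "ae_equal_pair U V \<longleftrightarrow>
     (AE x in lebesgue. fst U x = fst V x) \<and> (AE x in lebesgue. snd U x = snd V x)"

definition nontrivial_pair ::
    "('a::euclidean_space \<Rightarrow> real) \<times> ('a \<Rightarrow> real) \<Rightarrow> bool" where
  "nontrivial_pair U \<longleftrightarrow> \<not> ae_equal_pair U (\<lambda>x. 0, \<lambda>x. 0)"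

definition two_nontrivial_solutions ::
    "real \<Rightarrow> real \<Rightarrow> real \<Rightarrow> 'a::euclidean_space set \<Rightarrow> real \<Rightarrow> real \<Rightarrow> bool" where
  "two_nontrivial_solutions s q \<mu> \<Omega> lam del \<longleftrightarrow>
     (\<exists>U V. weak_solution s q \<mu> \<Omega> lam del U \<and> nontrivial_pair U \<and>
            weak_solution s q \<mu> \<Omega> lam del V \<and> nontrivial_pair V \<and>
            \<not> ae_equal_pair U V)"

text \<open>Positivity at every point of \<open>\<Omega>\<close> is a condition on representatives; as solutions are
  sought up to null sets, existence is the same as with positivity almost everywhere.\<close>

definition positive_solution ::
    "real \<Rightarrow> real \<Rightarrow> real \<Rightarrow> 'a::euclidean_space set \<Rightarrow> real \<Rightarrow> real \<Rightarrow> bool" where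
  "positive_solution s q \<mu> \<Omega> lam del \<longleftrightarrow>
     (\<exists>u v. weak_solution s q \<mu> \<Omega> lam del (u, v) \<and> (\<forall>x\<in>\<Omega>. 0 < u x \<and> 0 < v x))"

end

theory Submission
  imports Defs
begin

text \<open>The system is odd, so a positive solution \<open>(u, v)\<close> yields the second solution \<open>(- u, - v)\<close>, and
  only one positive solution is needed. It is found below the critical level, by monotone
  iteration from above. Since the form charges the region outside \<open>\<Omega>\<close>, testing with
  \<open>(u - T)\<^sup>+\<close> gives an \<open>L\<^sup>\<infinity>\<close> bound for the linear problem; so for small parameters a constant \<open>M\<close> acts as a
  supersolution, neither the Sobolev nor the Hardy-Littlewood-Sobolev inequality enters, and the
  critical exponent and the sign of \<open>\<mu> - 4 s\<close> play no role. The system is cooperative, so the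
  iteration from \<open>M\<close> decreases to a solution. It stays above small multiples
  of \<open>(r\<^sup>2 - \<bar>x - c\<bar>\<^sup>2)\<^sub>+ ^ k\<close> for all small balls in \<open>\<Omega>\<close>, which are subsolutions because the concave
  term dominates near zero; this makes the limit positive.\<close>

section \<open>Kernel integrability\<close>

text \<open>The zero pair solves the system, so a decreasing iteration by itself could collapse to
  it; hence every iterate must be shown to stay above one fixed family of nonzero subsolutions. The
  concave power is not Lipschitz at 0, which rules out a contraction argument; monotonicity and
  pointwise limits take its place. The constant \<open>killing\<close> carries the quantitative
  part. Truncating at height \<open>T\<close> costs
  \<open>2 * T * killing * (\<integral>x. \<phi> x \<partial>lborel)\<close> of energy, so a
  right-hand side below \<open>2 * M * killing\<close> keeps the linear solution below
  \<open>M\<close>. This fixes both \<open>M\<close> and the smallness of the parameters. A second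
  difficulty is that comparison yields inequalities only almost everywhere, whereas the
  nonlinearities, their monotonicity and the limits are handled at every point. Iterates are
  therefore corrected on null sets after each step, and at the end once more to obtain positivity
  everywhere in \<Omega>.\<close>

lemma ennreal_term_le_suminf:
  fixes f :: "nat \<Rightarrow> ennreal"
  shows "f j \<le> (\<Sum>j. f j)"
  using sum_le_suminf[of f "{j}"] by simp

text \<open>Dyadic decomposition: for nonzero \<open>h\<close> the term whose annulus contains
  \<open>h\<close> already dominates, since a negative power is largest at the inner radius. Full
  balls replace the annuli because their volumes are explicit. At the origin the left side is 0, as
  \<open>0 powr a = 0\<close>.\<close>

lemma powr_ball_annuli_bound:
  fixes h :: "'a::real_normed_vector"
  assumes "0 \<le> a" "0 < R" "norm h < R"
  shows "ennreal (norm h powr (- a))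
    \<le> (\<Sum>j. ennreal ((R / 2 ^ Suc j) powr (- a)) * indicator (ball 0 (R / 2 ^ j)) h)"
proof (cases "h = 0")
  case False
  then have "0 < norm h" by simp
  define P where "P j \<longleftrightarrow> R / 2 ^ Suc j \<le> norm h" for j :: nat
  have "\<exists>j. P j"
  proof -
    obtain j :: nat where "R / norm h < 2 ^ j"
      using real_arch_pow[of 2 "R / norm h"] by auto
    moreover have "(2::real) ^ j \<le> 2 ^ Suc j" by simp
    ultimately have "R / norm h \<le> 2 ^ Suc j" by linarith
    then show ?thesis
      unfolding P_def using \<open>0 < norm h\<close> by (intro exI[of _ j]) (simp add: field_simps)
  qed
  \<comment> \<open>Minimality gives the outer bound \<open>norm h < R / 2 ^ j\<close>: for positive
    \<open>j\<close> because the predecessor fails \<open>P\<close>, for \<open>j = 0\<close> by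
    hypothesis.\<close>
  define j where "j = (LEAST j. P j)"
  have Pj: "P j" unfolding j_def using \<open>\<exists>j. P j\<close> by (rule LeastI_ex)
  have "norm h < R / 2 ^ j"
  proof (cases j)
    case 0
    then show ?thesis using assms by simp
  next
    case (Suc i)
    then have "\<not> P i" unfolding j_def using not_less_Least[of i P] by linarith
    then show ?thesis unfolding P_def Suc by simp
  qed
  then have ind: "h \<in> ball 0 (R / 2 ^ j)" by simp
  have "norm h powr (- a) \<le> (R / 2 ^ Suc j) powr (- a)"
    using Pj \<open>0 \<le> a\<close> \<open>0 < R\<close> unfolding P_def by (intro powr_mono2') (simp_all del: power_Suc)
  then have "ennreal (norm h powr (- a))
      \<le> ennreal ((R / 2 ^ Suc j) powr (- a)) * indicator (ball 0 (R / 2 ^ j)) h"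
    using ind by (simp add: ennreal_leI)
  also have "\<dots> \<le> (\<Sum>j. ennreal ((R / 2 ^ Suc j) powr (- a)) * indicator (ball 0 (R / 2 ^ j)) h)"
    by (rule ennreal_term_le_suminf[of "\<lambda>j. ennreal ((R / 2 ^ Suc j) powr (- a)) * indicator (ball 0 (R / 2 ^ j)) h" j])
  finally show ?thesis .
qed simp

lemma nn_integral_finite_if_le_balls:
  fixes f :: "'a::euclidean_space \<Rightarrow> ennreal" and d r :: "nat \<Rightarrow> real"
  assumes le: "\<And>h. f h \<le> (\<Sum>j. ennreal (d j) * indicator (ball 0 (r j)) h)"
    and d: "\<And>j. 0 \<le> d j" and r: "\<And>j. 0 \<le> r j"
    and sum: "summable (\<lambda>j. d j * (unit_ball_vol (real DIM('a)) * r j ^ DIM('a)))"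
  shows "(\<integral>\<^sup>+h. f h \<partial>lborel) < \<infinity>"
proof -
  have [measurable]: "ball (0::'a) (r j) \<in> sets borel" for j by simp
  have le_series: "(\<integral>\<^sup>+h. f h \<partial>lborel)
     \<le> (\<integral>\<^sup>+(h::'a). (\<Sum>j. ennreal (d j) * indicator (ball 0 (r j)) h) \<partial>lborel)"
    by (rule nn_integral_mono) (rule le)
  have swap: "(\<integral>\<^sup>+(h::'a). (\<Sum>j. ennreal (d j) * indicator (ball 0 (r j)) h) \<partial>lborel)
      = (\<Sum>j. \<integral>\<^sup>+(h::'a). ennreal (d j) * indicator (ball 0 (r j)) h \<partial>lborel)"
    by (rule nn_integral_suminf) measurable
  have ball: "(\<integral>\<^sup>+(h::'a). ennreal (d j) * indicator (ball 0 (r j)) h \<partial>lborel)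
      = ennreal (d j * (unit_ball_vol (real DIM('a)) * r j ^ DIM('a)))" for j
  proof -
    have "(\<integral>\<^sup>+(h::'a). ennreal (d j) * indicator (ball 0 (r j)) h \<partial>lborel)
        = ennreal (d j) * emeasure lborel (ball (0::'a) (r j))"
      by (rule nn_integral_cmult_indicator) simp
    then show ?thesis
      by (simp only: emeasure_ball[OF r] ennreal_mult'[OF d])
  qed
  have sum_finite: "(\<Sum>j. ennreal (d j * (unit_ball_vol (real DIM('a)) * r j ^ DIM('a)))) < \<infinity>"
  proof -
    have "(\<Sum>j. ennreal (d j * (unit_ball_vol (real DIM('a)) * r j ^ DIM('a)))) \<noteq> top"
      using d r by (intro ennreal_suminf_neq_top[OF sum] mult_nonneg_nonneg) auto
    then show ?thesis by (simp add: less_top)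
  qed
  show ?thesis
    using le_less_trans[OF le_series[unfolded swap ball] sum_finite] .
qed

text \<open>The terms of the dyadic series form a geometric series with ratio
  \<open>2 powr (a - real DIM('a))\<close>, which is below 1 exactly because \<open>a\<close> is
  below the dimension.\<close>

lemma integrable_norm_powr_ball:
  fixes a R :: real
  assumes "0 \<le> a" "a < real DIM('a)" "0 < R"
  shows "integrable lborel (\<lambda>h::'a::euclidean_space. indicator (ball 0 R) h * norm h powr (- a))"
proof -
  define V where "V = unit_ball_vol (real DIM('a))"
  have V: "0 \<le> V" unfolding V_def by simp
  define c where "c = 2 powr (a - real DIM('a))"
  have c: "0 \<le> c" "c < 1"
    unfolding c_def using assms powr_less_mono[of "a - real DIM('a)" 0 2] by auto
  have eq: "(R / 2 ^ Suc j) powr (- a) * (V * (R / 2 ^ j) ^ DIM('a))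
      = (V * (R / 2) powr (- a) * R ^ DIM('a)) * c ^ j" for j :: nat
  proof -
    have 1: "(R / 2 ^ Suc j) powr (- a) = (R / 2) powr (- a) * 2 powr (a * j)"
    proof -
      have "R / 2 ^ Suc j = (R / 2) * 2 powr (- real j)"
        by (simp add: powr_minus powr_realpow field_simps)
      then have "(R / 2 ^ Suc j) powr (- a) = (R / 2) powr (- a) * (2 powr (- real j)) powr (- a)"
        by (simp only: powr_mult)
      then show ?thesis
        by (simp add: powr_powr mult.commute)
    qed
    have 2: "(R / 2 ^ j) ^ DIM('a) = R ^ DIM('a) * 2 powr (- (real DIM('a) * j))"
      by (simp add: power_divide powr_minus flip: powr_realpow)
         (simp add: powr_powr field_simps)
    have 3: "c ^ j = 2 powr (a * j) * 2 powr (- (real DIM('a) * j))"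
      unfolding c_def by (simp add: powr_powr algebra_simps flip: powr_realpow powr_add)
    show ?thesis unfolding 1 2 3 by (simp add: algebra_simps)
  qed
  have "(\<integral>\<^sup>+(h::'a). ennreal (indicator (ball 0 R) h * norm h powr (- a)) \<partial>lborel) < \<infinity>"
  proof (rule nn_integral_finite_if_le_balls)
    show "ennreal (indicator (ball 0 R) h * norm h powr (- a))
        \<le> (\<Sum>j. ennreal ((R / 2 ^ Suc j) powr (- a)) * indicator (ball 0 (R / 2 ^ j)) h)" for h :: 'a
      using powr_ball_annuli_bound[of a R h] assms by (cases "norm h < R") auto
    show "summable (\<lambda>j. (R / 2 ^ Suc j) powr (- a)
        * (unit_ball_vol (real DIM('a)) * (R / 2 ^ j) ^ DIM('a)))"
      unfolding eq[unfolded V_def] using c by (intro summable_mult summable_geometric) auto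
  qed (use assms in auto)
  moreover have "(\<lambda>h::'a. indicator (ball 0 R) h * norm h powr (- a)) \<in> borel_measurable lborel"
    by (intro borel_measurable_times borel_measurable_indicator powr_real_measurable
      borel_measurable_const borel_measurable_norm) auto
  ultimately show ?thesis
    by (intro integrableI_nonneg) auto
qed

lemma powr_outside_annuli_bound:
  fixes h :: "'a::real_normed_vector"
  assumes "0 \<le> b" "1 \<le> norm h"
  shows "ennreal (norm h powr (- b))
    \<le> (\<Sum>j. ennreal ((2 ^ j) powr (- b)) * indicator (ball 0 (2 ^ Suc j)) h)"
proof -
  define P where "P j \<longleftrightarrow> norm h < 2 ^ Suc j" for j :: nat
  have "\<exists>j. P j"
  proof -
    obtain j :: nat where "norm h < 2 ^ j"
      using real_arch_pow[of 2 "norm h"] by auto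
    moreover have "(2::real) ^ j \<le> 2 ^ Suc j" by simp
    ultimately have "norm h < 2 ^ Suc j" by linarith
    then show ?thesis unfolding P_def by blast
  qed
  define j where "j = (LEAST j. P j)"
  have Pj: "P j" unfolding j_def using \<open>\<exists>j. P j\<close> by (rule LeastI_ex)
  have "2 ^ j \<le> norm h"
  proof (cases j)
    case 0
    then show ?thesis using assms by simp
  next
    case (Suc i)
    then have "\<not> P i" unfolding j_def using not_less_Least[of i P] by linarith
    then show ?thesis unfolding P_def Suc by simp
  qed
  then have "norm h powr (- b) \<le> (2 ^ j) powr (- b)"
    using assms by (intro powr_mono2') auto
  then have "ennreal (norm h powr (- b))
      \<le> ennreal ((2 ^ j) powr (- b)) * indicator (ball 0 (2 ^ Suc j)) h"
    using Pj unfolding P_def by (simp add: ennreal_leI)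
  also have "\<dots> \<le> (\<Sum>j. ennreal ((2 ^ j) powr (- b)) * indicator (ball 0 (2 ^ Suc j)) h)"
    by (rule ennreal_term_le_suminf[of "\<lambda>j. ennreal ((2 ^ j) powr (- b)) * indicator (ball 0 (2 ^ Suc j)) h" j])
  finally show ?thesis .
qed

text \<open>The counterpart at infinity: the dyadic radii now grow, and the ratio is
  \<open>2 powr (real DIM('a) - b)\<close>.\<close>

lemma integrable_norm_powr_outside_ball:
  fixes b :: real
  assumes "real DIM('a) < b"
  shows "integrable lborel (\<lambda>h::'a::euclidean_space. indicator (- ball 0 1) h * norm h powr (- b))"
proof -
  define V where "V = unit_ball_vol (real DIM('a))"
  have V: "0 \<le> V" unfolding V_def by simp
  have b: "0 \<le> b" using assms by simp
  define c where "c = 2 powr (real DIM('a) - b)"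
  have c: "0 \<le> c" "c < 1"
    unfolding c_def using assms powr_less_mono[of "real DIM('a) - b" 0 2] by auto
  have eq: "(2 ^ j) powr (- b) * (V * (2 ^ Suc j) ^ DIM('a)) = (V * 2 ^ DIM('a)) * c ^ j" for j :: nat
  proof -
    have 1: "(2 ^ j) powr (- b) = 2 powr (- (b * j))"
      by (simp add: powr_powr mult.commute flip: powr_realpow)
    have 2: "(2 ^ Suc j) ^ DIM('a) = 2 ^ DIM('a) * (2::real) powr (real DIM('a) * j)"
      by (simp add: powr_powr power_mult_distrib mult.commute flip: powr_realpow)
    have 3: "c ^ j = 2 powr (- (b * j)) * 2 powr (real DIM('a) * j)"
      unfolding c_def by (simp add: powr_powr algebra_simps flip: powr_realpow powr_add)
    show ?thesis unfolding 1 2 3 by (simp add: algebra_simps)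
  qed
  have "(\<integral>\<^sup>+(h::'a). ennreal (indicator (- ball 0 1) h * norm h powr (- b)) \<partial>lborel) < \<infinity>"
  proof (rule nn_integral_finite_if_le_balls)
    show "ennreal (indicator (- ball 0 1) h * norm h powr (- b))
        \<le> (\<Sum>j. ennreal ((2 ^ j) powr (- b)) * indicator (ball 0 (2 ^ Suc j)) h)" for h :: 'a
      using powr_outside_annuli_bound[of b h] b by (cases "1 \<le> norm h") auto
    show "summable (\<lambda>j. (2 ^ j) powr (- b)
        * (unit_ball_vol (real DIM('a)) * (2 ^ Suc j) ^ DIM('a)))"
      unfolding eq[unfolded V_def] using c by (intro summable_mult summable_geometric) auto
  qed auto
  moreover have "(\<lambda>h::'a. indicator (- ball 0 1) h * norm h powr (- b)) \<in> borel_measurable lborel"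
    by (intro borel_measurable_times borel_measurable_indicator powr_real_measurable
      borel_measurable_const borel_measurable_norm) auto
  ultimately show ?thesis
    by (intro integrableI_nonneg) auto
qed

section \<open>The kernel of the fractional Laplacian\<close>

text \<open>The Gagliardo kernel without its normalising constant. At the origin it is 0, since
  division by 0 gives 0, so the diagonal is harmless pointwise as well as in measure.\<close>

definition frac_kernel :: "real \<Rightarrow> 'a::euclidean_space \<Rightarrow> real" where
  "frac_kernel s h = 1 / norm h powr (real DIM('a) + 2 * s)"

lemma frac_kernel_nonneg [simp]: "0 \<le> frac_kernel s h"
  by (simp add: frac_kernel_def)

lemma frac_kernel_minus [simp]: "frac_kernel s (- h) = frac_kernel s h"
  by (simp add: frac_kernel_def)

lemma frac_kernel_commute: "frac_kernel s (x - y) = frac_kernel s (y - x)"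
  by (simp add: frac_kernel_def norm_minus_commute)

lemma frac_kernel_measurable [measurable]: "frac_kernel s \<in> borel_measurable borel"
  unfolding frac_kernel_def[abs_def] by measurable

text \<open>The Levy condition for the kernel. Near 0 the square lowers the order of the singularity
  to n + 2s - 2, below n because s < 1; at infinity the decay of order n + 2s is fast enough because
  s > 0.\<close>

lemma integrable_min_sq_frac_kernel:
  fixes s :: real
  assumes "0 < s" "s < 1"
  shows "integrable lborel (\<lambda>h::'a::euclidean_space. min ((norm h)\<^sup>2) 1 * frac_kernel s h)"
proof -
  \<comment> \<open>In dimension 1 the order n + 2s - 2 may be negative. Raising it to 0 only
    enlarges the majorant, since it is used inside the unit ball.\<close>
  define a where "a = max 0 (real DIM('a) + 2 * s - 2)"
  have dim: "1 \<le> real DIM('a)"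
    using DIM_positive[where 'a='a] by linarith
  have a: "0 \<le> a" "a < real DIM('a)"
    using assms dim unfolding a_def by auto
  let ?g = "\<lambda>h::'a. indicator (ball 0 1) h * norm h powr (- a)
         + indicator (- ball 0 1) h * norm h powr (- (real DIM('a) + 2 * s))"
  have "integrable lborel ?g"
    using assms by (intro Bochner_Integration.integrable_add
      integrable_norm_powr_outside_ball integrable_norm_powr_ball a) auto
  then show ?thesis
  proof (rule Bochner_Integration.integrable_bound)
    show "AE h::'a in lborel. norm (min ((norm h)\<^sup>2) 1 * frac_kernel s h) \<le> norm (?g h)"
    proof (intro AE_I2)
      fix h :: 'a
      show "norm (min ((norm h)\<^sup>2) 1 * frac_kernel s h) \<le> norm (?g h)"
      proof (cases "norm h < 1")
        case True
        show ?thesis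
        proof (cases "h = 0")
          case False
          then have pos: "0 < norm h" by simp
          have "min ((norm h)\<^sup>2) 1 * frac_kernel s h \<le> (norm h)\<^sup>2 * frac_kernel s h"
            by (intro mult_right_mono) auto
          also have "\<dots> = norm h powr (- (real DIM('a) + 2 * s - 2))"
          proof -
            have "(norm h)\<^sup>2 * frac_kernel s h = norm h powr 2 / norm h powr (real DIM('a) + 2 * s)"
              unfolding frac_kernel_def using pos by simp
            also have "\<dots> = norm h powr (2 - (real DIM('a) + 2 * s))"
              by (simp only: powr_diff)
            finally show ?thesis by (simp only: minus_diff_eq)
          qed
          also have "\<dots> \<le> norm h powr (- a)"
            unfolding a_def using pos True by (intro powr_mono') auto
          finally show ?thesis using True by simp
        qed (simp add: frac_kernel_def)
      next
        case False
        then have "1 \<le> (norm h)\<^sup>2" by (simp add: one_le_power)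
        then have "min ((norm h)\<^sup>2) 1 * frac_kernel s h = frac_kernel s h" by (simp add: min_def)
        also have "\<dots> = norm h powr (- (real DIM('a) + 2 * s))"
          by (simp only: frac_kernel_def powr_minus_divide)
        finally show ?thesis using False by simp
      qed
    qed
  qed measurable
qed

lemma integrable_frac_kernel_outside:
  fixes s \<epsilon> :: real
  assumes "0 < s" "s < 1" "0 < \<epsilon>"
  shows "integrable lborel (\<lambda>h::'a::euclidean_space. indicator (- ball 0 \<epsilon>) h * frac_kernel s h)"
proof (rule Bochner_Integration.integrable_bound)
  show "integrable lborel (\<lambda>h::'a. (1 / min (\<epsilon>\<^sup>2) 1) * (min ((norm h)\<^sup>2) 1 * frac_kernel s h))"
    by (intro integrable_mult_right integrable_min_sq_frac_kernel assms)
  show "AE h::'a in lborel. norm (indicator (- ball 0 \<epsilon>) h * frac_kernel s h)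
      \<le> norm ((1 / min (\<epsilon>\<^sup>2) 1) * (min ((norm h)\<^sup>2) 1 * frac_kernel s h))"
  proof (intro AE_I2)
    fix h :: 'a
    have "frac_kernel s h \<le> (1 / min (\<epsilon>\<^sup>2) 1) * (min ((norm h)\<^sup>2) 1 * frac_kernel s h)"
      if "\<epsilon> \<le> norm h"
    proof -
      have "\<epsilon>\<^sup>2 \<le> (norm h)\<^sup>2" using that assms by (intro power_mono) auto
      then have "min (\<epsilon>\<^sup>2) 1 \<le> min ((norm h)\<^sup>2) 1" by auto
      moreover have "0 < min (\<epsilon>\<^sup>2) 1" using assms by simp
      ultimately have "1 \<le> (1 / min (\<epsilon>\<^sup>2) 1) * min ((norm h)\<^sup>2) 1" by (simp add: field_simps)
      then have "1 * frac_kernel s h \<le> ((1 / min (\<epsilon>\<^sup>2) 1) * min ((norm h)\<^sup>2) 1) * frac_kernel s h"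
        by (intro mult_right_mono) auto
      then show ?thesis by (simp add: mult.assoc)
    qed
    then show "norm (indicator (- ball 0 \<epsilon>) h * frac_kernel s h)
      \<le> norm ((1 / min (\<epsilon>\<^sup>2) 1) * (min ((norm h)\<^sup>2) 1 * frac_kernel s h))"
      using assms by (auto split: split_indicator simp: abs_mult)
  qed
qed measurable

section \<open>The energy space and its form\<close>

locale frac_domain =
  fixes s :: real and \<Omega> :: "'a::euclidean_space set"
  assumes s_pos: "0 < s" and s_less_1: "s < 1"
    and open_domain: "open \<Omega>" and bounded_domain: "bounded \<Omega>"
begin

abbreviation lborel2 :: "('a \<times> 'a) measure" where
  "lborel2 \<equiv> lborel \<Otimes>\<^sub>M lborel"

abbreviation pair_kernel :: "'a \<times> 'a \<Rightarrow> real" where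
  "pair_kernel z \<equiv> frac_kernel s (fst z - snd z)"

text \<open>Borel representatives of the elements of \<open>X0\<close>, so that Fubini applies on
  \<open>lborel2\<close>. Integrating over the whole product instead of
  \<open>Q_set \<Omega>\<close> changes nothing, as differences vanish when both points lie outside
  \<Omega>. Square integrability is a consequence, by \<open>poincare\<close>.\<close>

definition energy :: "('a \<Rightarrow> real) set" where
  "energy = {u. u \<in> borel_measurable borel \<and> (\<forall>x. x \<notin> \<Omega> \<longrightarrow> u x = 0) \<and>
     integrable lborel2 (\<lambda>z. (u (fst z) - u (snd z))\<^sup>2 * pair_kernel z)}"

definition form :: "('a \<Rightarrow> real) \<Rightarrow> ('a \<Rightarrow> real) \<Rightarrow> real" where
  "form u v = (\<integral>z. (u (fst z) - u (snd z)) * (v (fst z) - v (snd z)) * pair_kernel z \<partial>lborel2)"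

lemma domain_borel [measurable]: "\<Omega> \<in> sets borel"
  using open_domain by simp

lemma emeasure_domain: "emeasure lborel \<Omega> < \<infinity>"
  by (rule emeasure_bounded_finite[OF bounded_domain])

lemma energy_measurable: "u \<in> energy \<Longrightarrow> u \<in> borel_measurable borel"
  by (simp add: energy_def)

lemma energy_outside: "u \<in> energy \<Longrightarrow> x \<notin> \<Omega> \<Longrightarrow> u x = 0"
  by (simp add: energy_def)

lemma energy_integrable:
  "u \<in> energy \<Longrightarrow> integrable lborel2 (\<lambda>z. (u (fst z) - u (snd z))\<^sup>2 * pair_kernel z)"
  by (simp add: energy_def)

text \<open>The common source of closure under linear combinations and truncations; the integrand is
  dominated through (a + b)^2 \<le> 2 a^2 + 2 b^2.\<close>

lemma energy_if_differences_le:
  assumes [measurable]: "w \<in> borel_measurable borel"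
    and u: "u \<in> energy" and v: "v \<in> energy"
    and out: "\<And>x. x \<notin> \<Omega> \<Longrightarrow> w x = 0"
    and le: "\<And>x y. \<bar>w x - w y\<bar> \<le> c * (\<bar>u x - u y\<bar> + \<bar>v x - v y\<bar>)"
  shows "w \<in> energy"
proof -
  let ?g = "\<lambda>z. 2 * c\<^sup>2 * ((u (fst z) - u (snd z))\<^sup>2 * pair_kernel z)
     + 2 * c\<^sup>2 * ((v (fst z) - v (snd z))\<^sup>2 * pair_kernel z)"
  have "integrable lborel2 ?g"
    using u v by (intro Bochner_Integration.integrable_add integrable_mult_right energy_integrable)
  then have "integrable lborel2 (\<lambda>z. (w (fst z) - w (snd z))\<^sup>2 * pair_kernel z)"
  proof (rule Bochner_Integration.integrable_bound)
    show "AE z in lborel2. norm ((w (fst z) - w (snd z))\<^sup>2 * pair_kernel z) \<le> norm (?g z)"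
    proof (intro AE_I2)
      fix z :: "'a \<times> 'a"
      define a b where "a = \<bar>u (fst z) - u (snd z)\<bar>" and "b = \<bar>v (fst z) - v (snd z)\<bar>"
      have "\<bar>w (fst z) - w (snd z)\<bar>\<^sup>2 \<le> (c * (a + b))\<^sup>2"
        unfolding a_def b_def by (intro power_mono le) auto
      also have "\<dots> \<le> 2 * c\<^sup>2 * a\<^sup>2 + 2 * c\<^sup>2 * b\<^sup>2"
      proof -
        have "(a + b)\<^sup>2 \<le> 2 * a\<^sup>2 + 2 * b\<^sup>2"
          using sum_squares_bound[of a b] by (simp add: power2_sum)
        then have "c\<^sup>2 * (a + b)\<^sup>2 \<le> c\<^sup>2 * (2 * a\<^sup>2 + 2 * b\<^sup>2)"
          by (intro mult_left_mono) auto
        then show ?thesis unfolding power_mult_distrib by (simp add: distrib_left ac_simps)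
      qed
      finally have "(w (fst z) - w (snd z))\<^sup>2 * pair_kernel z
          \<le> (2 * c\<^sup>2 * a\<^sup>2 + 2 * c\<^sup>2 * b\<^sup>2) * pair_kernel z"
        by (intro mult_right_mono) auto
      also have "\<dots> = ?g z"
        unfolding a_def b_def by (simp add: algebra_simps)
      finally show "norm ((w (fst z) - w (snd z))\<^sup>2 * pair_kernel z) \<le> norm (?g z)" by simp
    qed
  qed measurable
  then show ?thesis using out by (simp add: energy_def)
qed

lemma zero_energy: "(\<lambda>x. 0) \<in> energy"
  by (simp add: energy_def)

lemma linear_energy:
  assumes "u \<in> energy" "v \<in> energy"
  shows "(\<lambda>x. a * u x + b * v x) \<in> energy"
proof (rule energy_if_differences_le[where c = "\<bar>a\<bar> + \<bar>b\<bar>"])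
  have [measurable]: "u \<in> borel_measurable borel" "v \<in> borel_measurable borel"
    using assms by (auto intro: energy_measurable)
  show "(\<lambda>x. a * u x + b * v x) \<in> borel_measurable borel" by measurable
  fix x y
  have "a * u x + b * v x - (a * u y + b * v y) = a * (u x - u y) + b * (v x - v y)"
    by (simp add: algebra_simps)
  also have "\<bar>\<dots>\<bar> \<le> \<bar>a\<bar> * \<bar>u x - u y\<bar> + \<bar>b\<bar> * \<bar>v x - v y\<bar>"
    by (rule order.trans[OF abs_triangle_ineq]) (simp add: abs_mult)
  also have "\<dots> \<le> (\<bar>a\<bar> + \<bar>b\<bar>) * (\<bar>u x - u y\<bar> + \<bar>v x - v y\<bar>)"
    by (simp add: algebra_simps)
  finally show "\<bar>a * u x + b * v x - (a * u y + b * v y)\<bar>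
      \<le> (\<bar>a\<bar> + \<bar>b\<bar>) * (\<bar>u x - u y\<bar> + \<bar>v x - v y\<bar>)" .
qed (use assms in \<open>auto simp: energy_outside\<close>)

lemma diff_energy: "u \<in> energy \<Longrightarrow> v \<in> energy \<Longrightarrow> (\<lambda>x. u x - v x) \<in> energy"
  using linear_energy[of u v 1 "-1"] by simp

lemma truncation_energy:
  assumes w: "w \<in> energy" and "0 \<le> T"
  shows "(\<lambda>x. max 0 (w x - T)) \<in> energy"
proof (rule energy_if_differences_le[where c = 1])
  have [measurable]: "w \<in> borel_measurable borel" using w by (rule energy_measurable)
  show "(\<lambda>x. max 0 (w x - T)) \<in> borel_measurable borel" by measurable
  show "\<bar>max 0 (w x - T) - max 0 (w y - T)\<bar> \<le> 1 * (\<bar>w x - w y\<bar> + \<bar>w x - w y\<bar>)" for x y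
    by (auto simp: max_def)
qed (use assms in \<open>auto simp: energy_outside\<close>)

lemma form_integrable:
  assumes u: "u \<in> energy" and v: "v \<in> energy"
  shows "integrable lborel2 (\<lambda>z. (u (fst z) - u (snd z)) * (v (fst z) - v (snd z)) * pair_kernel z)"
proof (rule Bochner_Integration.integrable_bound)
  let ?g = "\<lambda>z. (u (fst z) - u (snd z))\<^sup>2 * pair_kernel z + (v (fst z) - v (snd z))\<^sup>2 * pair_kernel z"
  have [measurable]: "u \<in> borel_measurable borel" "v \<in> borel_measurable borel"
    using assms by (auto intro: energy_measurable)
  show "integrable lborel2 ?g"
    by (intro Bochner_Integration.integrable_add energy_integrable u v)
  show "AE z in lborel2. norm ((u (fst z) - u (snd z)) * (v (fst z) - v (snd z)) * pair_kernel z) \<le> norm (?g z)"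
  proof (intro AE_I2)
    fix z :: "'a \<times> 'a"
    have "\<bar>a * b\<bar> \<le> a\<^sup>2 + b\<^sup>2" for a b :: real
    proof -
      have "0 \<le> \<bar>a * b\<bar>" by simp
      moreover have "2 * \<bar>a * b\<bar> \<le> a\<^sup>2 + b\<^sup>2"
        using sum_squares_bound[of "\<bar>a\<bar>" "\<bar>b\<bar>"] by (simp add: abs_mult)
      ultimately show ?thesis by linarith
    qed
    then have "\<bar>(u (fst z) - u (snd z)) * (v (fst z) - v (snd z))\<bar> * pair_kernel z
       \<le> ((u (fst z) - u (snd z))\<^sup>2 + (v (fst z) - v (snd z))\<^sup>2) * pair_kernel z"
      by (intro mult_right_mono) auto
    then show "norm ((u (fst z) - u (snd z)) * (v (fst z) - v (snd z)) * pair_kernel z) \<le> norm (?g z)"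
      by (simp add: abs_mult distrib_right)
  qed
  show "(\<lambda>z. (u (fst z) - u (snd z)) * (v (fst z) - v (snd z)) * pair_kernel z) \<in> borel_measurable lborel2"
    by measurable
qed

lemma form_commute: "form u v = form v u"
  by (simp add: form_def mult.commute)

lemma form_linear_left:
  assumes "u \<in> energy" "v \<in> energy" "\<phi> \<in> energy"
  shows "form (\<lambda>x. a * u x + b * v x) \<phi> = a * form u \<phi> + b * form v \<phi>"
proof -
  have "form (\<lambda>x. a * u x + b * v x) \<phi> =
    (\<integral>z. a * ((u (fst z) - u (snd z)) * (\<phi> (fst z) - \<phi> (snd z)) * pair_kernel z)
       + b * ((v (fst z) - v (snd z)) * (\<phi> (fst z) - \<phi> (snd z)) * pair_kernel z) \<partial>lborel2)"
    unfolding form_def by (intro Bochner_Integration.integral_cong) (auto simp: algebra_simps)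
  also have "\<dots> = a * form u \<phi> + b * form v \<phi>"
    unfolding form_def
    by (subst Bochner_Integration.integral_add) (auto intro!: integrable_mult_right form_integrable assms)
  finally show ?thesis .
qed

lemma form_diff_left:
  assumes "u \<in> energy" "v \<in> energy" "\<phi> \<in> energy"
  shows "form (\<lambda>x. u x - v x) \<phi> = form u \<phi> - form v \<phi>"
  using form_linear_left[OF assms, of 1 "-1"] by simp

lemma form_linear_square:
  assumes "u \<in> energy" "v \<in> energy"
  shows "form (\<lambda>x. a * u x + b * v x) (\<lambda>x. a * u x + b * v x)
    = a\<^sup>2 * form u u + 2 * a * b * form u v + b\<^sup>2 * form v v"
proof -
  let ?w = "\<lambda>x. a * u x + b * v x"
  have "form u ?w = a * form u u + b * form u v" "form v ?w = a * form u v + b * form v v"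
    unfolding form_commute[of _ ?w] form_linear_left[OF assms assms(1)] form_linear_left[OF assms assms(2)]
    by (simp_all add: form_commute[of v u])
  then show ?thesis
    unfolding form_linear_left[OF assms linear_energy[OF assms]]
    by (simp add: power2_eq_square distrib_left)
qed

text \<open>A ball \<open>A\<close> away from \<open>\<Omega>\<close> sees every point of \<open>\<Omega>\<close> with kernel at least \<open>k > 0\<close>. Since
  functions in the energy space vanish on \<open>A\<close>, this gives the Poincare inequality and, for
  truncations, an \<open>L\<^sup>\<infinity>\<close> bound, without any Sobolev embedding.\<close>

lemma exterior_ball:
  obtains p :: 'a and k :: real where "0 < k" "ball p 1 \<inter> \<Omega> = {}"
    "\<And>x y. x \<in> \<Omega> \<Longrightarrow> y \<in> ball p 1 \<Longrightarrow> k \<le> frac_kernel s (x - y)"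
proof -
  obtain R where R: "0 < R" "\<And>x. x \<in> \<Omega> \<Longrightarrow> norm x < R"
    using bounded_domain bounded_pos_less by blast
  obtain e :: 'a where e: "e \<in> Basis" using nonempty_Basis by blast
  define p where "p = (R + 2) *\<^sub>R e"
  have np: "norm p = R + 2" unfolding p_def using e R by simp
  have far: "R < norm y" if "y \<in> ball p 1" for y
  proof -
    have "norm p \<le> norm y + norm (p - y)"
      using norm_triangle_ineq[of y "p - y"] by simp
    then show ?thesis using that np by (simp add: dist_norm)
  qed
  define k where "k = 1 / (2 * R + 3) powr (real DIM('a) + 2 * s)"
  show ?thesis
  proof
    show "0 < k" unfolding k_def using R by simp
    show "ball p 1 \<inter> \<Omega> = {}" using far R by force
    fix x y assume xy: "x \<in> \<Omega>" "y \<in> ball p 1"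
    have "norm y \<le> norm p + norm (p - y)"
      using norm_triangle_ineq4[of p "p - y"] by simp
    then have "norm y \<le> R + 3" using xy np by (simp add: dist_norm)
    then have le: "norm (x - y) \<le> 2 * R + 3"
      using norm_triangle_ineq4[of x y] R(2)[OF xy(1)] by linarith
    have "0 < norm (x - y)" using far[OF xy(2)] R(2)[OF xy(1)] by force
    then show "k \<le> frac_kernel s (x - y)"
      unfolding k_def frac_kernel_def using le s_pos
      by (intro divide_left_mono powr_mono2 mult_pos_pos) auto
  qed
qed

text \<open>The constant is the lower bound \<open>k\<close> of the kernel times the volume
  \<open>m\<close> of the exterior ball; the factor 2 counts both orders of a pair. \<open>F\<close>
  and \<open>g\<close> are kept abstract so that the same constant serves the Poincare inequality,
  with \<open>g\<close> the square of a function, and the truncation estimate, with \<open>g\<close>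
  a multiple of the truncation.\<close>

lemma killing_constant_exists:
  "\<exists>\<kappa>>0. \<forall>F g. integrable lborel2 F \<longrightarrow> g \<in> borel_measurable borel \<longrightarrow> (\<forall>x. 0 \<le> g x) \<longrightarrow>
    (\<forall>z. 0 \<le> F z) \<longrightarrow>
    (\<forall>x\<in>\<Omega>. \<forall>y. y \<notin> \<Omega> \<longrightarrow> g x * frac_kernel s (x - y) \<le> F (x, y) \<and> g x * frac_kernel s (x - y) \<le> F (y, x)) \<longrightarrow>
    (\<forall>x. x \<notin> \<Omega> \<longrightarrow> g x = 0) \<longrightarrow>
    integrable lborel g \<and> 2 * \<kappa> * (\<integral>x. g x \<partial>lborel) \<le> (\<integral>z. F z \<partial>lborel2)"
proof -
  obtain p :: 'a and k where k: "0 < k" and disj: "ball p 1 \<inter> \<Omega> = {}"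
    and kle: "\<And>x y. x \<in> \<Omega> \<Longrightarrow> y \<in> ball p 1 \<Longrightarrow> k \<le> frac_kernel s (x - y)"
    by (rule exterior_ball) blast
  define A where "A = ball p 1"
  have [measurable]: "A \<in> sets borel" unfolding A_def by simp
  define m where "m = unit_ball_vol (real DIM('a))"
  have m: "0 < m" unfolding m_def by simp
  have mA: "emeasure lborel A = ennreal m"
    unfolding A_def m_def by (simp add: emeasure_ball)
  show ?thesis
  proof (intro exI[of _ "k * m"] conjI allI impI)
    show "0 < k * m" using k m by simp
  next
    fix F :: "'a \<times> 'a \<Rightarrow> real" and g :: "'a \<Rightarrow> real"
    assume F: "integrable lborel2 F" and g [measurable]: "g \<in> borel_measurable borel"
      and g0: "\<forall>x. 0 \<le> g x" and F0: "\<forall>z. 0 \<le> F z"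
      and le: "\<forall>x\<in>\<Omega>. \<forall>y. y \<notin> \<Omega> \<longrightarrow>
        g x * frac_kernel s (x - y) \<le> F (x, y) \<and> g x * frac_kernel s (x - y) \<le> F (y, x)"
      and out: "\<forall>x. x \<notin> \<Omega> \<longrightarrow> g x = 0"
    \<comment> \<open>At most one of the two summands is nonzero, because \<open>g\<close> lives on
      \<Omega> and \<open>A\<close> is disjoint from \<Omega>.\<close>
    have pw: "k * (g x * indicator A y) + k * (g y * indicator A x) \<le> F (x, y)" for x y
    proof -
      have 1: "k * g x \<le> F (x, y) \<and> k * g x \<le> F (y, x)" if "x \<in> \<Omega>" "y \<in> A" for x y
      proof -
        have "y \<notin> \<Omega>" using that disj unfolding A_def by auto
        moreover have "k * g x \<le> g x * frac_kernel s (x - y)"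
          using kle[OF that(1)] that(2) g0 unfolding A_def
          by (subst mult.commute) (intro mult_left_mono, auto)
        ultimately show ?thesis using le that(1) by (meson order.trans)
      qed
      show ?thesis
      proof (cases "x \<in> \<Omega>")
        case True
        then have "x \<notin> A" using disj unfolding A_def by auto
        then show ?thesis using 1[OF True, of y] F0 by (cases "y \<in> A") auto
      next
        case False
        then have "g x = 0" using out by simp
        then show ?thesis using 1[of y x] F0 out by (cases "y \<in> \<Omega>"; cases "x \<in> A") auto
      qed
    qed
    have G: "(\<integral>\<^sup>+z. ennreal (g (fst z)) * indicator A (snd z) \<partial>lborel2) = ennreal m * (\<integral>\<^sup>+x. g x \<partial>lborel)"
    proof -
      have "(\<integral>\<^sup>+z. ennreal (g (fst z)) * indicator A (snd z) \<partial>lborel2)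
          = (\<integral>\<^sup>+x. \<integral>\<^sup>+y. ennreal (g x) * indicator A y \<partial>lborel \<partial>lborel)"
      proof -
        have "(\<lambda>z. ennreal (g (fst z)) * indicator A (snd z)) \<in> borel_measurable lborel2"
          by measurable
        from lborel.nn_integral_fst[OF this] show ?thesis by simp
      qed
      also have "\<dots> = (\<integral>\<^sup>+x. ennreal m * ennreal (g x) \<partial>lborel)"
        by (intro nn_integral_cong) (simp add: nn_integral_cmult_indicator mA mult.commute)
      also have "\<dots> = ennreal m * (\<integral>\<^sup>+x. g x \<partial>lborel)"
        by (subst nn_integral_cmult) auto
      finally show ?thesis .
    qed
    have G': "(\<integral>\<^sup>+z. ennreal (g (snd z)) * indicator A (fst z) \<partial>lborel2) = ennreal m * (\<integral>\<^sup>+x. g x \<partial>lborel)"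
    proof -
      have "(\<integral>\<^sup>+z. ennreal (g (snd z)) * indicator A (fst z) \<partial>lborel2)
          = (\<integral>\<^sup>+y. \<integral>\<^sup>+x. ennreal (g y) * indicator A x \<partial>lborel \<partial>lborel)"
      proof -
        have "(\<lambda>z. ennreal (g (snd z)) * indicator A (fst z)) \<in> borel_measurable lborel2"
          by measurable
        from lborel_pair.nn_integral_snd[OF this] show ?thesis by simp
      qed
      also have "\<dots> = (\<integral>\<^sup>+x. ennreal m * ennreal (g x) \<partial>lborel)"
        by (intro nn_integral_cong) (simp add: nn_integral_cmult_indicator mA mult.commute)
      also have "\<dots> = ennreal m * (\<integral>\<^sup>+x. g x \<partial>lborel)"
        by (subst nn_integral_cmult) auto
      finally show ?thesis .
    qed
    define I where "I = (\<integral>\<^sup>+x. g x \<partial>lborel)"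
    have "ennreal (2 * (k * m)) * I
      = ennreal k * (ennreal m * I) + ennreal k * (ennreal m * I)"
    proof -
      have "ennreal (2 * (k * m)) = ennreal k * ennreal m + ennreal k * ennreal m"
        using k m by (simp flip: ennreal_mult ennreal_plus)
      then show ?thesis by (simp add: distrib_right mult.assoc)
    qed
    also have "\<dots> = (\<integral>\<^sup>+z. ennreal k * (ennreal (g (fst z)) * indicator A (snd z))
        + ennreal k * (ennreal (g (snd z)) * indicator A (fst z)) \<partial>lborel2)"
    proof -
      have m: "(\<lambda>z. ennreal (g (fst z)) * indicator A (snd z)) \<in> borel_measurable lborel2"
        "(\<lambda>z. ennreal (g (snd z)) * indicator A (fst z)) \<in> borel_measurable lborel2"
        by measurable
      have "(\<lambda>z. ennreal k * (ennreal (g (fst z)) * indicator A (snd z))) \<in> borel_measurable lborel2"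
        "(\<lambda>z. ennreal k * (ennreal (g (snd z)) * indicator A (fst z))) \<in> borel_measurable lborel2"
        by measurable
      then show ?thesis
        by (simp only: nn_integral_add nn_integral_cmult[OF m(1)] nn_integral_cmult[OF m(2)] G G' I_def)
    qed
    also have "\<dots> \<le> (\<integral>\<^sup>+z. ennreal (F z) \<partial>lborel2)"
    proof (intro nn_integral_mono)
      fix z :: "'a \<times> 'a"
      have "ennreal k * (ennreal (g (fst z)) * indicator A (snd z))
        + ennreal k * (ennreal (g (snd z)) * indicator A (fst z))
        = ennreal (k * (g (fst z) * indicator A (snd z)) + k * (g (snd z) * indicator A (fst z)))"
        using k g0 by (auto simp: ennreal_mult'' ennreal_mult split: split_indicator)
      also have "\<dots> \<le> ennreal (F z)"
        using pw[of "fst z" "snd z"] by (intro ennreal_leI) simp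
      finally show "ennreal k * (ennreal (g (fst z)) * indicator A (snd z))
        + ennreal k * (ennreal (g (snd z)) * indicator A (fst z)) \<le> ennreal (F z)" .
    qed
    also have "\<dots> = ennreal (\<integral>z. F z \<partial>lborel2)"
      using F F0 by (intro nn_integral_eq_integral) auto
    finally have main: "ennreal (2 * (k * m)) * I \<le> ennreal (\<integral>z. F z \<partial>lborel2)" .
    \<comment> \<open>An infinite \<open>I\<close> would make the left side of \<open>main\<close>
      infinite, since its coefficient is positive. This is how integrability of \<open>g\<close>
      comes out of the estimate.\<close>
    have "I < \<infinity>"
    proof (rule ccontr)
      assume "\<not> I < \<infinity>"
      then have "I = \<infinity>" by (metis infinity_ennreal_def top.not_eq_extremum)
      then have "ennreal (2 * (k * m)) * I = \<infinity>"
        using k m by (simp add: ennreal_mult_eq_top_iff)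
      with main show False by (simp add: top_unique)
    qed
    then show int: "integrable lborel g"
      unfolding I_def using g0 by (intro integrableI_nonneg) auto
    have "I = ennreal (\<integral>x. g x \<partial>lborel)"
      unfolding I_def using int g0 by (intro nn_integral_eq_integral) auto
    then have "ennreal (2 * (k * m) * (\<integral>x. g x \<partial>lborel)) \<le> ennreal (\<integral>z. F z \<partial>lborel2)"
      using main k m by (simp add: ennreal_mult')
    moreover have "0 \<le> (\<integral>z. F z \<partial>lborel2)" using F0 by (intro integral_nonneg_AE) auto
    ultimately show "2 * (k * m) * (\<integral>x. g x \<partial>lborel) \<le> (\<integral>z. F z \<partial>lborel2)"
      by (simp add: ennreal_le_iff)
  qed
qed

text \<open>A lower bound for the rate at which \<Omega> loses energy to its exterior. It is fixed
  once by choice because the later estimates must be compared with one and the same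
  constant.\<close>

definition killing :: real where
  "killing = (SOME \<kappa>. \<kappa> > 0 \<and> (\<forall>F g. integrable lborel2 F \<longrightarrow> g \<in> borel_measurable borel \<longrightarrow> (\<forall>x. 0 \<le> g x) \<longrightarrow>
    (\<forall>z. 0 \<le> F z) \<longrightarrow>
    (\<forall>x\<in>\<Omega>. \<forall>y. y \<notin> \<Omega> \<longrightarrow> g x * frac_kernel s (x - y) \<le> F (x, y) \<and> g x * frac_kernel s (x - y) \<le> F (y, x)) \<longrightarrow>
    (\<forall>x. x \<notin> \<Omega> \<longrightarrow> g x = 0) \<longrightarrow>
    integrable lborel g \<and> 2 * \<kappa> * (\<integral>x. g x \<partial>lborel) \<le> (\<integral>z. F z \<partial>lborel2)))"

lemma killing_pos: "0 < killing"
  using someI_ex[OF killing_constant_exists] unfolding killing_def by blast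

lemma killing_bound:
  assumes "integrable lborel2 F" "g \<in> borel_measurable borel" "\<And>x. 0 \<le> g x" "\<And>z. 0 \<le> F z"
    and "\<And>x y. x \<in> \<Omega> \<Longrightarrow> y \<notin> \<Omega> \<Longrightarrow> g x * frac_kernel s (x - y) \<le> F (x, y)"
    and "\<And>x y. x \<in> \<Omega> \<Longrightarrow> y \<notin> \<Omega> \<Longrightarrow> g x * frac_kernel s (x - y) \<le> F (y, x)"
    and "\<And>x. x \<notin> \<Omega> \<Longrightarrow> g x = 0"
  shows "integrable lborel g" "2 * killing * (\<integral>x. g x \<partial>lborel) \<le> (\<integral>z. F z \<partial>lborel2)"
  using someI_ex[OF killing_constant_exists] assms unfolding killing_def[symmetric] by blast+

text \<open>If y lies outside \<Omega> then u y = 0, so the energy density at (x, y) is exactly the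
  square of u x times the kernel, as \<open>killing_bound\<close> requires.\<close>

lemma poincare:
  assumes u: "u \<in> energy"
  shows "integrable lborel (\<lambda>x. (u x)\<^sup>2)" "2 * killing * (\<integral>x. (u x)\<^sup>2 \<partial>lborel) \<le> form u u"
proof -
  have [measurable]: "u \<in> borel_measurable borel" using u by (rule energy_measurable)
  have form: "form u u = (\<integral>z. (u (fst z) - u (snd z))\<^sup>2 * pair_kernel z \<partial>lborel2)"
    unfolding form_def by (simp add: power2_eq_square)
  note * = killing_bound[of "\<lambda>z. (u (fst z) - u (snd z))\<^sup>2 * pair_kernel z" "\<lambda>x. (u x)\<^sup>2"]
  show "integrable lborel (\<lambda>x. (u x)\<^sup>2)"
    by (rule *(1)) (use energy_integrable[OF u] energy_outside[OF u] in \<open>auto simp: frac_kernel_commute\<close>)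
  show "2 * killing * (\<integral>x. (u x)\<^sup>2 \<partial>lborel) \<le> form u u"
    unfolding form
    by (rule *(2)) (use energy_integrable[OF u] energy_outside[OF u] in \<open>auto simp: frac_kernel_commute\<close>)
qed

text \<open>The product is dominated by the square of \<open>B\<close> on \<Omega> plus the square
  of \<open>u\<close>. A bound on \<Omega> is enough since \<open>u\<close> vanishes
  elsewhere.\<close>

lemma integrable_bounded_mult:
  assumes f: "f \<in> borel_measurable borel" "\<And>x. x \<in> \<Omega> \<Longrightarrow> \<bar>f x\<bar> \<le> B" and u: "u \<in> energy"
  shows "integrable lborel (\<lambda>x. f x * u x)"
proof (rule Bochner_Integration.integrable_bound)
  have [measurable]: "u \<in> borel_measurable borel" using u by (rule energy_measurable)
  note f(1)[measurable]
  show "integrable lborel (\<lambda>x. B\<^sup>2 * indicator \<Omega> x + (u x)\<^sup>2)"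
    using emeasure_domain poincare(1)[OF u] by (intro Bochner_Integration.integrable_add integrable_mult_right) auto
  show "(\<lambda>x. f x * u x) \<in> borel_measurable lborel" by measurable
  show "AE x in lborel. norm (f x * u x) \<le> norm (B\<^sup>2 * indicator \<Omega> x + (u x)\<^sup>2)"
  proof (intro AE_I2)
    fix x
    show "norm (f x * u x) \<le> norm (B\<^sup>2 * indicator \<Omega> x + (u x)\<^sup>2)"
    proof (cases "x \<in> \<Omega>")
      case True
      have "\<bar>f x\<bar> \<le> B" by (rule f(2)[OF True])
      have "2 * (B * \<bar>u x\<bar>) \<le> B\<^sup>2 + (u x)\<^sup>2" using sum_squares_bound[of B "\<bar>u x\<bar>"] by simp
      moreover have "0 \<le> B * \<bar>u x\<bar>" using \<open>\<bar>f x\<bar> \<le> B\<close> by (intro mult_nonneg_nonneg) auto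
      moreover have "\<bar>f x\<bar> * \<bar>u x\<bar> \<le> B * \<bar>u x\<bar>" using \<open>\<bar>f x\<bar> \<le> B\<close> by (intro mult_right_mono) auto
      ultimately show ?thesis using True by (simp add: abs_mult)
    qed (simp add: energy_outside[OF u])
  qed
qed

lemma integrable_energy: "u \<in> energy \<Longrightarrow> integrable lborel u"
  using integrable_bounded_mult[of "\<lambda>_. 1" 1 u] by simp

section \<open>Truncation and the comparison principle\<close>

text \<open>Write w as \<phi> plus the minimum of w and T. Both are nondecreasing functions of w, so
  the product of their increments is nonnegative everywhere. Against an exterior point, where w is
  0, that product equals T times \<phi>; \<open>killing_bound\<close> turns this into the linear
  gain on the left.\<close>

lemma form_truncation:
  assumes w: "w \<in> energy" and T: "0 \<le> T"
  defines "\<phi> \<equiv> \<lambda>x. max 0 (w x - T)"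
  shows "form \<phi> \<phi> + 2 * T * killing * (\<integral>x. \<phi> x \<partial>lborel) \<le> form w \<phi>"
proof -
  have \<phi>: "\<phi> \<in> energy" unfolding \<phi>_def by (rule truncation_energy[OF w T])
  have [measurable]: "\<phi> \<in> borel_measurable borel" using \<phi> by (rule energy_measurable)
  define F where "F z = (w (fst z) - w (snd z)) * (\<phi> (fst z) - \<phi> (snd z)) * pair_kernel z
     - (\<phi> (fst z) - \<phi> (snd z)) * (\<phi> (fst z) - \<phi> (snd z)) * pair_kernel z" for z
  have F_eq: "F z = ((w (fst z) - w (snd z)) - (\<phi> (fst z) - \<phi> (snd z))) * (\<phi> (fst z) - \<phi> (snd z)) * pair_kernel z" for z
    unfolding F_def by (simp add: algebra_simps)
  have intF: "integrable lborel2 F"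
    unfolding F_def[abs_def] by (intro Bochner_Integration.integrable_diff form_integrable w \<phi>)
  have "2 * killing * (\<integral>x. T * \<phi> x \<partial>lborel) \<le> (\<integral>z. F z \<partial>lborel2)"
  proof (rule killing_bound(2)[OF intF])
    show "(\<lambda>x. T * \<phi> x) \<in> borel_measurable borel" by measurable
    show "0 \<le> F z" for z
    proof -
      have "0 \<le> ((a - b) - (max 0 (a - T) - max 0 (b - T))) * (max 0 (a - T) - max 0 (b - T))" for a b
        using T by (auto simp: max_def intro: mult_nonneg_nonneg mult_nonpos_nonpos)
      from mult_nonneg_nonneg[OF this frac_kernel_nonneg] show ?thesis
        unfolding F_eq \<phi>_def .
    qed
    show "T * \<phi> x * frac_kernel s (x - y) \<le> F (x, y)" if "x \<in> \<Omega>" "y \<notin> \<Omega>" for x y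
    proof -
      have "T * \<phi> x \<le> ((w x - w y) - (\<phi> x - \<phi> y)) * (\<phi> x - \<phi> y)"
        using T energy_outside[OF w that(2)] unfolding \<phi>_def by (auto simp: max_def)
      then show ?thesis unfolding F_eq by (auto intro: mult_right_mono)
    qed
    show "T * \<phi> x * frac_kernel s (x - y) \<le> F (y, x)" if "x \<in> \<Omega>" "y \<notin> \<Omega>" for x y
    proof -
      have "T * \<phi> x \<le> ((w y - w x) - (\<phi> y - \<phi> x)) * (\<phi> y - \<phi> x)"
        using T energy_outside[OF w that(2)] unfolding \<phi>_def by (auto simp: max_def algebra_simps)
      then show ?thesis unfolding F_eq frac_kernel_commute[of s x y] by (auto intro: mult_right_mono)
    qed
  qed (use T energy_outside[OF \<phi>] in \<open>auto simp: \<phi>_def\<close>)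
  also have "(\<integral>z. F z \<partial>lborel2) = form w \<phi> - form \<phi> \<phi>"
    unfolding F_def form_def by (intro Bochner_Integration.integral_diff form_integrable w \<phi>)
  finally show ?thesis by (simp add: algebra_simps)
qed

lemma AE_zero_if_form_nonpos:
  assumes u: "u \<in> energy" and "form u u \<le> 0"
  shows "AE x in lborel. u x = 0"
proof -
  have "2 * killing * (\<integral>x. (u x)\<^sup>2 \<partial>lborel) \<le> 0"
    using poincare(2)[OF u] assms(2) by linarith
  then have "(\<integral>x. (u x)\<^sup>2 \<partial>lborel) \<le> 0"
    using killing_pos by (simp add: mult_le_0_iff)
  then have "(\<integral>x. (u x)\<^sup>2 \<partial>lborel) = 0"
    by (intro antisym integral_nonneg_AE) auto
  then show ?thesis
    using integral_nonneg_eq_0_iff_AE[OF poincare(1)[OF u]] by auto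
qed

text \<open>Testing with the truncation at \<open>T\<close>, the hypothesis cancels exactly the
  linear gain of \<open>form_truncation\<close>, which leaves
  \<open>form \<phi> \<phi> \<le> 0\<close>. The case \<open>T = 0\<close> is the weak maximum
  principle, and positive \<open>T\<close> gives the bound by a constant.\<close>

lemma comparison:
  assumes w: "w \<in> energy" and T: "0 \<le> T"
    and le: "\<And>\<phi>. \<phi> \<in> energy \<Longrightarrow> (\<And>x. 0 \<le> \<phi> x) \<Longrightarrow> form w \<phi> \<le> 2 * T * killing * (\<integral>x. \<phi> x \<partial>lborel)"
  shows "AE x in lborel. w x \<le> T"
proof -
  define \<phi> where "\<phi> x = max 0 (w x - T)" for x
  have \<phi>: "\<phi> \<in> energy" unfolding \<phi>_def[abs_def] by (rule truncation_energy[OF w T])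
  have "form \<phi> \<phi> \<le> 0"
    using form_truncation[OF w T] le[OF \<phi>] unfolding \<phi>_def[abs_def] by simp
  from AE_zero_if_form_nonpos[OF \<phi> this] show ?thesis
    by eventually_elim (auto simp: \<phi>_def max_def split: if_splits)
qed

end

section \<open>The linear problem\<close>

text \<open>Fatou's lemma in real-valued form. It is the only lower semicontinuity used: for L1
  limits, for the energy of a minimising sequence and for L2 limits.\<close>

lemma fatou_bound:
  fixes F :: "nat \<Rightarrow> 'b \<Rightarrow> real"
  assumes F: "\<And>j. integrable M (F j)" "\<And>j x. 0 \<le> F j x"
    and G: "G \<in> borel_measurable M" "\<And>x. 0 \<le> G x"
    and lim: "AE x in M. (\<lambda>j. F j x) \<longlonglongrightarrow> G x"
    and bound: "\<forall>\<^sub>F j in sequentially. (\<integral>x. F j x \<partial>M) \<le> c"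
  shows "integrable M G" "(\<integral>x. G x \<partial>M) \<le> c"
proof -
  have "(\<integral>\<^sup>+x. ennreal (G x) \<partial>M) = (\<integral>\<^sup>+x. liminf (\<lambda>j. ennreal (F j x)) \<partial>M)"
  proof (rule nn_integral_cong_AE, use lim in eventually_elim)
    case (elim x)
    then have "(\<lambda>j. ennreal (F j x)) \<longlonglongrightarrow> ennreal (G x)" by (rule tendsto_ennrealI)
    then show ?case by (simp add: lim_imp_Liminf)
  qed
  also have "\<dots> \<le> liminf (\<lambda>j. \<integral>\<^sup>+x. ennreal (F j x) \<partial>M)"
    using F by (intro nn_integral_liminf) (auto intro: borel_measurable_integrable)
  also have "\<dots> \<le> liminf (\<lambda>j. ennreal c)"
  proof (rule Liminf_mono, use bound in eventually_elim)
    case (elim j)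
    have "(\<integral>\<^sup>+x. ennreal (F j x) \<partial>M) = ennreal (\<integral>x. F j x \<partial>M)"
      using F by (intro nn_integral_eq_integral) auto
    then show ?case using elim by (simp add: ennreal_leI)
  qed
  finally have le: "(\<integral>\<^sup>+x. ennreal (G x) \<partial>M) \<le> ennreal c"
    by (simp add: Liminf_const)
  show int: "integrable M G"
    using G le by (intro integrableI_nonneg) (auto simp: order.strict_trans1)
  \<comment> \<open>A negative \<open>c\<close> would become 0 under \<open>ennreal\<close>, and the
    real inequality could not be read off.\<close>
  have "0 \<le> c"
  proof -
    obtain j where "(\<integral>x. F j x \<partial>M) \<le> c"
      using bound by (auto simp: eventually_sequentially)
    moreover have "0 \<le> (\<integral>x. F j x \<partial>M)" using F by (intro integral_nonneg_AE) auto
    ultimately show ?thesis by linarith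
  qed
  moreover have "(\<integral>\<^sup>+x. ennreal (G x) \<partial>M) = ennreal (\<integral>x. G x \<partial>M)"
    using int G by (intro nn_integral_eq_integral) auto
  ultimately show "(\<integral>x. G x \<partial>M) \<le> c"
    using le by (simp add: ennreal_le_iff)
qed

lemma linear_coeff_zero_if_quadratic_nonneg:
  fixes b c :: real
  assumes "\<And>t. 0 \<le> 2 * t * b + t\<^sup>2 * c"
  shows "b = 0"
proof (rule ccontr)
  assume "b \<noteq> 0"
  \<comment> \<open>With \<open>d\<close> positive and at least \<open>c\<close>, the point
    \<open>- b / d\<close> makes the quadratic negative whatever the sign of
    \<open>c\<close>.\<close>
  define d where "d = \<bar>c\<bar> + 1"
  have d: "0 < d" "c \<le> d" unfolding d_def by auto
  have "2 * (- b / d) * b + (- b / d)\<^sup>2 * c = (b\<^sup>2 / d\<^sup>2) * (c - 2 * d)"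
    using d by (simp add: power2_eq_square field_simps)
  moreover have "0 < b\<^sup>2 / d\<^sup>2" using \<open>b \<noteq> 0\<close> d by simp
  moreover have "c - 2 * d < 0" using d by simp
  ultimately have "2 * (- b / d) * b + (- b / d)\<^sup>2 * c < 0"
    by (simp only: mult_pos_neg)
  with assms[of "- b / d"] show False by linarith
qed

lemma AE_lborel_pair:
  fixes P :: "'a::euclidean_space \<Rightarrow> bool"
  assumes "AE x in lborel. P x"
  shows "AE z in lborel \<Otimes>\<^sub>M lborel. P (fst z) \<and> P (snd z)"
proof -
  obtain N :: "'a set" where N: "{x \<in> space lborel. \<not> P x} \<subseteq> N" "emeasure lborel N = 0" "N \<in> sets lborel"
    using assms by (rule AE_E)
  have sets: "N \<times> UNIV \<in> sets (lborel \<Otimes>\<^sub>M lborel)" "UNIV \<times> N \<in> sets (lborel \<Otimes>\<^sub>M lborel)"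
    using N(3) by (auto intro!: pair_measureI)
  have "emeasure (lborel \<Otimes>\<^sub>M lborel) (N \<times> (UNIV :: 'a set)) = 0"
    "emeasure (lborel \<Otimes>\<^sub>M lborel) ((UNIV :: 'a set) \<times> N) = 0"
    using N by (subst lborel.emeasure_pair_measure_Times; simp)+
  with sets have "N \<times> UNIV \<union> UNIV \<times> N \<in> null_sets (lborel \<Otimes>\<^sub>M lborel)"
    by (intro null_sets.Un) (auto simp: null_sets_def)
  then show ?thesis
    by (rule AE_I') (use N(1) in auto)
qed

context frac_domain
begin

text \<open>Young's inequality with a free weight \<open>a\<close>, then \<open>poincare\<close>.
  The weight lets the volume term be made small first and the energy term afterwards.\<close>

lemma integral_abs_energy_le:
  assumes w: "w \<in> energy" and a: "0 < a"
  shows "(\<integral>x. \<bar>w x\<bar> \<partial>lborel) \<le> form w w / (4 * a * killing) + a * measure lborel \<Omega> / 2"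
proof -
  have ind: "integrable lborel (indicator \<Omega> :: 'a \<Rightarrow> real)" using emeasure_domain by auto
  have "(\<integral>x. \<bar>w x\<bar> \<partial>lborel) \<le> (\<integral>x. (1 / (2 * a)) * (w x)\<^sup>2 + (a / 2) * indicator \<Omega> x \<partial>lborel)"
  proof (rule integral_mono)
    show "integrable lborel (\<lambda>x. \<bar>w x\<bar>)" using integrable_energy[OF w] by simp
    show "integrable lborel (\<lambda>x. (1 / (2 * a)) * (w x)\<^sup>2 + (a / 2) * indicator \<Omega> x)"
      by (intro Bochner_Integration.integrable_add integrable_mult_right poincare(1)[OF w] ind)
    show "\<bar>w x\<bar> \<le> (1 / (2 * a)) * (w x)\<^sup>2 + (a / 2) * indicator \<Omega> x" for x
    proof (cases "x \<in> \<Omega>")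
      case True
      have "2 * a * \<bar>w x\<bar> \<le> (w x)\<^sup>2 + a\<^sup>2"
        using sum_squares_bound[of a "\<bar>w x\<bar>"] by simp
      then show ?thesis using a True by (simp add: field_simps power2_eq_square)
    qed (simp add: energy_outside[OF w])
  qed
  also have "\<dots> = (1 / (2 * a)) * (\<integral>x. (w x)\<^sup>2 \<partial>lborel) + a * measure lborel \<Omega> / 2"
    by (subst Bochner_Integration.integral_add) (auto intro!: integrable_mult_right poincare(1)[OF w] ind)
  also have "(1 / (2 * a)) * (\<integral>x. (w x)\<^sup>2 \<partial>lborel) \<le> form w w / (4 * a * killing)"
    using poincare(2)[OF w] a killing_pos by (simp add: field_simps)
  finally show ?thesis by simp
qed

lemma integral_abs_energy_small:
  assumes "0 < e"
  obtains d where "0 < d" "\<And>w. w \<in> energy \<Longrightarrow> form w w \<le> d \<Longrightarrow> (\<integral>x. \<bar>w x\<bar> \<partial>lborel) < e"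
proof
  define V where "V = measure lborel \<Omega>"
  have V: "0 \<le> V" unfolding V_def by simp
  \<comment> \<open>This weight pushes the volume term to at most \<open>e / 2\<close>; the bound
    \<open>d\<close> below then makes the energy term at most \<open>e / 4\<close>.\<close>
  define a where "a = e / (V + 1)"
  have a: "0 < a" unfolding a_def using assms V by simp
  define d where "d = a * killing * e"
  show "0 < d" unfolding d_def using a assms killing_pos by simp
  fix w assume w: "w \<in> energy" "form w w \<le> d"
  have "form w w / (4 * a * killing) \<le> d / (4 * a * killing)"
    using w(2) a killing_pos by (intro divide_right_mono) auto
  also have "\<dots> = e / 4" unfolding d_def using a killing_pos by (simp add: field_simps)
  finally have "form w w / (4 * a * killing) \<le> e / 4" .
  moreover have "a * V / 2 \<le> e / 2" unfolding a_def using V assms by (simp add: field_simps)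
  ultimately show "(\<integral>x. \<bar>w x\<bar> \<partial>lborel) < e"
    using integral_abs_energy_le[OF w(1) a] assms unfolding V_def by linarith
qed

text \<open>Direct method for the functional \<open>J\<close>, whose Euler-Lagrange equation is the
  claim. Uniform convexity makes a minimising sequence Cauchy in energy, hence in L1, so a
  subsequence converges almost everywhere; Fatou's lemma shows that the limit is a
  minimiser.\<close>

lemma linear_problem:
  assumes f [measurable]: "f \<in> borel_measurable borel" and fB: "\<And>x. x \<in> \<Omega> \<Longrightarrow> \<bar>f x\<bar> \<le> B"
  obtains u where "u \<in> energy" "\<And>\<phi>. \<phi> \<in> energy \<Longrightarrow> form u \<phi> = (\<integral>x. f x * \<phi> x \<partial>lborel)"
proof -
  define L where "L u = (\<integral>x. f x * u x \<partial>lborel)" for u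
  define J where "J u = form u u - 2 * L u" for u
  have L_lin: "L (\<lambda>x. a * u x + b * v x) = a * L u + b * L v" if "u \<in> energy" "v \<in> energy" for a b u v
  proof -
    have "L (\<lambda>x. a * u x + b * v x) = (\<integral>x. a * (f x * u x) + b * (f x * v x) \<partial>lborel)"
      unfolding L_def by (simp add: algebra_simps)
    also have "\<dots> = a * L u + b * L v"
      unfolding L_def using that
      by (subst Bochner_Integration.integral_add)
        (auto intro!: integrable_mult_right integrable_bounded_mult[OF f fB])
    finally show ?thesis .
  qed
  \<comment> \<open>Young's inequality with weight \<open>killing\<close> bounds the linear part;
    its quadratic term is absorbed by \<open>poincare\<close>.\<close>
  have J_lower: "- (B\<^sup>2 / killing) * measure lborel \<Omega> \<le> J u" if u: "u \<in> energy" for u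
  proof -
    have ind: "integrable lborel (indicator \<Omega> :: 'a \<Rightarrow> real)" using emeasure_domain by auto
    have "2 * L u = (\<integral>x. 2 * (f x * u x) \<partial>lborel)" unfolding L_def by simp
    also have "\<dots> \<le> (\<integral>x. killing * (u x)\<^sup>2 + (B\<^sup>2 / killing) * indicator \<Omega> x \<partial>lborel)"
    proof (rule integral_mono)
      show "integrable lborel (\<lambda>x. 2 * (f x * u x))"
        by (intro integrable_mult_right integrable_bounded_mult[OF f fB] u)
      show "integrable lborel (\<lambda>x. killing * (u x)\<^sup>2 + (B\<^sup>2 / killing) * indicator \<Omega> x)"
        by (intro Bochner_Integration.integrable_add integrable_mult_right poincare(1)[OF u] ind)
      show "2 * (f x * u x) \<le> killing * (u x)\<^sup>2 + (B\<^sup>2 / killing) * indicator \<Omega> x" for x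
      proof (cases "x \<in> \<Omega>")
        case True
        have "0 \<le> (killing * u x - f x)\<^sup>2" by simp
        then have "2 * killing * (f x * u x) \<le> killing\<^sup>2 * (u x)\<^sup>2 + (f x)\<^sup>2"
          by (simp add: power2_diff power_mult_distrib algebra_simps)
        moreover have "(f x)\<^sup>2 \<le> B\<^sup>2" using power_mono[OF fB[OF True], of 2] by simp
        ultimately have "2 * killing * (f x * u x) \<le> killing\<^sup>2 * (u x)\<^sup>2 + B\<^sup>2" by linarith
        then show ?thesis using True killing_pos by (simp add: field_simps power2_eq_square)
      qed (simp add: energy_outside[OF u])
    qed
    also have "\<dots> = killing * (\<integral>x. (u x)\<^sup>2 \<partial>lborel) + (B\<^sup>2 / killing) * measure lborel \<Omega>"
      by (subst Bochner_Integration.integral_add) (auto intro!: integrable_mult_right poincare(1)[OF u] ind)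
    finally have "2 * L u \<le> killing * (\<integral>x. (u x)\<^sup>2 \<partial>lborel) + (B\<^sup>2 / killing) * measure lborel \<Omega>" .
    moreover have "0 \<le> killing * (\<integral>x. (u x)\<^sup>2 \<partial>lborel)"
      using killing_pos by (intro mult_nonneg_nonneg integral_nonneg_AE) auto
    ultimately show ?thesis using poincare(2)[OF u] unfolding J_def by simp
  qed
  define m where "m = (INF u\<in>energy. J u)"
  have bdd: "bdd_below (J ` energy)" using J_lower by (auto intro!: bdd_belowI2)
  have m_le: "m \<le> J u" if "u \<in> energy" for u
    unfolding m_def using bdd that by (rule cINF_lower)
  have "\<exists>u\<in>energy. J u < m + 1 / real (Suc n)" for n
  proof -
    have "m < m + 1 / real (Suc n)" by simp
    then show ?thesis
      unfolding m_def using cINF_less_iff[OF _ bdd] zero_energy by blast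
  qed
  then obtain U where U: "\<And>n. U n \<in> energy" and JU: "\<And>n. J (U n) < m + 1 / real (Suc n)" by metis
  have [measurable]: "U n \<in> borel_measurable borel" for n by (rule energy_measurable[OF U])
  \<comment> \<open>Parallelogram identity: the left side is 2 J (U i) + 2 J (U j) - 4 J of the
    midpoint, and the midpoint has value at least \<open>m\<close>.\<close>
  have form_diff: "form (\<lambda>x. U i x - U j x) (\<lambda>x. U i x - U j x) \<le> 2 / real (Suc i) + 2 / real (Suc j)" for i j
  proof -
    let ?w = "\<lambda>x. (1/2) * U i x + (1/2) * U j x"
    have "form (\<lambda>x. U i x - U j x) (\<lambda>x. U i x - U j x) = form (U i) (U i) - 2 * form (U i) (U j) + form (U j) (U j)"
      using form_linear_square[OF U U, of 1 i "-1" j] by simp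
    moreover have "form ?w ?w = (1/4) * form (U i) (U i) + (1/2) * form (U i) (U j) + (1/4) * form (U j) (U j)"
      using form_linear_square[OF U U, of "1/2" i "1/2" j] by (simp add: power2_eq_square)
    moreover have "L ?w = (1/2) * L (U i) + (1/2) * L (U j)" by (rule L_lin[OF U U])
    moreover have "m \<le> J ?w" by (rule m_le[OF linear_energy[OF U U]])
    ultimately show ?thesis using JU[of i] JU[of j] unfolding J_def by simp
  qed
  have cauchy: "\<exists>N. \<forall>i\<ge>N. \<forall>j\<ge>N. (\<integral>x. \<bar>U i x - U j x\<bar> \<partial>lborel) < e" if e: "0 < e" for e
  proof -
    obtain d where d: "0 < d" "\<And>w. w \<in> energy \<Longrightarrow> form w w \<le> d \<Longrightarrow> (\<integral>x. \<bar>w x\<bar> \<partial>lborel) < e"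
      by (rule integral_abs_energy_small[OF e]) blast
    obtain N where N: "4 / d < real N" using reals_Archimedean2 by blast
    have "2 / real (Suc i) \<le> d / 2" if "N \<le> i" for i
    proof -
      have "4 / d < real (Suc i)" using N that by simp
      then show ?thesis using d(1) by (simp add: field_simps)
    qed
    then have "(\<integral>x. \<bar>U i x - U j x\<bar> \<partial>lborel) < e" if "N \<le> i" "N \<le> j" for i j
      using that form_diff[of i j] by (intro d(2) diff_energy U) (smt (verit) field_sum_of_halves)
    then show ?thesis by blast
  qed
  obtain r where r: "strict_mono r" and AE_cauchy: "AE x in lborel. Cauchy (\<lambda>i. U (r i) x)"
    by (rule cauchy_L1_AE_cauchy_subseq[of lborel U])
      (use cauchy integrable_energy[OF U] in auto)
  \<comment> \<open>Where the subsequence fails to converge, \<open>lim\<close> is an unspecified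
    value, which matters only on a null set; outside \<Omega> all members are 0, so the limit is 0
    at every such point.\<close>
  define u where "u x = lim (\<lambda>i. U (r i) x)" for x
  have u_meas [measurable]: "u \<in> borel_measurable borel"
    unfolding u_def[abs_def] by (rule borel_measurable_lim_metric) measurable
  have AE_lim: "AE x in lborel. (\<lambda>i. U (r i) x) \<longlonglongrightarrow> u x"
    using AE_cauchy
    by eventually_elim (simp add: u_def Cauchy_convergent_iff convergent_LIMSEQ_iff)
  have L1: "integrable lborel (\<lambda>x. \<bar>U (r i) x - u x\<bar>) \<and> (\<integral>x. \<bar>U (r i) x - u x\<bar> \<partial>lborel) \<le> e"
    if "\<forall>i\<ge>N. \<forall>j\<ge>N. (\<integral>x. \<bar>U i x - U j x\<bar> \<partial>lborel) < e" "N \<le> i" for N i e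
  proof -
    have lim: "AE x in lborel. (\<lambda>j. \<bar>U (r i) x - U (r j) x\<bar>) \<longlonglongrightarrow> \<bar>U (r i) x - u x\<bar>"
      using AE_lim by eventually_elim (auto intro!: tendsto_intros)
    have "N \<le> r k" if "N \<le> k" for k using seq_suble[OF r, of k] that by linarith
    then have "\<forall>\<^sub>F j in sequentially. (\<integral>x. \<bar>U (r i) x - U (r j) x\<bar> \<partial>lborel) \<le> e"
      using that unfolding eventually_sequentially by (meson less_imp_le)
    moreover have "integrable lborel (\<lambda>x. \<bar>U (r i) x - U (r j) x\<bar>)" for j
      using integrable_energy[OF diff_energy[OF U U]] by simp
    ultimately show ?thesis
      using fatou_bound[of lborel "\<lambda>j x. \<bar>U (r i) x - U (r j) x\<bar>" "\<lambda>x. \<bar>U (r i) x - u x\<bar>" e] lim by simp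
  qed
  have u_out: "u x = 0" if "x \<notin> \<Omega>" for x
    unfolding u_def using energy_outside[OF U that] by (simp add: limI)
  have int_u: "integrable lborel u"
  proof -
    obtain N where "\<forall>i\<ge>N. \<forall>j\<ge>N. (\<integral>x. \<bar>U i x - U j x\<bar> \<partial>lborel) < 1" using cauchy[of 1] by auto
    from L1[OF this, of N] have "integrable lborel (\<lambda>x. \<bar>U (r N) x - u x\<bar>)" by simp
    then have "integrable lborel (\<lambda>x. U (r N) x - u x)"
      by (subst (asm) integrable_abs_iff) measurable
    from Bochner_Integration.integrable_diff[OF integrable_energy[OF U[of "r N"]] this]
    show ?thesis by simp
  qed
  \<comment> \<open>The functional \<open>L\<close> is continuous for L1 convergence because
    \<open>f\<close> is bounded on \<Omega>. This is the mode of convergence that \<open>L1\<close>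
    provides.\<close>
  have L_bound: "\<bar>L (U (r i)) - L u\<bar> \<le> \<bar>B\<bar> * (\<integral>x. \<bar>U (r i) x - u x\<bar> \<partial>lborel)" for i
  proof -
    have dom: "\<bar>f x * (U (r i) x - u x)\<bar> \<le> \<bar>B\<bar> * \<bar>U (r i) x - u x\<bar>" for x
    proof (cases "x \<in> \<Omega>")
      case True
      then show ?thesis using fB[of x] by (auto simp: abs_mult intro!: mult_right_mono)
    qed (simp add: energy_outside[OF U] u_out)
    have int1: "integrable lborel (\<lambda>x. U (r i) x - u x)"
      by (intro Bochner_Integration.integrable_diff integrable_energy U int_u)
    have int2: "integrable lborel (\<lambda>x. f x * (U (r i) x - u x))"
      by (rule Bochner_Integration.integrable_bound[OF integrable_mult_right[OF integrable_abs[OF int1], of "\<bar>B\<bar>"]])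
        (use dom in auto)
    have intfu: "integrable lborel (\<lambda>x. f x * u x)"
      using Bochner_Integration.integrable_diff[OF integrable_bounded_mult[OF f fB U[of "r i"]] int2]
      by (simp add: right_diff_distrib)
    have "L (U (r i)) - L u = (\<integral>x. f x * (U (r i) x - u x) \<partial>lborel)"
      unfolding L_def right_diff_distrib
      by (subst Bochner_Integration.integral_diff[OF integrable_bounded_mult[OF f fB U] intfu]) simp_all
    then have "\<bar>L (U (r i)) - L u\<bar> \<le> (\<integral>x. \<bar>f x * (U (r i) x - u x)\<bar> \<partial>lborel)"
      by (simp only: integral_abs_bound)
    also have "\<dots> \<le> (\<integral>x. \<bar>B\<bar> * \<bar>U (r i) x - u x\<bar> \<partial>lborel)"
      by (intro integral_mono integrable_abs int2 integrable_mult_right int1 dom)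
    finally show ?thesis by simp
  qed
  have L_lim: "\<forall>\<^sub>F i in sequentially. L (U (r i)) \<le> L u + e" if "0 < e" for e
  proof -
    have "0 < e / (\<bar>B\<bar> + 1)" using that by simp
    from cauchy[OF this] obtain N where
      N: "\<forall>i\<ge>N. \<forall>j\<ge>N. (\<integral>x. \<bar>U i x - U j x\<bar> \<partial>lborel) < e / (\<bar>B\<bar> + 1)" by blast
    have "L (U (r i)) \<le> L u + e" if "N \<le> i" for i
    proof -
      have "(\<integral>x. \<bar>U (r i) x - u x\<bar> \<partial>lborel) \<le> e / (\<bar>B\<bar> + 1)" using L1[OF N that] by simp
      then have "\<bar>B\<bar> * (\<integral>x. \<bar>U (r i) x - u x\<bar> \<partial>lborel) \<le> \<bar>B\<bar> * (e / (\<bar>B\<bar> + 1))"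
        by (intro mult_left_mono) auto
      also have "\<dots> \<le> e" using \<open>0 < e\<close> by (simp add: field_simps)
      finally show ?thesis using L_bound[of i] by linarith
    qed
    then show ?thesis unfolding eventually_sequentially by blast
  qed
  \<comment> \<open>The slack \<open>e\<close> splits in halves: one for the distance of
    \<open>J\<close> from its infimum, the other for twice the error of \<open>L\<close>.\<close>
  have fatou: "integrable lborel2 (\<lambda>z. (u (fst z) - u (snd z))\<^sup>2 * pair_kernel z) \<and>
      (\<integral>z. (u (fst z) - u (snd z))\<^sup>2 * pair_kernel z \<partial>lborel2) \<le> m + 2 * L u + e" if "0 < e" for e
  proof -
    have "\<forall>\<^sub>F i in sequentially. 1 / real (Suc i) < e / 2"
      unfolding inverse_eq_divide[symmetric]
      by (rule order_tendstoD(2)[OF LIMSEQ_inverse_real_of_nat]) (use that in simp)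
    moreover have "\<forall>\<^sub>F i in sequentially. L (U (r i)) \<le> L u + e / 4" using L_lim[of "e / 4"] that by simp
    ultimately have ev: "\<forall>\<^sub>F i in sequentially.
        (\<integral>z. (U (r i) (fst z) - U (r i) (snd z))\<^sup>2 * pair_kernel z \<partial>lborel2) \<le> m + 2 * L u + e"
    proof eventually_elim
      case (elim i)
      have "i \<le> r i" by (rule seq_suble[OF r])
      then have "1 / real (Suc (r i)) \<le> 1 / real (Suc i)" by (intro divide_left_mono) auto
      then have "form (U (r i)) (U (r i)) \<le> m + 2 * L u + e"
        using elim JU[of "r i"] unfolding J_def by linarith
      then show ?case unfolding form_def by (simp add: power2_eq_square)
    qed
    have lim: "AE z in lborel2. (\<lambda>i. (U (r i) (fst z) - U (r i) (snd z))\<^sup>2 * pair_kernel z)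
        \<longlonglongrightarrow> (u (fst z) - u (snd z))\<^sup>2 * pair_kernel z"
      using AE_lborel_pair[OF AE_lim] by eventually_elim (auto intro!: tendsto_intros)
    note * = fatou_bound[OF energy_integrable[OF U] _ _ _ lim ev]
    show ?thesis by (intro conjI *) auto
  qed
  have u: "u \<in> energy"
    using fatou[of 1] u_out u_meas by (simp add: energy_def)
  have "J u \<le> m"
  proof (rule field_le_epsilon)
    fix e :: real assume "0 < e"
    then show "J u \<le> m + e"
      using fatou[of e] unfolding J_def form_def by (simp add: power2_eq_square)
  qed
  have "form u \<phi> = (\<integral>x. f x * \<phi> x \<partial>lborel)" if \<phi>: "\<phi> \<in> energy" for \<phi>
  proof -
    \<comment> \<open>First variation: along \<open>u + t \<phi>\<close> the functional is a
      quadratic in \<open>t\<close> with its minimum at 0.\<close>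
    have "form u \<phi> - L \<phi> = 0"
    proof (rule linear_coeff_zero_if_quadratic_nonneg)
      fix t
      have "J u \<le> J (\<lambda>x. 1 * u x + t * \<phi> x)"
        using \<open>J u \<le> m\<close> m_le[OF linear_energy[OF u \<phi>, of 1 t]] by linarith
      then show "0 \<le> 2 * t * (form u \<phi> - L \<phi>) + t\<^sup>2 * form \<phi> \<phi>"
        unfolding J_def form_linear_square[OF u \<phi>] L_lin[OF u \<phi>] by (simp add: algebra_simps)
    qed
    then show ?thesis by (simp add: L_def)
  qed
  with u show ?thesis by (rule that)
qed

end

section \<open>Subsolutions from bump functions\<close>

lemma lborel_distr_reflect:
  fixes x :: "'a::euclidean_space"
  shows "distr lborel borel (\<lambda>y. x - y) = lborel"
  by (subst (2) lborel_affine[of "-1" x]) (auto simp: density_1)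

lemma integrable_reflect_iff:
  fixes f :: "'a::euclidean_space \<Rightarrow> real"
  assumes [measurable]: "f \<in> borel_measurable borel"
  shows "integrable lborel (\<lambda>y. f (x - y)) \<longleftrightarrow> integrable lborel f"
  by (subst (2) lborel_distr_reflect[of x, symmetric], subst integrable_distr_eq) auto

lemma integral_reflect:
  fixes f :: "'a::euclidean_space \<Rightarrow> real"
  assumes [measurable]: "f \<in> borel_measurable borel"
  shows "(\<integral>y. f (x - y) \<partial>lborel) = (\<integral>y. f y \<partial>lborel)"
  by (subst (2) lborel_distr_reflect[of x, symmetric], subst integral_distr) auto

text \<open>After reflection the inner integral is the L1 norm of \<open>\<kappa>\<close>
  independently of x, so Tonelli gives the product of the two L1 norms.\<close>

lemma integrable_pair_convolution:
  fixes g \<kappa> :: "'a::euclidean_space \<Rightarrow> real"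
  assumes g: "integrable lborel g" and \<kappa>: "integrable lborel \<kappa>"
  shows "integrable (lborel \<Otimes>\<^sub>M lborel) (\<lambda>z. g (fst z) * \<kappa> (fst z - snd z))"
proof (rule lborel_pair.Fubini_integrable)
  have [measurable]: "g \<in> borel_measurable borel" "\<kappa> \<in> borel_measurable borel"
    using g \<kappa> by (auto dest: borel_measurable_integrable)
  show "(\<lambda>z. g (fst z) * \<kappa> (fst z - snd z)) \<in> borel_measurable (lborel \<Otimes>\<^sub>M lborel)"
    by measurable
  have "(\<integral>y. norm (g x * \<kappa> (x - y)) \<partial>lborel) = (\<integral>y. \<bar>\<kappa> y\<bar> \<partial>lborel) * \<bar>g x\<bar>" for x
    using integral_reflect[of "\<lambda>y. \<bar>\<kappa> y\<bar>" x] by (simp add: abs_mult)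
  then show "integrable lborel (\<lambda>x. \<integral>y. norm (g (fst (x, y)) * \<kappa> (fst (x, y) - snd (x, y))) \<partial>lborel)"
    using g by simp
  show "AE x in lborel. integrable lborel (\<lambda>y. g (fst (x, y)) * \<kappa> (fst (x, y) - snd (x, y)))"
    using \<kappa> by (intro AE_I2) (simp add: integrable_reflect_iff)
qed

context frac_domain
begin

section \<open>Energy estimates from first and second differences\<close>

text \<open>The factor by which a bound on second differences becomes a bound on the operator in
  \<open>form_le_second_difference\<close>.\<close>

definition kernel_mass :: real where
  "kernel_mass = (\<integral>h. min ((norm h)\<^sup>2) 1 * frac_kernel s (h::'a) \<partial>lborel)"

lemma kernel_mass_nonneg: "0 \<le> kernel_mass"
  unfolding kernel_mass_def by (intro integral_nonneg_AE AE_I2 mult_nonneg_nonneg) auto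

text \<open>The difference quotient vanishes unless one of the points lies in \<Omega>. The majorant
  is therefore an integrable kernel convolved with the indicator of \<Omega>, taken in both
  orders.\<close>

lemma lipschitz_energy:
  assumes [measurable]: "z \<in> borel_measurable borel" and out: "\<And>x. x \<notin> \<Omega> \<Longrightarrow> z x = 0"
    and lip: "\<And>x y. (z x - z y)\<^sup>2 \<le> C * min ((norm (x - y))\<^sup>2) 1"
  shows "z \<in> energy"
proof -
  define \<kappa> where "\<kappa> h = min ((norm h)\<^sup>2) 1 * frac_kernel s (h::'a)" for h
  have \<kappa>: "integrable lborel \<kappa>"
    unfolding \<kappa>_def[abs_def] by (rule integrable_min_sq_frac_kernel[OF s_pos s_less_1])
  have \<kappa>_nonneg: "0 \<le> \<kappa> h" for h unfolding \<kappa>_def by (intro mult_nonneg_nonneg) auto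
  have \<kappa>_commute: "\<kappa> (x - y) = \<kappa> (y - x)" for x y
    unfolding \<kappa>_def by (simp add: norm_minus_commute frac_kernel_commute)
  have ind: "integrable lborel (indicator \<Omega> :: 'a \<Rightarrow> real)" using emeasure_domain by auto
  have int1: "integrable lborel2 (\<lambda>z. indicator \<Omega> (fst z) * \<kappa> (fst z - snd z))"
    by (rule integrable_pair_convolution[OF ind \<kappa>])
  have int2: "integrable lborel2 (\<lambda>z. indicator \<Omega> (snd z) * \<kappa> (fst z - snd z))"
    using lborel_pair.integrable_product_swap[OF int1] by (simp add: case_prod_unfold \<kappa>_commute)
  have "integrable lborel2 (\<lambda>w. (z (fst w) - z (snd w))\<^sup>2 * pair_kernel w)"
  proof (rule Bochner_Integration.integrable_bound)
    let ?g = "\<lambda>w. C * (indicator \<Omega> (fst w) * \<kappa> (fst w - snd w) + indicator \<Omega> (snd w) * \<kappa> (fst w - snd w))"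
    show "integrable lborel2 ?g"
      by (intro integrable_mult_right Bochner_Integration.integrable_add int1 int2)
    show "AE w in lborel2. norm ((z (fst w) - z (snd w))\<^sup>2 * pair_kernel w) \<le> norm (?g w)"
    proof (intro AE_I2)
      fix w :: "'a \<times> 'a"
      obtain x y where w: "w = (x, y)" by (cases w)
      have C\<kappa>: "(z x - z y)\<^sup>2 * frac_kernel s (x - y) \<le> C * \<kappa> (x - y)"
        unfolding \<kappa>_def using mult_right_mono[OF lip frac_kernel_nonneg] by (simp add: mult.assoc)
      have nn: "0 \<le> (z x - z y)\<^sup>2 * frac_kernel s (x - y)" by (intro mult_nonneg_nonneg) auto
      have "(z x - z y)\<^sup>2 * frac_kernel s (x - y) \<le> ?g (x, y)"
      proof -
        define D where "D = C * \<kappa> (x - y)"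
        have "?g (x, y) = D * indicator \<Omega> x + D * indicator \<Omega> y"
          unfolding D_def by (simp add: distrib_left mult.commute mult.left_commute)
        moreover have "(z x - z y)\<^sup>2 * frac_kernel s (x - y) \<le> D" "0 \<le> D"
          using C\<kappa> nn unfolding D_def by linarith+
        ultimately show ?thesis
          using out[of x] out[of y] by (cases "x \<in> \<Omega>"; cases "y \<in> \<Omega>") auto
      qed
      then show "norm ((z (fst w) - z (snd w))\<^sup>2 * pair_kernel w) \<le> norm (?g w)"
        unfolding w using nn by simp
    qed
  qed measurable
  then show ?thesis using out by (simp add: energy_def)
qed

text \<open>The truncated kernels \<open>\<kappa>\<^sub>\<epsilon>\<close> make the symmetrization \<open>\<integral>\<integral> (z x - z y) (\<phi> x - \<phi> y) \<kappa>\<^sub>\<epsilon>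
  = 2 \<integral> \<phi> x \<integral> (z x - z y) \<kappa>\<^sub>\<epsilon>\<close> absolutely convergent.\<close>

lemma form_truncated_le:
  assumes z: "z \<in> energy" and zB: "\<And>x. \<bar>z x\<bar> \<le> Z"
    and \<phi>: "\<phi> \<in> energy" "\<And>x. 0 \<le> \<phi> x"
    and G: "integrable lborel (\<lambda>x. G x * \<phi> x)"
    and diff: "\<And>x h. 2 * z x - z (x + h) - z (x - h) \<le> G x * min ((norm h)\<^sup>2) 1"
    and G0: "\<And>x. 0 \<le> G x" and \<epsilon>: "0 < \<epsilon>"
  shows "(\<integral>w. (z (fst w) - z (snd w)) * (\<phi> (fst w) - \<phi> (snd w))
      * (indicator (- ball 0 \<epsilon>) (fst w - snd w) * pair_kernel w) \<partial>lborel2)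
    \<le> kernel_mass * (\<integral>x. G x * \<phi> x \<partial>lborel)"
proof -
  have [measurable]: "z \<in> borel_measurable borel" "\<phi> \<in> borel_measurable borel"
    using z \<phi> by (auto intro: energy_measurable)
  define \<kappa> where "\<kappa> h = indicator (- ball 0 \<epsilon>) h * frac_kernel s (h::'a)" for h
  have \<kappa>: "integrable lborel \<kappa>"
    unfolding \<kappa>_def[abs_def] by (rule integrable_frac_kernel_outside[OF s_pos s_less_1 \<epsilon>])
  have [measurable]: "\<kappa> \<in> borel_measurable borel" using \<kappa> by (auto dest: borel_measurable_integrable)
  have \<kappa>_nonneg: "0 \<le> \<kappa> h" for h unfolding \<kappa>_def by (intro mult_nonneg_nonneg) auto
  have \<kappa>_minus: "\<kappa> (- h) = \<kappa> h" for h unfolding \<kappa>_def by (auto split: split_indicator)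
  have \<kappa>_commute: "\<kappa> (x - y) = \<kappa> (y - x)" for x y using \<kappa>_minus[of "y - x"] by simp
  \<comment> \<open>One half of the symmetrised integrand; exchanging the two variables gives the
    other half since \<open>\<kappa>\<close> is even.\<close>
  define H where "H w = \<phi> (fst w) * (z (fst w) - z (snd w)) * \<kappa> (fst w - snd w)" for w
  have intH: "integrable lborel2 H"
  proof (rule Bochner_Integration.integrable_bound)
    show "integrable lborel2 (\<lambda>w. (2 * Z) * (\<phi> (fst w) * \<kappa> (fst w - snd w)))"
      by (intro integrable_mult_right integrable_pair_convolution integrable_energy \<phi>(1) \<kappa>)
    show "H \<in> borel_measurable lborel2" unfolding H_def[abs_def] by measurable
    show "AE w in lborel2. norm (H w) \<le> norm ((2 * Z) * (\<phi> (fst w) * \<kappa> (fst w - snd w)))"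
    proof (intro AE_I2)
      fix w :: "'a \<times> 'a"
      have "\<bar>z (fst w) - z (snd w)\<bar> \<le> 2 * Z" using zB[of "fst w"] zB[of "snd w"] by linarith
      then have "\<bar>z (fst w) - z (snd w)\<bar> * (\<phi> (fst w) * \<kappa> (fst w - snd w))
          \<le> (2 * Z) * (\<phi> (fst w) * \<kappa> (fst w - snd w))"
        using \<phi>(2) \<kappa>_nonneg by (intro mult_right_mono mult_nonneg_nonneg)
      moreover have "norm (H w) = \<bar>z (fst w) - z (snd w)\<bar> * (\<phi> (fst w) * \<kappa> (fst w - snd w))"
        unfolding H_def using \<phi>(2) \<kappa>_nonneg by (simp add: abs_mult mult.commute mult.left_commute)
      ultimately show "norm (H w) \<le> norm ((2 * Z) * (\<phi> (fst w) * \<kappa> (fst w - snd w)))"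
        unfolding real_norm_def by linarith
    qed
  qed
  define I where "I x = (\<integral>y. (z x - z y) * \<kappa> (x - y) \<partial>lborel)" for x
  \<comment> \<open>Averaging the substitutions \<open>x - h\<close> and \<open>x + h\<close>
    produces a second difference. Only a one-sided bound on it is assumed; as \<open>G\<close> is
    nonnegative, the cutoff may then be dropped from the kernel.\<close>
  have I_le: "2 * I x \<le> G x * kernel_mass" for x
  proof -
    have int: "integrable lborel (\<lambda>h. (z x - z (x - h)) * \<kappa> h)" "integrable lborel (\<lambda>h. (z x - z (x + h)) * \<kappa> h)"
    proof -
      have "integrable lborel (\<lambda>h. (2 * Z) * \<kappa> h)" using \<kappa> by simp
      then show "integrable lborel (\<lambda>h. (z x - z (x - h)) * \<kappa> h)" "integrable lborel (\<lambda>h. (z x - z (x + h)) * \<kappa> h)"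
      proof (rule_tac [!] Bochner_Integration.integrable_bound)
        have *: "\<bar>(z x - z y) * \<kappa> h\<bar> \<le> \<bar>2 * Z * \<kappa> h\<bar>" for y h
        proof -
          have "\<bar>z x - z y\<bar> \<le> \<bar>2 * Z\<bar>" using zB[of x] zB[of y] by linarith
          then show ?thesis unfolding abs_mult[of _ "\<kappa> h"] by (intro mult_right_mono) auto
        qed
        show "AE h in lborel. norm ((z x - z (x - h)) * \<kappa> h) \<le> norm (2 * Z * \<kappa> h)"
          "AE h in lborel. norm ((z x - z (x + h)) * \<kappa> h) \<le> norm (2 * Z * \<kappa> h)"
          using * by simp_all
      qed measurable
    qed
    have I1: "I x = (\<integral>h. (z x - z (x - h)) * \<kappa> h \<partial>lborel)"
      unfolding I_def using integral_reflect[of "\<lambda>h. (z x - z (x - h)) * \<kappa> h" x] by simp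
    have I2: "I x = (\<integral>h. (z x - z (x + h)) * \<kappa> h \<partial>lborel)"
      unfolding I1 using integral_reflect[of "\<lambda>h. (z x - z (x + h)) * \<kappa> h" 0] by (simp add: \<kappa>_minus)
    have "2 * I x = (\<integral>h. (z x - z (x - h)) * \<kappa> h + (z x - z (x + h)) * \<kappa> h \<partial>lborel)"
      using I1 I2 by (subst Bochner_Integration.integral_add[OF int]) simp
    also have "\<dots> \<le> (\<integral>h. G x * (min ((norm h)\<^sup>2) 1 * frac_kernel s (h::'a)) \<partial>lborel)"
    proof (rule integral_mono)
      show "integrable lborel (\<lambda>h. (z x - z (x - h)) * \<kappa> h + (z x - z (x + h)) * \<kappa> h)"
        by (intro Bochner_Integration.integrable_add int)
      show "integrable lborel (\<lambda>h. G x * (min ((norm h)\<^sup>2) 1 * frac_kernel s (h::'a)))"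
        by (intro integrable_mult_right integrable_min_sq_frac_kernel s_pos s_less_1)
      fix h
      have "(z x - z (x - h)) * \<kappa> h + (z x - z (x + h)) * \<kappa> h = (2 * z x - z (x + h) - z (x - h)) * \<kappa> h"
        by (simp add: algebra_simps)
      also have "\<dots> \<le> (G x * min ((norm h)\<^sup>2) 1) * \<kappa> h"
        by (intro mult_right_mono diff \<kappa>_nonneg)
      also have "\<dots> \<le> (G x * min ((norm h)\<^sup>2) 1) * frac_kernel s h"
        unfolding \<kappa>_def using G0 by (intro mult_left_mono mult_nonneg_nonneg) (auto split: split_indicator)
      finally show "(z x - z (x - h)) * \<kappa> h + (z x - z (x + h)) * \<kappa> h
          \<le> G x * (min ((norm h)\<^sup>2) 1 * frac_kernel s h)"
        by (simp only: mult.assoc)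
    qed
    also have "\<dots> = G x * kernel_mass" by (simp add: kernel_mass_def)
    finally show ?thesis .
  qed
  have H_eq: "(\<integral>w. H w \<partial>lborel2) = (\<integral>x. \<phi> x * I x \<partial>lborel)"
  proof -
    have "(\<integral>y. H (x, y) \<partial>lborel) = \<phi> x * I x" for x
      unfolding H_def I_def by (simp add: mult.assoc)
    then show ?thesis
      using lborel_pair.integral_fst'[OF intH] by simp
  qed
  have int\<phi>I: "integrable lborel (\<lambda>x. \<phi> x * I x)"
    using lborel_pair.integrable_fst'[OF intH] unfolding H_def I_def by (simp add: mult.assoc)
  have "2 * (\<integral>w. H w \<partial>lborel2) = (\<integral>x. \<phi> x * (2 * I x) \<partial>lborel)"
  proof -
    have "\<phi> x * (2 * I x) = 2 * (\<phi> x * I x)" for x by simp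
    then show ?thesis by (simp only: H_eq integral_mult_right_zero)
  qed
  also have "\<dots> \<le> (\<integral>x. kernel_mass * (G x * \<phi> x) \<partial>lborel)"
  proof (rule integral_mono)
    show "integrable lborel (\<lambda>x. \<phi> x * (2 * I x))"
      using integrable_mult_right[OF int\<phi>I, of 2] by (simp add: mult.left_commute)
    show "integrable lborel (\<lambda>x. kernel_mass * (G x * \<phi> x))" using G by simp
    show "\<phi> x * (2 * I x) \<le> kernel_mass * (G x * \<phi> x)" for x
      using mult_left_mono[OF I_le \<phi>(2)] by (simp add: mult.commute mult.left_commute)
  qed
  also have "\<dots> = kernel_mass * (\<integral>x. G x * \<phi> x \<partial>lborel)" by simp
  finally have H_le: "2 * (\<integral>w. H w \<partial>lborel2) \<le> kernel_mass * (\<integral>x. G x * \<phi> x \<partial>lborel)" .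
  have int_swap: "integrable lborel2 (\<lambda>w. H (snd w, fst w))"
    using lborel_pair.integrable_product_swap[OF intH] by (simp add: case_prod_unfold)
  have swap: "(\<integral>w. H (snd w, fst w) \<partial>lborel2) = (\<integral>w. H w \<partial>lborel2)"
    using lborel_pair.integral_product_swap[OF borel_measurable_integrable[OF intH]]
    by (simp add: case_prod_unfold)
  have "(\<integral>w. (z (fst w) - z (snd w)) * (\<phi> (fst w) - \<phi> (snd w))
      * (indicator (- ball 0 \<epsilon>) (fst w - snd w) * pair_kernel w) \<partial>lborel2)
    = (\<integral>w. H w + H (snd w, fst w) \<partial>lborel2)"
  proof (intro Bochner_Integration.integral_cong refl)
    fix w :: "'a \<times> 'a"
    have "H w + H (snd w, fst w) = (z (fst w) - z (snd w)) * (\<phi> (fst w) - \<phi> (snd w)) * \<kappa> (fst w - snd w)"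
      unfolding H_def using \<kappa>_commute[of "snd w" "fst w"] by (simp add: algebra_simps)
    then show "(z (fst w) - z (snd w)) * (\<phi> (fst w) - \<phi> (snd w))
      * (indicator (- ball 0 \<epsilon>) (fst w - snd w) * pair_kernel w) = H w + H (snd w, fst w)"
      unfolding \<kappa>_def by simp
  qed
  also have "\<dots> = 2 * (\<integral>w. H w \<partial>lborel2)"
    by (subst Bochner_Integration.integral_add[OF intH int_swap]) (simp add: swap)
  finally show ?thesis using H_le by simp
qed

text \<open>The bound of \<open>form_truncated_le\<close> does not depend on the cutoff, which is
  removed by dominated convergence with the absolute integrand of the form as majorant.\<close>

lemma form_le_second_difference:
  assumes z: "z \<in> energy" and zB: "\<And>x. \<bar>z x\<bar> \<le> Z"
    and \<phi>: "\<phi> \<in> energy" "\<And>x. 0 \<le> \<phi> x"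
    and G: "integrable lborel (\<lambda>x. G x * \<phi> x)"
    and diff: "\<And>x h. 2 * z x - z (x + h) - z (x - h) \<le> G x * min ((norm h)\<^sup>2) 1"
    and G0: "\<And>x. 0 \<le> G x"
  shows "form z \<phi> \<le> kernel_mass * (\<integral>x. G x * \<phi> x \<partial>lborel)"
proof -
  define \<epsilon> where "\<epsilon> n = 1 / real (Suc n)" for n
  let ?F = "\<lambda>w. (z (fst w) - z (snd w)) * (\<phi> (fst w) - \<phi> (snd w)) * pair_kernel w"
  let ?Fn = "\<lambda>n w. (z (fst w) - z (snd w)) * (\<phi> (fst w) - \<phi> (snd w))
      * (indicator (- ball 0 (\<epsilon> n)) (fst w - snd w) * pair_kernel w)"
  have [measurable]: "z \<in> borel_measurable borel" "\<phi> \<in> borel_measurable borel"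
    using z \<phi> by (auto intro: energy_measurable)
  have [measurable]: "- ball (0::'a) (\<epsilon> n) \<in> sets borel" for n by simp
  have "(\<lambda>n. \<integral>w. ?Fn n w \<partial>lborel2) \<longlonglongrightarrow> (\<integral>w. ?F w \<partial>lborel2)"
  proof (rule integral_dominated_convergence[where w = "\<lambda>w. \<bar>?F w\<bar>"])
    show "integrable lborel2 (\<lambda>w. \<bar>?F w\<bar>)" by (intro integrable_abs form_integrable z \<phi>(1))
    show "AE w in lborel2. (\<lambda>n. ?Fn n w) \<longlonglongrightarrow> ?F w"
    proof (intro AE_I2)
      fix w :: "'a \<times> 'a"
      show "(\<lambda>n. ?Fn n w) \<longlonglongrightarrow> ?F w"
      \<comment> \<open>On the diagonal every integrand is 0; off it the cutoff is eventually
        inactive.\<close>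
      proof (cases "fst w = snd w")
        case False
        then have "0 < norm (fst w - snd w)" by simp
        then have "\<forall>\<^sub>F n in sequentially. \<epsilon> n < norm (fst w - snd w)"
          unfolding \<epsilon>_def inverse_eq_divide[symmetric]
          by (rule order_tendstoD(2)[OF LIMSEQ_inverse_real_of_nat])
        then have "\<forall>\<^sub>F n in sequentially. ?Fn n w = ?F w"
          by eventually_elim simp
        then show ?thesis by (rule tendsto_eventually)
      qed simp
    qed
    show "AE w in lborel2. norm (?Fn n w) \<le> \<bar>?F w\<bar>" for n
      by (intro AE_I2) (auto split: split_indicator)
    show "?F \<in> borel_measurable lborel2" by measurable
    show "?Fn n \<in> borel_measurable lborel2" for n by measurable
  qed
  then have "(\<integral>w. ?F w \<partial>lborel2) \<le> kernel_mass * (\<integral>x. G x * \<phi> x \<partial>lborel)"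
  proof (rule LIMSEQ_le_const2)
    have "0 < \<epsilon> n" for n unfolding \<epsilon>_def by simp
    from form_truncated_le[OF z zB \<phi> G diff G0 this]
    show "\<exists>N. \<forall>n\<ge>N. (\<integral>w. ?Fn n w \<partial>lborel2) \<le> kernel_mass * (\<integral>x. G x * \<phi> x \<partial>lborel)"
      by blast
  qed
  then show ?thesis by (simp only: form_def)
qed

end

section \<open>Truncated paraboloids and their powers\<close>

text \<open>The kink created by the positive part is convex, hence harmless: subsolutions need the
  second difference controlled from one side only.\<close>

definition bump :: "'a::euclidean_space \<Rightarrow> real \<Rightarrow> 'a \<Rightarrow> real" where
  "bump c r x = max 0 (r\<^sup>2 - (norm (x - c))\<^sup>2)"

lemma bump_nonneg [simp]: "0 \<le> bump c r x"
  by (simp add: bump_def)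

lemma bump_measurable [measurable]: "bump c r \<in> borel_measurable borel"
  unfolding bump_def[abs_def] by measurable

lemma bump_pos_iff: "0 < r \<Longrightarrow> 0 < bump c r x \<longleftrightarrow> x \<in> ball c r"
proof -
  assume r: "0 < r"
  have "0 < bump c r x \<longleftrightarrow> (norm (x - c))\<^sup>2 < r\<^sup>2"
    by (simp add: bump_def less_max_iff_disj)
  also have "\<dots> \<longleftrightarrow> norm (x - c) < r"
    using r power_strict_mono[of "norm (x - c)" r 2] power_less_imp_less_base[of "norm (x - c)" 2 r] by auto
  finally show ?thesis by (simp add: dist_norm norm_minus_commute)
qed

lemma bump_le_1:
  assumes "0 < r" "r \<le> 1"
  shows "bump c r x \<le> 1"
proof -
  have "r\<^sup>2 \<le> 1" using assms by (simp add: power_le_one)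
  moreover have "0 \<le> (norm (x - c))\<^sup>2" by simp
  ultimately have "r\<^sup>2 - (norm (x - c))\<^sup>2 \<le> 1" by linarith
  then show ?thesis unfolding bump_def by simp
qed

lemma bump_lipschitz:
  assumes "0 < r" "r \<le> 1"
  shows "\<bar>bump c r x - bump c r y\<bar> \<le> 2 * norm (x - y)"
proof -
  \<comment> \<open>In this form the bump is a 1-Lipschitz function with values in [0, 1], squared;
    the constant 2 is the sum of two such values.\<close>
  have eq: "bump c r x = r\<^sup>2 - (min r (norm (x - c)))\<^sup>2" for x
  proof (cases "norm (x - c) \<le> r")
    case True
    then have "(norm (x - c))\<^sup>2 \<le> r\<^sup>2" by (intro power_mono) auto
    then show ?thesis using True by (simp add: bump_def min_def)
  next
    case False
    then have "r\<^sup>2 \<le> (norm (x - c))\<^sup>2" using assms by (intro power_mono) auto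
    then show ?thesis using False by (simp add: bump_def min_def)
  qed
  define a b where "a = min r (norm (x - c))" and "b = min r (norm (y - c))"
  have ab: "0 \<le> a" "a \<le> 1" "0 \<le> b" "b \<le> 1" unfolding a_def b_def using assms by auto
  have "\<bar>norm (x - c) - norm (y - c)\<bar> \<le> norm (x - y)"
    using norm_triangle_ineq3[of "x - c" "y - c"] by simp
  then have d: "\<bar>b - a\<bar> \<le> norm (x - y)" unfolding a_def b_def by linarith
  have "bump c r x - bump c r y = (b - a) * (b + a)"
    unfolding eq a_def b_def by (simp add: power2_eq_square algebra_simps)
  also have "\<bar>\<dots>\<bar> = \<bar>b - a\<bar> * (b + a)" using ab by (simp add: abs_mult)
  also have "\<dots> \<le> norm (x - y) * 2" using ab d by (intro mult_mono) auto
  finally show ?thesis by simp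
qed

text \<open>Where the bump is positive, compare with the untruncated paraboloid, which lies below
  it, and use the parallelogram identity. Where it is 0, the neighbouring values only help.\<close>

lemma bump_second_difference:
  assumes "0 < r" "r \<le> 1"
  shows "2 * bump c r x - bump c r (x + h) - bump c r (x - h) \<le> 2 * min ((norm h)\<^sup>2) 1"
proof -
  have "2 * bump c r x - bump c r (x + h) - bump c r (x - h) \<le> 2 * (norm h)\<^sup>2"
  proof (cases "bump c r x = 0")
    case True
    moreover have "0 \<le> (norm h)\<^sup>2" by simp
    ultimately show ?thesis using bump_nonneg[of c r "x + h"] bump_nonneg[of c r "x - h"] by linarith
  next
    case False
    then have "bump c r x = r\<^sup>2 - (norm (x - c))\<^sup>2" by (auto simp: bump_def max_def split: if_splits)
    moreover have "r\<^sup>2 - (norm ((x - c) + h))\<^sup>2 \<le> bump c r (x + h)"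
      "r\<^sup>2 - (norm ((x - c) - h))\<^sup>2 \<le> bump c r (x - h)"
      unfolding bump_def by (simp_all add: algebra_simps)
    moreover have "(norm ((x - c) + h))\<^sup>2 + (norm ((x - c) - h))\<^sup>2 = 2 * (norm (x - c))\<^sup>2 + 2 * (norm h)\<^sup>2"
      by (simp add: power2_norm_eq_inner inner_add_left inner_add_right inner_diff_left inner_diff_right)
    ultimately show ?thesis by linarith
  qed
  moreover have "2 * bump c r x - bump c r (x + h) - bump c r (x - h) \<le> 2 * 1"
    using bump_le_1[OF assms, of c x] bump_nonneg[of c r "x + h"] bump_nonneg[of c r "x - h"] by linarith
  ultimately show ?thesis by linarith
qed

text \<open>Convexity of the power: the tangent at \<open>a\<close> lies below the graph at
  \<open>b\<close>.\<close>

lemma power_diff_le_tangent: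
  fixes a b :: real
  assumes "0 \<le> a" "0 \<le> b"
  shows "a ^ Suc m - b ^ Suc m \<le> real (Suc m) * a ^ m * (a - b)"
proof (induction m)
  case (Suc m)
  \<comment> \<open>The induction step rests on an exact identity for the next power that contains
    this product with a minus sign; monotonicity of powers allows it to be discarded.\<close>
  have "0 \<le> (a ^ Suc m - b ^ Suc m) * (a - b)"
  proof (cases "b \<le> a")
    case True
    then show ?thesis using assms by (intro mult_nonneg_nonneg) (auto simp del: power_Suc intro!: power_mono)
  next
    case False
    then have "a ^ Suc m \<le> b ^ Suc m" using assms by (intro power_mono) auto
    then show ?thesis using False by (intro mult_nonpos_nonpos) auto
  qed
  moreover have "a * (a ^ Suc m - b ^ Suc m) \<le> a * (real (Suc m) * a ^ m * (a - b))"
    by (intro mult_left_mono Suc assms)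
  moreover have "a * (real (Suc m) * a ^ m * (a - b)) = real (Suc m) * a ^ Suc m * (a - b)"
    by simp
  moreover have "a ^ Suc (Suc m) - b ^ Suc (Suc m)
      = a * (a ^ Suc m - b ^ Suc m) + a ^ Suc m * (a - b) - (a ^ Suc m - b ^ Suc m) * (a - b)"
    unfolding power_Suc[of _ "Suc m"] by (simp only: algebra_simps)
  moreover have "real (Suc (Suc m)) * a ^ Suc m * (a - b)
      = real (Suc m) * a ^ Suc m * (a - b) + a ^ Suc m * (a - b)"
    unfolding of_nat_Suc[of "Suc m"] by (simp only: distrib_right mult_1_left)
  ultimately show ?case by linarith
qed simp

text \<open>The tangent at the centre serves both neighbours. The resulting factor
  \<open>bump c r x ^ m\<close> vanishes at the edge of the ball, where the concave term vanishes
  too; a plain constant could not be absorbed there.\<close>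

lemma bump_power_second_difference:
  assumes "0 < r" "r \<le> 1"
  shows "2 * bump c r x ^ Suc m - bump c r (x + h) ^ Suc m - bump c r (x - h) ^ Suc m
    \<le> 2 * real (Suc m) * bump c r x ^ m * min ((norm h)\<^sup>2) 1"
proof -
  let ?t = "real (Suc m) * bump c r x ^ m"
  have "bump c r x ^ Suc m - bump c r (x + h) ^ Suc m \<le> ?t * (bump c r x - bump c r (x + h))"
    "bump c r x ^ Suc m - bump c r (x - h) ^ Suc m \<le> ?t * (bump c r x - bump c r (x - h))"
    by (intro power_diff_le_tangent bump_nonneg)+
  moreover have "2 * X - Y - Y' \<le> t * (2 * b - a - a')"
    if "X - Y \<le> t * (b - a)" "X - Y' \<le> t * (b - a')" for X Y Y' t a a' b :: real
    using that by (simp add: algebra_simps)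
  ultimately have "2 * bump c r x ^ Suc m - bump c r (x + h) ^ Suc m - bump c r (x - h) ^ Suc m
      \<le> ?t * (2 * bump c r x - bump c r (x + h) - bump c r (x - h))"
    by blast
  also have "\<dots> \<le> ?t * (2 * min ((norm h)\<^sup>2) 1)"
    by (intro mult_left_mono bump_second_difference assms mult_nonneg_nonneg) auto
  finally show ?thesis by (simp only: mult.commute mult.left_commute mult.assoc)
qed

context frac_domain
begin

lemma bump_power_energy:
  assumes r: "0 < r" "r \<le> 1" and sub: "ball c r \<subseteq> \<Omega>"
  shows "(\<lambda>x. \<epsilon> * bump c r x ^ Suc m) \<in> energy"
proof (rule lipschitz_energy[where C = "(2 * \<epsilon> * real (Suc m))\<^sup>2"])
  show "(\<lambda>x. \<epsilon> * bump c r x ^ Suc m) \<in> borel_measurable borel" by measurable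
  show "\<epsilon> * bump c r x ^ Suc m = 0" if "x \<notin> \<Omega>" for x
  proof -
    have "\<not> 0 < bump c r x" using that sub by (auto simp: bump_pos_iff[OF r(1)])
    then have "bump c r x = 0" using bump_nonneg[of c r x] by linarith
    then show ?thesis by simp
  qed
  fix x y
  define a b where "a = bump c r x" and "b = bump c r y"
  have ab: "0 \<le> a" "a \<le> 1" "0 \<le> b" "b \<le> 1" unfolding a_def b_def using bump_le_1[OF r] by auto
  have *: "\<bar>a ^ Suc m - b ^ Suc m\<bar> \<le> real (Suc m) * \<bar>a - b\<bar>"
  proof -
    have le: "a ^ Suc m - b ^ Suc m \<le> real (Suc m) * \<bar>a - b\<bar>" if ab: "0 \<le> a" "a \<le> 1" "0 \<le> b" for a b
    proof -
      have "real (Suc m) * a ^ m * (a - b) \<le> real (Suc m) * a ^ m * \<bar>a - b\<bar>"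
        using ab by (intro mult_left_mono) auto
      also have "\<dots> \<le> real (Suc m) * 1 * \<bar>a - b\<bar>"
        using ab by (intro mult_right_mono mult_left_mono power_le_one) auto
      finally show ?thesis using power_diff_le_tangent[OF ab(1,3), of m] by linarith
    qed
    show ?thesis using le[of a b] le[of b a] ab by (simp add: abs_minus_commute abs_le_iff del: power_Suc)
  qed
  have "\<bar>a - b\<bar> \<le> 2 * min (norm (x - y)) 1"
  proof -
    have "\<bar>a - b\<bar> \<le> 2 * norm (x - y)" unfolding a_def b_def by (rule bump_lipschitz[OF r])
    moreover have "\<bar>a - b\<bar> \<le> 2" using ab by linarith
    ultimately show ?thesis by (simp add: min_def)
  qed
  then have "\<bar>a ^ Suc m - b ^ Suc m\<bar> \<le> real (Suc m) * (2 * min (norm (x - y)) 1)"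
    by (intro order.trans[OF *] mult_left_mono) auto
  then have "\<bar>a ^ Suc m - b ^ Suc m\<bar>\<^sup>2 \<le> (real (Suc m) * (2 * min (norm (x - y)) 1))\<^sup>2"
    by (rule power_mono) simp
  then have "\<epsilon>\<^sup>2 * (a ^ Suc m - b ^ Suc m)\<^sup>2 \<le> \<epsilon>\<^sup>2 * (real (Suc m) * (2 * min (norm (x - y)) 1))\<^sup>2"
    by (intro mult_left_mono) auto
  \<comment> \<open>Squaring is monotone on nonnegative numbers, so it commutes with the minimum;
    this produces the weight of \<open>lipschitz_energy\<close>.\<close>
  moreover have "(min (norm (x - y)) 1)\<^sup>2 = min ((norm (x - y))\<^sup>2) 1"
    by (auto simp: min_def power_le_one abs_square_le_1)
  ultimately show "(\<epsilon> * bump c r x ^ Suc m - \<epsilon> * bump c r y ^ Suc m)\<^sup>2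
      \<le> (2 * \<epsilon> * real (Suc m))\<^sup>2 * min ((norm (x - y))\<^sup>2) 1"
    unfolding a_def b_def by (simp only: right_diff_distrib[symmetric] power_mult_distrib) (simp add: ac_simps)
qed

lemma form_bump_power_le:
  assumes r: "0 < r" "r \<le> 1" and sub: "ball c r \<subseteq> \<Omega>" and \<epsilon>: "0 \<le> \<epsilon>"
    and \<phi>: "\<phi> \<in> energy" "\<And>x. 0 \<le> \<phi> x"
  shows "form (\<lambda>x. \<epsilon> * bump c r x ^ Suc m) \<phi>
    \<le> (\<integral>x. (2 * kernel_mass * real (Suc m) * \<epsilon> * bump c r x ^ m) * \<phi> x \<partial>lborel)"
proof -
  let ?G = "\<lambda>x. \<epsilon> * (2 * real (Suc m) * bump c r x ^ m)"
  have "form (\<lambda>x. \<epsilon> * bump c r x ^ Suc m) \<phi> \<le> kernel_mass * (\<integral>x. ?G x * \<phi> x \<partial>lborel)"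
  proof (rule form_le_second_difference[where Z = \<epsilon>])
    show "(\<lambda>x. \<epsilon> * bump c r x ^ Suc m) \<in> energy" by (rule bump_power_energy[OF r sub])
    show "\<bar>\<epsilon> * bump c r x ^ Suc m\<bar> \<le> \<epsilon>" for x
    proof -
      have "bump c r x ^ Suc m \<le> 1" using bump_le_1[OF r] by (intro power_le_one) auto
      then show ?thesis using \<epsilon> by (simp add: abs_mult mult_left_le del: power_Suc)
    qed
    show "integrable lborel (\<lambda>x. ?G x * \<phi> x)"
    proof (rule integrable_bounded_mult[OF _ _ \<phi>(1), where B = "\<epsilon> * (2 * real (Suc m))"])
      show "?G \<in> borel_measurable borel" by measurable
      show "\<bar>?G x\<bar> \<le> \<epsilon> * (2 * real (Suc m))" for x
      proof -
        have "bump c r x ^ m \<le> 1" using bump_le_1[OF r] by (intro power_le_one) auto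
        then have "2 * real (Suc m) * bump c r x ^ m \<le> 2 * real (Suc m)" by (intro mult_left_le) auto
        then have "?G x \<le> \<epsilon> * (2 * real (Suc m))" by (intro mult_left_mono \<epsilon>)
        moreover have "0 \<le> ?G x" using \<epsilon> by (intro mult_nonneg_nonneg) auto
        ultimately show ?thesis by simp
      qed
    qed
    show "0 \<le> ?G x" for x using \<epsilon> by (intro mult_nonneg_nonneg) auto
    show "2 * (\<epsilon> * bump c r x ^ Suc m) - \<epsilon> * bump c r (x + h) ^ Suc m - \<epsilon> * bump c r (x - h) ^ Suc m
        \<le> ?G x * min ((norm h)\<^sup>2) 1" for x h
      using mult_left_mono[OF bump_power_second_difference[OF r, of c x m h] \<epsilon>]
      by (simp add: right_diff_distrib mult.assoc mult.left_commute del: power_Suc)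
  qed (use \<phi> in auto)
  also have "\<dots> = (\<integral>x. kernel_mass * (?G x * \<phi> x) \<partial>lborel)" by simp
  also have "\<dots> = (\<integral>x. (2 * kernel_mass * real (Suc m) * \<epsilon> * bump c r x ^ m) * \<phi> x \<partial>lborel)"
    by (intro Bochner_Integration.integral_cong refl) (simp only: mult.assoc mult.commute mult.left_commute)
  finally show ?thesis .
qed

end

section \<open>Monotone iteration for systems\<close>

context frac_domain
begin

lemma energy_cong_AE:
  assumes u: "u \<in> energy" and [measurable]: "u' \<in> borel_measurable borel"
    and out: "\<And>x. x \<notin> \<Omega> \<Longrightarrow> u' x = 0" and eq: "AE x in lborel. u' x = u x"
  shows "u' \<in> energy" "\<phi> \<in> energy \<Longrightarrow> form u' \<phi> = form u \<phi>"
proof -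
  have [measurable]: "u \<in> borel_measurable borel" using u by (rule energy_measurable)
  have AE2: "AE z in lborel2. u' (fst z) = u (fst z) \<and> u' (snd z) = u (snd z)"
    by (rule AE_lborel_pair[OF eq])
  have "integrable lborel2 (\<lambda>z. (u' (fst z) - u' (snd z))\<^sup>2 * pair_kernel z)
      \<longleftrightarrow> integrable lborel2 (\<lambda>z. (u (fst z) - u (snd z))\<^sup>2 * pair_kernel z)"
  proof (rule integrable_cong_AE)
    show "AE z in lborel2. (u' (fst z) - u' (snd z))\<^sup>2 * pair_kernel z
        = (u (fst z) - u (snd z))\<^sup>2 * pair_kernel z"
      using AE2 by eventually_elim simp
  qed measurable
  then show "u' \<in> energy" using energy_integrable[OF u] out by (simp add: energy_def)
  show "form u' \<phi> = form u \<phi>" if "\<phi> \<in> energy"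
    unfolding form_def
  proof (rule integral_cong_AE)
    have [measurable]: "\<phi> \<in> borel_measurable borel" using that by (rule energy_measurable)
    show "(\<lambda>z. (u' (fst z) - u' (snd z)) * (\<phi> (fst z) - \<phi> (snd z)) * pair_kernel z) \<in> borel_measurable lborel2"
      "(\<lambda>z. (u (fst z) - u (snd z)) * (\<phi> (fst z) - \<phi> (snd z)) * pair_kernel z) \<in> borel_measurable lborel2"
      by measurable
    show "AE z in lborel2. (u' (fst z) - u' (snd z)) * (\<phi> (fst z) - \<phi> (snd z)) * pair_kernel z
        = (u (fst z) - u (snd z)) * (\<phi> (fst z) - \<phi> (snd z)) * pair_kernel z"
      using AE2 by eventually_elim simp
  qed
qed

section \<open>Order and limits for solutions of the linear problem\<close>

text \<open>The normalising constant is absorbed into \<open>f\<close>, which is why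
  \<open>nonlin\<close> carries a division by \<open>C\<close>.\<close>

definition solves :: "('a \<Rightarrow> real) \<Rightarrow> ('a \<Rightarrow> real) \<Rightarrow> bool" where
  "solves u f \<longleftrightarrow> u \<in> energy \<and> (\<forall>\<phi>\<in>energy. form u \<phi> = (\<integral>x. f x * \<phi> x \<partial>lborel))"

text \<open>The bounds hold at every point rather than almost everywhere, so that nonlinearities can
  be compared and limits taken pointwise.\<close>

definition admissible :: "real \<Rightarrow> ('a \<Rightarrow> real) \<Rightarrow> bool" where
  "admissible M u \<longleftrightarrow> u \<in> borel_measurable borel \<and> (\<forall>x. 0 \<le> u x \<and> u x \<le> M) \<and> (\<forall>x. x \<notin> \<Omega> \<longrightarrow> u x = 0)"

lemma solves_le:
  assumes z: "z \<in> energy" and u: "solves u f"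
    and le: "\<And>\<phi>. \<phi> \<in> energy \<Longrightarrow> (\<And>x. 0 \<le> \<phi> x) \<Longrightarrow> form z \<phi> \<le> (\<integral>x. f x * \<phi> x \<partial>lborel)"
  shows "AE x in lborel. z x \<le> u x"
proof -
  have u': "u \<in> energy" using u by (simp add: solves_def)
  have "AE x in lborel. z x - u x \<le> 0"
  proof (rule comparison[OF diff_energy[OF z u']])
    fix \<phi> assume \<phi>: "\<phi> \<in> energy" "\<And>x. 0 \<le> \<phi> x"
    then show "form (\<lambda>x. z x - u x) \<phi> \<le> 2 * 0 * killing * (\<integral>x. \<phi> x \<partial>lborel)"
      using le[OF \<phi>] u unfolding form_diff_left[OF z u' \<phi>(1)] by (simp add: solves_def)
  qed simp
  then show ?thesis by eventually_elim simp
qed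

lemma integral_mult_mono_domain:
  assumes f: "f \<in> borel_measurable borel" "\<And>x. x \<in> \<Omega> \<Longrightarrow> \<bar>f x\<bar> \<le> B"
    and g: "g \<in> borel_measurable borel" "\<And>x. x \<in> \<Omega> \<Longrightarrow> \<bar>g x\<bar> \<le> B'"
    and le: "\<And>x. x \<in> \<Omega> \<Longrightarrow> f x \<le> g x"
    and \<phi>: "\<phi> \<in> energy" "\<And>x. 0 \<le> \<phi> x"
  shows "(\<integral>x. f x * \<phi> x \<partial>lborel) \<le> (\<integral>x. g x * \<phi> x \<partial>lborel)"
proof (rule integral_mono)
  show "integrable lborel (\<lambda>x. f x * \<phi> x)" by (rule integrable_bounded_mult[OF f \<phi>(1)])
  show "integrable lborel (\<lambda>x. g x * \<phi> x)" by (rule integrable_bounded_mult[OF g \<phi>(1)])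
  show "f x * \<phi> x \<le> g x * \<phi> x" for x
    using le[of x] \<phi> by (cases "x \<in> \<Omega>") (auto simp: energy_outside intro: mult_right_mono)
qed

lemma solves_mono:
  assumes u: "solves u f" "solves v g"
    and f: "f \<in> borel_measurable borel" "\<And>x. x \<in> \<Omega> \<Longrightarrow> \<bar>f x\<bar> \<le> B"
    and g: "g \<in> borel_measurable borel" "\<And>x. x \<in> \<Omega> \<Longrightarrow> \<bar>g x\<bar> \<le> B'"
    and le: "\<And>x. x \<in> \<Omega> \<Longrightarrow> f x \<le> g x"
  shows "AE x in lborel. u x \<le> v x"
proof (rule solves_le[OF _ u(2)])
  show "u \<in> energy" using u(1) by (simp add: solves_def)
  show "form u \<phi> \<le> (\<integral>x. g x * \<phi> x \<partial>lborel)" if "\<phi> \<in> energy" "\<And>x. 0 \<le> \<phi> x" for \<phi>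
    using integral_mult_mono_domain[OF f g le that] u(1) that(1) by (simp add: solves_def)
qed

text \<open>The bound on \<open>f\<close> is exactly what \<open>comparison\<close> tolerates at
  height \<open>M\<close>. It makes the constant \<open>M\<close> a supersolution.\<close>

lemma solves_le_const:
  assumes u: "solves u f" and f: "f \<in> borel_measurable borel" "\<And>x. x \<in> \<Omega> \<Longrightarrow> \<bar>f x\<bar> \<le> 2 * M * killing"
    and M: "0 \<le> M"
  shows "AE x in lborel. u x \<le> M"
proof (rule comparison[OF _ M])
  show "u \<in> energy" using u by (simp add: solves_def)
  show "form u \<phi> \<le> 2 * M * killing * (\<integral>x. \<phi> x \<partial>lborel)" if "\<phi> \<in> energy" "\<And>x. 0 \<le> \<phi> x" for \<phi>
  proof -
    have "form u \<phi> = (\<integral>x. f x * \<phi> x \<partial>lborel)" using u that(1) by (simp add: solves_def)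
    also have "\<dots> \<le> (\<integral>x. (2 * M * killing) * \<phi> x \<partial>lborel)"
    proof (rule integral_mult_mono_domain[OF f _ _ _ that])
      show "\<bar>2 * M * killing\<bar> \<le> 2 * M * killing" using M killing_pos by simp
      show "f x \<le> 2 * M * killing" if "x \<in> \<Omega>" for x using f(2)[OF that] by linarith
    qed auto
    finally show ?thesis by simp
  qed
qed

lemma solves_nonneg:
  assumes u: "solves u f" and "\<And>x. x \<in> \<Omega> \<Longrightarrow> 0 \<le> f x"
  shows "AE x in lborel. 0 \<le> u x"
proof (rule solves_le[OF zero_energy u])
  fix \<phi> assume \<phi>: "\<phi> \<in> energy" "\<And>x. 0 \<le> \<phi> x"
  have "0 \<le> f x * \<phi> x" for x
    using assms(2)[of x] \<phi> by (cases "x \<in> \<Omega>") (auto simp: energy_outside)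
  then have "0 \<le> (\<integral>x. f x * \<phi> x \<partial>lborel)" by (intro integral_nonneg_AE) auto
  moreover have "form (\<lambda>x. 0) \<phi> = 0" by (simp add: form_def)
  ultimately show "form (\<lambda>x. 0) \<phi> \<le> (\<integral>x. f x * \<phi> x \<partial>lborel)" by simp
qed

lemma solves_cong_AE:
  assumes "solves u f" "u' \<in> borel_measurable borel" "\<And>x. x \<notin> \<Omega> \<Longrightarrow> u' x = 0"
    "AE x in lborel. u' x = u x"
  shows "solves u' f"
  using assms energy_cong_AE[of u u'] by (auto simp: solves_def)

text \<open>Comparison places the linear solution between 0 and \<open>u0\<close> only almost
  everywhere. Clipping it to that range changes it on a null set, which keeps it a solution and
  makes the order hold everywhere.\<close>

lemma solves_below:
  assumes u0: "admissible M u0" and f: "f \<in> borel_measurable borel"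
    "\<And>x. x \<in> \<Omega> \<Longrightarrow> 0 \<le> f x" "\<And>x. x \<in> \<Omega> \<Longrightarrow> f x \<le> B"
    and super: "\<And>w. solves w f \<Longrightarrow> AE x in lborel. w x \<le> u0 x"
  obtains u where "admissible M u" "solves u f" "\<And>x. u x \<le> u0 x"
proof -
  have "\<bar>f x\<bar> \<le> B" if "x \<in> \<Omega>" for x using f(2,3)[OF that] by simp
  from linear_problem[OF f(1) this] obtain w where w: "solves w f"
    unfolding solves_def by metis
  have [measurable]: "w \<in> borel_measurable borel" "u0 \<in> borel_measurable borel"
    using w u0 energy_measurable by (auto simp: solves_def admissible_def)
  define u where "u x = max 0 (min (w x) (u0 x))" for x
  have eq: "AE x in lborel. u x = w x"
  proof -
    have "AE x in lborel. 0 \<le> w x" by (rule solves_nonneg[OF w f(2)])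
    with super[OF w] show ?thesis by eventually_elim (simp add: u_def)
  qed
  have adm: "admissible M u"
    using u0 unfolding admissible_def u_def[abs_def] by (auto simp: min_def max_def intro: order.trans)
  show ?thesis
  proof (rule that[OF adm])
    show "solves u f"
      by (rule solves_cong_AE[OF w _ _ eq]) (use adm in \<open>auto simp: admissible_def\<close>)
    show "u x \<le> u0 x" for x using u0 unfolding u_def admissible_def by simp
  qed
qed

text \<open>Instead of passing to the limit inside the form, solve the linear problem with the
  limiting data and show that the sequence converges to that solution \<open>v\<close> in L2.
  Fatou's lemma then identifies the pointwise limit with \<open>v\<close> almost everywhere. The
  index shift reflects that the data of stage k determine stage k + 1.\<close>

lemma solves_limit:
  assumes U: "\<And>k. solves (U (Suc k)) (f k)"
    and f: "\<And>k. f k \<in> borel_measurable borel" "\<And>k x. x \<in> \<Omega> \<Longrightarrow> \<bar>f k x\<bar> \<le> B"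
    and g: "g \<in> borel_measurable borel" "\<And>x. x \<in> \<Omega> \<Longrightarrow> \<bar>g x\<bar> \<le> B"
    and f_lim: "\<And>x. x \<in> \<Omega> \<Longrightarrow> (\<lambda>k. f k x) \<longlonglongrightarrow> g x"
    and U_lim: "\<And>x. (\<lambda>k. U k x) \<longlonglongrightarrow> u x"
    and u: "u \<in> borel_measurable borel" "\<And>x. x \<notin> \<Omega> \<Longrightarrow> u x = 0"
  shows "solves u g"
proof -
  obtain v where v: "solves v g"
    using linear_problem[OF g] unfolding solves_def by metis
  have v_energy: "v \<in> energy" using v by (simp add: solves_def)
  have U_energy: "U (Suc k) \<in> energy" for k using U by (simp add: solves_def)
  note [measurable] = f(1) g(1) u(1) energy_measurable[OF v_energy] energy_measurable[OF U_energy]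
  define \<psi> where "\<psi> k x = U (Suc k) x - v x" for k x
  define d where "d k x = indicator \<Omega> x * (f k x - g x)\<^sup>2" for k x
  have \<psi>: "\<psi> k \<in> energy" for k unfolding \<psi>_def[abs_def] by (intro diff_energy U_energy v_energy)
  have ind: "integrable lborel (\<lambda>x. (2 * B)\<^sup>2 * indicator \<Omega> x)"
    using emeasure_domain by (intro integrable_mult_right) auto
  have d_le: "d k x \<le> (2 * B)\<^sup>2 * indicator \<Omega> x" for k x
  proof (cases "x \<in> \<Omega>")
    case True
    have "\<bar>f k x - g x\<bar> \<le> 2 * B" using f(2)[OF True, of k] g(2)[OF True] by linarith
    then have "\<bar>f k x - g x\<bar>\<^sup>2 \<le> (2 * B)\<^sup>2" by (intro power_mono) auto
    then show ?thesis using True by (simp add: d_def)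
  qed (simp add: d_def)
  have d_nonneg: "0 \<le> d k x" for k x by (simp add: d_def)
  have d_meas [measurable]: "d k \<in> borel_measurable borel" for k unfolding d_def[abs_def] by measurable
  have int_d: "integrable lborel (d k)" for k
    by (rule Bochner_Integration.integrable_bound[OF ind]) (use d_le d_nonneg in auto)
  have "(\<lambda>k. \<integral>x. d k x \<partial>lborel) \<longlonglongrightarrow> (\<integral>x. 0 \<partial>(lborel :: 'a measure))"
  proof (rule integral_dominated_convergence[OF _ _ ind])
    show "AE x in lborel. (\<lambda>k. d k x) \<longlonglongrightarrow> 0"
    proof (intro AE_I2)
      fix x
      show "(\<lambda>k. d k x) \<longlonglongrightarrow> 0"
      proof (cases "x \<in> \<Omega>")
        case True
        have "(\<lambda>k. (f k x - g x)\<^sup>2) \<longlonglongrightarrow> (g x - g x)\<^sup>2"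
          by (intro tendsto_intros f_lim True)
        then show ?thesis using True by (simp add: d_def)
      qed (simp add: d_def)
    qed
    show "AE x in lborel. norm (d k x) \<le> (2 * B)\<^sup>2 * indicator \<Omega> x" for k
      using d_le d_nonneg by (intro AE_I2) simp
  qed (auto simp: d_meas)
  then have d_lim: "(\<lambda>k. \<integral>x. d k x \<partial>lborel) \<longlonglongrightarrow> 0" by simp
  \<comment> \<open>Stability of the linear problem: Young's inequality with weight
    \<open>killing\<close> is absorbed by half of the Poincare bound, which leaves
    \<open>4 * killing\<^sup>2\<close> in the denominator.\<close>
  have \<psi>_le: "(\<integral>x. (\<psi> k x)\<^sup>2 \<partial>lborel) \<le> (\<integral>x. d k x \<partial>lborel) / (4 * killing\<^sup>2)" for k
  proof -
    have "2 * killing * (\<integral>x. (\<psi> k x)\<^sup>2 \<partial>lborel) \<le> form (\<psi> k) (\<psi> k)" by (rule poincare(2)[OF \<psi>])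
    also have "\<dots> = form (U (Suc k)) (\<psi> k) - form v (\<psi> k)"
      using form_diff_left[OF U_energy v_energy \<psi>] unfolding \<psi>_def[abs_def] .
    also have "\<dots> = (\<integral>x. f k x * \<psi> k x \<partial>lborel) - (\<integral>x. g x * \<psi> k x \<partial>lborel)"
      using U v \<psi> by (simp add: solves_def)
    also have "\<dots> = (\<integral>x. f k x * \<psi> k x - g x * \<psi> k x \<partial>lborel)"
      by (intro Bochner_Integration.integral_diff[symmetric] integrable_bounded_mult[OF f \<psi>]
          integrable_bounded_mult[OF g \<psi>])
    also have "\<dots> \<le> (\<integral>x. killing * (\<psi> k x)\<^sup>2 + d k x / (4 * killing) \<partial>lborel)"
    proof (rule integral_mono)
      show "integrable lborel (\<lambda>x. f k x * \<psi> k x - g x * \<psi> k x)"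
        by (intro Bochner_Integration.integrable_diff integrable_bounded_mult[OF f \<psi>]
          integrable_bounded_mult[OF g \<psi>])
      show "integrable lborel (\<lambda>x. killing * (\<psi> k x)\<^sup>2 + d k x / (4 * killing))"
        by (intro Bochner_Integration.integrable_add integrable_mult_right poincare(1) \<psi>
          Bochner_Integration.integrable_divide int_d)
      show "f k x * \<psi> k x - g x * \<psi> k x \<le> killing * (\<psi> k x)\<^sup>2 + d k x / (4 * killing)" for x
      proof (cases "x \<in> \<Omega>")
        case True
        have "0 \<le> (2 * killing * \<psi> k x - (f k x - g x))\<^sup>2" by simp
        also have "\<dots> = 4 * killing * (killing * (\<psi> k x)\<^sup>2 + (f k x - g x)\<^sup>2 / (4 * killing) - (f k x * \<psi> k x - g x * \<psi> k x))"
          using killing_pos by (simp add: power2_eq_square field_simps)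
        finally have "0 \<le> killing * (\<psi> k x)\<^sup>2 + (f k x - g x)\<^sup>2 / (4 * killing) - (f k x * \<psi> k x - g x * \<psi> k x)"
          using killing_pos by (simp add: zero_le_mult_iff)
        then show ?thesis using True by (simp add: d_def)
      qed (simp add: d_def energy_outside[OF \<psi>])
    qed
    also have "\<dots> = killing * (\<integral>x. (\<psi> k x)\<^sup>2 \<partial>lborel) + (\<integral>x. d k x \<partial>lborel) / (4 * killing)"
      by (subst Bochner_Integration.integral_add)
        (auto intro!: integrable_mult_right poincare(1) \<psi> Bochner_Integration.integrable_divide int_d)
    finally have "killing * (\<integral>x. (\<psi> k x)\<^sup>2 \<partial>lborel) \<le> (\<integral>x. d k x \<partial>lborel) / (4 * killing)" by simp
    then show ?thesis using killing_pos by (simp add: field_simps power2_eq_square)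
  qed
  have lim: "AE x in lborel. (\<lambda>k. (\<psi> k x)\<^sup>2) \<longlonglongrightarrow> (u x - v x)\<^sup>2"
  proof (intro AE_I2)
    fix x
    have "(\<lambda>k. U (Suc k) x) \<longlonglongrightarrow> u x" using U_lim by (rule LIMSEQ_Suc)
    then show "(\<lambda>k. (\<psi> k x)\<^sup>2) \<longlonglongrightarrow> (u x - v x)\<^sup>2"
      unfolding \<psi>_def by (intro tendsto_intros)
  qed
  have small: "integrable lborel (\<lambda>x. (u x - v x)\<^sup>2) \<and> (\<integral>x. (u x - v x)\<^sup>2 \<partial>lborel) \<le> e" if e: "0 < e" for e
  proof -
    have "0 < e * (4 * killing\<^sup>2)" using e killing_pos by simp
    from order_tendstoD(2)[OF d_lim this]
    have "\<forall>\<^sub>F k in sequentially. (\<integral>x. (\<psi> k x)\<^sup>2 \<partial>lborel) \<le> e"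
    proof eventually_elim
      case (elim k)
      then have "(\<integral>x. d k x \<partial>lborel) / (4 * killing\<^sup>2) \<le> e" using killing_pos by (simp add: field_simps)
      with \<psi>_le[of k] show ?case by linarith
    qed
    note * = fatou_bound[OF poincare(1)[OF \<psi>] _ _ _ lim this]
    show ?thesis by (intro conjI *) auto
  qed
  have int: "integrable lborel (\<lambda>x. (u x - v x)\<^sup>2)" using small[of 1] by simp
  have "(\<integral>x. (u x - v x)\<^sup>2 \<partial>lborel) \<le> 0"
    by (rule field_le_epsilon) (use small in simp)
  then have "(\<integral>x. (u x - v x)\<^sup>2 \<partial>lborel) = 0"
    by (intro antisym integral_nonneg_AE) auto
  then have "AE x in lborel. u x = v x"
    using integral_nonneg_eq_0_iff_AE[OF int] by auto
  with solves_cong_AE[OF v u(1)] u(2) show ?thesis by blast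
qed

lemma admissible_measurable: "admissible M u \<Longrightarrow> u \<in> borel_measurable borel"
  by (simp add: admissible_def)

lemma decreasing_admissible_limit:
  assumes adm: "\<And>k. admissible M (U k)" and dec: "\<And>k x. U (Suc k) x \<le> U k x"
  obtains u where "admissible M u" "\<And>x. (\<lambda>k. U k x) \<longlonglongrightarrow> u x"
proof
  define u where "u x = lim (\<lambda>k. U k x)" for x
  show lim: "(\<lambda>k. U k x) \<longlonglongrightarrow> u x" for x
  proof -
    have "decseq (\<lambda>k. U k x)" using dec by (simp add: decseq_Suc_iff)
    moreover have "0 \<le> U k x" for k using adm by (simp add: admissible_def)
    ultimately have "convergent (\<lambda>k. U k x)"
      using decseq_convergent[of "\<lambda>k. U k x" 0] by (metis convergent_def)
    then show ?thesis unfolding u_def by (simp add: convergent_LIMSEQ_iff)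
  qed
  have "u \<in> borel_measurable borel"
    using admissible_measurable[OF adm] unfolding u_def[abs_def] by measurable
  moreover have "0 \<le> u x \<and> u x \<le> M" for x
    using LIMSEQ_le_const[OF lim, of 0 x] LIMSEQ_le_const2[OF lim, of x M] adm
    by (auto simp: admissible_def)
  moreover have "u x = 0" if "x \<notin> \<Omega>" for x
    using LIMSEQ_unique[OF lim[of x], of 0] adm that by (simp add: admissible_def)
  ultimately show "admissible M u" by (simp add: admissible_def)
qed

text \<open>In both nonlinearities the first argument is the unknown of the equation itself and the
  second one the other unknown. The set \<open>Z\<close> consists of common subsolutions.\<close>

lemma monotone_iteration:
  assumes M: "0 \<le> M"
    and meas: "\<And>N u v. N \<in> {N1, N2} \<Longrightarrow> admissible M u \<Longrightarrow> admissible M v \<Longrightarrow> N u v \<in> borel_measurable borel"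
    and nonneg: "\<And>N u v x. N \<in> {N1, N2} \<Longrightarrow> admissible M u \<Longrightarrow> admissible M v \<Longrightarrow> x \<in> \<Omega> \<Longrightarrow> 0 \<le> N u v x"
    and bound: "\<And>N u v x. N \<in> {N1, N2} \<Longrightarrow> admissible M u \<Longrightarrow> admissible M v \<Longrightarrow> x \<in> \<Omega>
      \<Longrightarrow> N u v x \<le> 2 * M * killing"
    and mono: "\<And>N u v u' v' x. N \<in> {N1, N2} \<Longrightarrow> admissible M u \<Longrightarrow> admissible M v \<Longrightarrow>
      admissible M u' \<Longrightarrow> admissible M v' \<Longrightarrow> (\<And>y. u' y \<le> u y) \<Longrightarrow> (\<And>y. v' y \<le> v y) \<Longrightarrow> x \<in> \<Omega>
      \<Longrightarrow> N u' v' x \<le> N u v x"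
    and cont: "\<And>N U V u v x. N \<in> {N1, N2} \<Longrightarrow> (\<And>k. admissible M (U k)) \<Longrightarrow> (\<And>k. admissible M (V k)) \<Longrightarrow>
      admissible M u \<Longrightarrow> admissible M v \<Longrightarrow> (\<And>y. (\<lambda>k. U k y) \<longlonglongrightarrow> u y) \<Longrightarrow> (\<And>y. (\<lambda>k. V k y) \<longlonglongrightarrow> v y) \<Longrightarrow>
      x \<in> \<Omega> \<Longrightarrow> (\<lambda>k. N (U k) (V k) x) \<longlonglongrightarrow> N u v x"
    and Z: "\<And>z. z \<in> Z \<Longrightarrow> z \<in> energy" "\<And>z x. z \<in> Z \<Longrightarrow> z x \<le> M"
    and sub: "\<And>N z u v \<phi>. N \<in> {N1, N2} \<Longrightarrow> z \<in> Z \<Longrightarrow> admissible M u \<Longrightarrow> admissible M v \<Longrightarrow>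
      (AE x in lborel. z x \<le> u x) \<Longrightarrow> \<phi> \<in> energy \<Longrightarrow> (\<And>x. 0 \<le> \<phi> x) \<Longrightarrow>
      form z \<phi> \<le> (\<integral>x. N u v x * \<phi> x \<partial>lborel)"
  obtains u v where "admissible M u" "admissible M v" "solves u (N1 u v)" "solves v (N2 v u)"
    "\<And>z. z \<in> Z \<Longrightarrow> AE x in lborel. z x \<le> u x" "\<And>z. z \<in> Z \<Longrightarrow> AE x in lborel. z x \<le> v x"
proof -
  \<comment> \<open>The supersolution property is stated through solutions of the linear problem
    rather than as an inequality for \<open>form\<close>, because the starting function
    \<open>M * indicator \<Omega> x\<close> need not lie in \<open>energy\<close>.\<close>
  define super where "super N u v \<longleftrightarrow> (\<forall>w. solves w (N u v) \<longrightarrow> (AE x in lborel. w x \<le> u x))"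
    for N :: "('a \<Rightarrow> real) \<Rightarrow> ('a \<Rightarrow> real) \<Rightarrow> 'a \<Rightarrow> real" and u v
  define above where "above u \<longleftrightarrow> (\<forall>z\<in>Z. AE x in lborel. z x \<le> u x)" for u :: "'a \<Rightarrow> real"
  define P where "P p \<longleftrightarrow> admissible M (fst p) \<and> admissible M (snd p) \<and>
    super N1 (fst p) (snd p) \<and> super N2 (snd p) (fst p) \<and> above (fst p) \<and> above (snd p)"
    for p :: "('a \<Rightarrow> real) \<times> ('a \<Rightarrow> real)"
  define Q where "Q p p' \<longleftrightarrow> solves (fst p') (N1 (fst p) (snd p)) \<and> solves (snd p') (N2 (snd p) (fst p)) \<and>
    (\<forall>x. fst p' x \<le> fst p x) \<and> (\<forall>x. snd p' x \<le> snd p x)"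
    for p p' :: "('a \<Rightarrow> real) \<times> ('a \<Rightarrow> real)"
  have abs_bound: "\<bar>N u v x\<bar> \<le> 2 * M * killing"
    if "N \<in> {N1, N2}" "admissible M u" "admissible M v" "x \<in> \<Omega>" for N u v x
    using nonneg[OF that] bound[OF that] by simp
  have step: "\<exists>u'. admissible M u' \<and> solves u' (N u v) \<and> (\<forall>x. u' x \<le> u x) \<and> above u'"
    if N: "N \<in> {N1, N2}" and u: "admissible M u" and v: "admissible M v" and sup: "super N u v" and ab: "above u"
    for N u v
  proof -
    obtain u' where u': "admissible M u'" "solves u' (N u v)" "\<And>x. u' x \<le> u x"
      by (rule solves_below[OF u meas[OF N u v] nonneg[OF N u v] bound[OF N u v]])
        (use sup in \<open>auto simp: super_def\<close>)
    have "above u'"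
      unfolding above_def
    proof
      fix z assume z: "z \<in> Z"
      then have "AE x in lborel. z x \<le> u x" using ab by (simp add: above_def)
      from solves_le[OF Z(1)[OF z] u'(2) sub[OF N z u v this]]
      show "AE x in lborel. z x \<le> u' x" .
    qed
    with u' show ?thesis by blast
  qed
  \<comment> \<open>The new iterate solves with the old data, and the new data are smaller by
    monotonicity; hence the next solution lies below it.\<close>
  have super_step: "super N u' v'"
    if N: "N \<in> {N1, N2}" and adm: "admissible M u" "admissible M v" "admissible M u'" "admissible M v'"
      and le: "\<And>x. u' x \<le> u x" "\<And>x. v' x \<le> v x" and sol: "solves u' (N u v)" for N u v u' v'
    unfolding super_def
  proof (intro allI impI)
    fix w assume w: "solves w (N u' v')"
    show "AE x in lborel. w x \<le> u' x"
      by (rule solves_mono[OF w sol meas[OF N adm(3,4)] abs_bound[OF N adm(3,4)]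
            meas[OF N adm(1,2)] abs_bound[OF N adm(1,2)] mono[OF N adm le]])
  qed
  have "\<exists>f. \<forall>n. P (f n) \<and> Q (f n) (f (Suc n))"
  proof (rule dependent_nat_choice[where Q = "\<lambda>_. Q" and P = "\<lambda>_. P"])
    let ?m = "\<lambda>x. M * indicator \<Omega> x"
    have adm: "admissible M ?m" using M by (auto simp: admissible_def split: split_indicator)
    have sup: "super N ?m ?m" if N: "N \<in> {N1, N2}" for N
      unfolding super_def
    proof (intro allI impI)
      fix w assume w: "solves w (N ?m ?m)"
      have "AE x in lborel. w x \<le> M"
        by (rule solves_le_const[OF w meas[OF N adm adm] abs_bound[OF N adm adm] M])
      then show "AE x in lborel. w x \<le> ?m x"
        by eventually_elim (use w in \<open>auto simp: solves_def energy_outside split: split_indicator\<close>)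
    qed
    have "above ?m"
      unfolding above_def using Z(2) by (auto simp: energy_outside[OF Z(1)] split: split_indicator)
    then have "P (?m, ?m)" using adm sup by (simp add: P_def)
    then show "\<exists>p. P p" by blast
  next
    fix p n assume "P p"
    obtain u v where p: "p = (u, v)" by (cases p)
    have uv: "admissible M u" "admissible M v" "super N1 u v" "super N2 v u" "above u" "above v"
      using \<open>P p\<close> unfolding P_def p by simp_all
    obtain u' where u': "admissible M u'" "solves u' (N1 u v)" "\<And>x. u' x \<le> u x" "above u'"
      using step[of N1 u v] uv by auto
    obtain v' where v': "admissible M v'" "solves v' (N2 v u)" "\<And>x. v' x \<le> v x" "above v'"
      using step[of N2 v u] uv by auto
    have "P (u', v')"
      using super_step[of N1 u v u' v', OF _ uv(1,2) u'(1) v'(1) u'(3) v'(3) u'(2)]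
        super_step[of N2 v u v' u', OF _ uv(2,1) v'(1) u'(1) v'(3) u'(3) v'(2)] u' v' by (simp add: P_def)
    moreover have "Q p (u', v')" using u' v' by (simp add: Q_def p)
    ultimately show "\<exists>p'. P p' \<and> Q p p'" by blast
  qed
  then obtain f where f: "\<And>n. P (f n)" "\<And>n. Q (f n) (f (Suc n))" by blast
  define U V where "U n = fst (f n)" and "V n = snd (f n)" for n
  have adm: "admissible M (U n)" "admissible M (V n)" for n
    using f(1)[of n] by (simp_all add: P_def U_def V_def)
  have ab: "above (U n)" "above (V n)" for n
    using f(1)[of n] by (simp_all add: P_def U_def V_def)
  have sol: "solves (U (Suc n)) (N1 (U n) (V n))" "solves (V (Suc n)) (N2 (V n) (U n))" for n
    using f(2)[of n] by (simp_all add: Q_def U_def V_def)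
  have dec: "U (Suc n) x \<le> U n x" "V (Suc n) x \<le> V n x" for n x
    using f(2)[of n] by (simp_all add: Q_def U_def V_def)
  obtain u where u: "admissible M u" "\<And>x. (\<lambda>k. U k x) \<longlonglongrightarrow> u x"
    by (rule decreasing_admissible_limit[of M U]) (use adm dec in auto)
  obtain v where v: "admissible M v" "\<And>x. (\<lambda>k. V k x) \<longlonglongrightarrow> v x"
    by (rule decreasing_admissible_limit[of M V]) (use adm dec in auto)
  \<comment> \<open>Each iterate has its own exceptional null set; countably many of them are united
    before the limit is taken.\<close>
  have above_lim: "AE x in lborel. z x \<le> w x"
    if "z \<in> Z" "\<And>n. above (W n)" "\<And>x. (\<lambda>k. W k x) \<longlonglongrightarrow> w x" for z W w
  proof -
    have "AE x in lborel. \<forall>n. z x \<le> W n x"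
      using that(1,2) by (simp add: AE_all_countable above_def)
    then show ?thesis
      by eventually_elim (use LIMSEQ_le_const[OF that(3)] in blast)
  qed
  show ?thesis
  proof (rule that[OF u(1) v(1)])
    have N: "N1 \<in> {N1, N2}" "N2 \<in> {N1, N2}" by auto
    show "solves u (N1 u v)"
      by (rule solves_limit[of U "\<lambda>n. N1 (U n) (V n)", OF sol(1) meas[OF N(1) adm]
            abs_bound[OF N(1) adm] meas[OF N(1) u(1) v(1)] abs_bound[OF N(1) u(1) v(1)]
            cont[OF N(1) adm u(1) v(1) u(2) v(2)] u(2)])
        (use u in \<open>auto simp: admissible_def\<close>)
    show "solves v (N2 v u)"
      by (rule solves_limit[of V "\<lambda>n. N2 (V n) (U n)", OF sol(2) meas[OF N(2) adm(2,1)]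
            abs_bound[OF N(2) adm(2,1)] meas[OF N(2) v(1) u(1)] abs_bound[OF N(2) v(1) u(1)]
            cont[OF N(2) adm(2,1) v(1) u(1) v(2) u(2)] v(2)])
        (use v in \<open>auto simp: admissible_def\<close>)
  qed (use above_lim u(2) v(2) ab in auto)
qed

end

section \<open>The concave-convex system\<close>

lemma riesz_conv_borel:
  assumes [measurable]: "g \<in> borel_measurable borel"
  shows "riesz_conv \<mu> g x = (\<integral>y. norm (x - y) powr (- \<mu>) * g y \<partial>lborel)"
  unfolding riesz_conv_def by (rule integral_completion) measurable

locale concave_convex = frac_domain +
  fixes q \<mu> p C :: real
  assumes q: "1 < q" "q < 2" and \<mu>: "0 < \<mu>" "\<mu> < real DIM('a)" and p: "1 < p" and C: "0 < C"
begin

text \<open>Powers appear without absolute values because the iteration involves nonnegative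
  functions only.\<close>

definition nonlin :: "real \<Rightarrow> ('a \<Rightarrow> real) \<Rightarrow> ('a \<Rightarrow> real) \<Rightarrow> 'a \<Rightarrow> real" where
  "nonlin c u v x = (c * u x powr (q - 1) + riesz_conv \<mu> (\<lambda>y. v y powr p) x * u x powr (p - 1)) / C"

text \<open>Two points of \<Omega> are closer than \<open>2 * R\<close>, so the kernel is dominated
  by a translate of one singularity on a fixed ball; it is integrable since \<mu> is below the
  dimension, with an integral independent of \<open>x\<close>.\<close>

lemma riesz_domain_bound:
  obtains K where "0 < K" "\<And>x. x \<in> \<Omega> \<Longrightarrow> integrable lborel (\<lambda>y. norm (x - y) powr (- \<mu>) * indicator \<Omega> y)"
    "\<And>x. x \<in> \<Omega> \<Longrightarrow> (\<integral>y. norm (x - y) powr (- \<mu>) * indicator \<Omega> y \<partial>lborel) \<le> K"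
proof -
  obtain R where R: "0 < R" "\<And>x. x \<in> \<Omega> \<Longrightarrow> norm x < R"
    using bounded_domain bounded_pos_less by blast
  define g where "g h = indicator (ball 0 (2 * R)) h * norm h powr (- \<mu>)" for h :: 'a
  have g: "integrable lborel g"
    unfolding g_def[abs_def] using R(1) \<mu> by (intro integrable_norm_powr_ball) auto
  have g_meas: "g \<in> borel_measurable borel" using g by (auto dest: borel_measurable_integrable)
  have le: "norm (x - y) powr (- \<mu>) * indicator \<Omega> y \<le> g (x - y)" if "x \<in> \<Omega>" for x y
  proof (cases "y \<in> \<Omega>")
    case True
    have "norm (x - y) < 2 * R"
      using norm_triangle_ineq4[of x y] R(2)[OF that] R(2)[OF True] by linarith
    then show ?thesis using True by (simp add: g_def)
  qed (simp add: g_def)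
  have int_g: "integrable lborel (\<lambda>y. g (x - y))" for x
    using g by (simp add: integrable_reflect_iff[OF g_meas])
  have int: "integrable lborel (\<lambda>y. norm (x - y) powr (- \<mu>) * indicator \<Omega> y)" if "x \<in> \<Omega>" for x
  proof (rule Bochner_Integration.integrable_bound[OF int_g])
    show "(\<lambda>y. norm (x - y) powr (- \<mu>) * indicator \<Omega> y) \<in> borel_measurable lborel" by measurable
    show "AE y in lborel. norm (norm (x - y) powr (- \<mu>) * indicator \<Omega> y) \<le> norm (g (x - y))"
    proof (intro AE_I2)
      fix y
      have "0 \<le> norm (x - y) powr (- \<mu>) * indicator \<Omega> y" by simp
      with le[OF that, of y] show "norm (norm (x - y) powr (- \<mu>) * indicator \<Omega> y) \<le> norm (g (x - y))"
        unfolding real_norm_def by linarith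
    qed
  qed
  have bound: "(\<integral>y. norm (x - y) powr (- \<mu>) * indicator \<Omega> y \<partial>lborel) \<le> (\<integral>h. g h \<partial>lborel) + 1"
    if "x \<in> \<Omega>" for x
  proof -
    have "(\<integral>y. norm (x - y) powr (- \<mu>) * indicator \<Omega> y \<partial>lborel) \<le> (\<integral>y. g (x - y) \<partial>lborel)"
      by (intro integral_mono int int_g le that)
    also have "\<dots> = (\<integral>h. g h \<partial>lborel)" by (rule integral_reflect[OF g_meas])
    finally show ?thesis by simp
  qed
  have "0 \<le> (\<integral>h. g h \<partial>lborel)" by (intro integral_nonneg_AE AE_I2) (simp add: g_def)
  then have "0 < (\<integral>h. g h \<partial>lborel) + 1" by simp
  from that[OF this int bound] show ?thesis .
qed

definition riesz_bound :: real where
  "riesz_bound = (SOME K. 0 < K \<and>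
    (\<forall>x\<in>\<Omega>. integrable lborel (\<lambda>y. norm (x - y) powr (- \<mu>) * indicator \<Omega> y) \<and>
      (\<integral>y. norm (x - y) powr (- \<mu>) * indicator \<Omega> y \<partial>lborel) \<le> K))"

lemma riesz_bound:
  "0 < riesz_bound"
  "x \<in> \<Omega> \<Longrightarrow> integrable lborel (\<lambda>y. norm (x - y) powr (- \<mu>) * indicator \<Omega> y)"
  "x \<in> \<Omega> \<Longrightarrow> (\<integral>y. norm (x - y) powr (- \<mu>) * indicator \<Omega> y \<partial>lborel) \<le> riesz_bound"
proof -
  have "\<exists>K. 0 < K \<and>
    (\<forall>x\<in>\<Omega>. integrable lborel (\<lambda>y. norm (x - y) powr (- \<mu>) * indicator \<Omega> y) \<and>
      (\<integral>y. norm (x - y) powr (- \<mu>) * indicator \<Omega> y \<partial>lborel) \<le> K)"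
    by (rule riesz_domain_bound) blast
  from someI_ex[OF this] show "0 < riesz_bound"
    "x \<in> \<Omega> \<Longrightarrow> integrable lborel (\<lambda>y. norm (x - y) powr (- \<mu>) * indicator \<Omega> y)"
    "x \<in> \<Omega> \<Longrightarrow> (\<integral>y. norm (x - y) powr (- \<mu>) * indicator \<Omega> y \<partial>lborel) \<le> riesz_bound"
    unfolding riesz_bound_def by blast+
qed

lemma powr_admissible_le:
  assumes "admissible M v"
  shows "v y powr p \<le> M powr p * indicator \<Omega> y"
  using assms p by (cases "y \<in> \<Omega>") (auto simp: admissible_def intro: powr_mono2)

lemma riesz_integrand_le:
  assumes "admissible M v"
  shows "norm (x - y) powr (- \<mu>) * v y powr p \<le> M powr p * (norm (x - y) powr (- \<mu>) * indicator \<Omega> y)"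
proof -
  have "norm (x - y) powr (- \<mu>) * v y powr p \<le> norm (x - y) powr (- \<mu>) * (M powr p * indicator \<Omega> y)"
    by (intro mult_left_mono powr_admissible_le[OF assms]) simp
  then show ?thesis by (simp only: mult.left_commute)
qed

lemma integrable_riesz:
  assumes v: "admissible M v" and x: "x \<in> \<Omega>"
  shows "integrable lborel (\<lambda>y. norm (x - y) powr (- \<mu>) * v y powr p)"
proof (rule Bochner_Integration.integrable_bound)
  have [measurable]: "v \<in> borel_measurable borel" using v by (rule admissible_measurable)
  show "integrable lborel (\<lambda>y. M powr p * (norm (x - y) powr (- \<mu>) * indicator \<Omega> y))"
    by (intro integrable_mult_right riesz_bound(2) x)
  show "AE y in lborel. norm (norm (x - y) powr (- \<mu>) * v y powr p)
      \<le> norm (M powr p * (norm (x - y) powr (- \<mu>) * indicator \<Omega> y))"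
    by (intro AE_I2) (simp add: abs_mult riesz_integrand_le[OF v])
  show "(\<lambda>y. norm (x - y) powr (- \<mu>) * v y powr p) \<in> borel_measurable lborel" by measurable
qed

lemma riesz_conv_powr:
  assumes "admissible M v"
  shows "riesz_conv \<mu> (\<lambda>y. v y powr p) x = (\<integral>y. norm (x - y) powr (- \<mu>) * v y powr p \<partial>lborel)"
proof -
  have [measurable]: "v \<in> borel_measurable borel" using assms by (rule admissible_measurable)
  show ?thesis by (rule riesz_conv_borel) measurable
qed

lemma riesz_conv_nonneg:
  assumes "admissible M v"
  shows "0 \<le> riesz_conv \<mu> (\<lambda>y. v y powr p) x"
  unfolding riesz_conv_powr[OF assms] by (intro integral_nonneg_AE AE_I2) simp

lemma riesz_conv_le:
  assumes v: "admissible M v" and x: "x \<in> \<Omega>"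
  shows "riesz_conv \<mu> (\<lambda>y. v y powr p) x \<le> riesz_bound * M powr p"
proof -
  have "riesz_conv \<mu> (\<lambda>y. v y powr p) x \<le> (\<integral>y. M powr p * (norm (x - y) powr (- \<mu>) * indicator \<Omega> y) \<partial>lborel)"
    unfolding riesz_conv_powr[OF v]
  proof (rule integral_mono)
    show "integrable lborel (\<lambda>y. norm (x - y) powr (- \<mu>) * v y powr p)" by (rule integrable_riesz[OF v x])
    show "integrable lborel (\<lambda>y. M powr p * (norm (x - y) powr (- \<mu>) * indicator \<Omega> y))"
      by (intro integrable_mult_right riesz_bound(2) x)
    show "norm (x - y) powr (- \<mu>) * v y powr p \<le> M powr p * (norm (x - y) powr (- \<mu>) * indicator \<Omega> y)" for y
      by (rule riesz_integrand_le[OF v])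
  qed
  also have "\<dots> \<le> M powr p * riesz_bound"
    using riesz_bound(3)[OF x] by (simp add: mult_left_mono)
  finally show ?thesis by (simp add: mult.commute)
qed

lemma riesz_conv_mono:
  assumes v: "admissible M v" "admissible M v'" and le: "\<And>y. v' y \<le> v y" and x: "x \<in> \<Omega>"
  shows "riesz_conv \<mu> (\<lambda>y. v' y powr p) x \<le> riesz_conv \<mu> (\<lambda>y. v y powr p) x"
  unfolding riesz_conv_powr[OF v(1)] riesz_conv_powr[OF v(2)]
proof (rule integral_mono[OF integrable_riesz[OF v(2) x] integrable_riesz[OF v(1) x]])
  fix y
  have "v' y powr p \<le> v y powr p"
    using v le p by (intro powr_mono2) (auto simp: admissible_def)
  then show "norm (x - y) powr (- \<mu>) * v' y powr p \<le> norm (x - y) powr (- \<mu>) * v y powr p"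
    by (intro mult_left_mono) auto
qed

lemma tendsto_powr_admissible:
  assumes V: "\<And>k. admissible M (V k)" and lim: "(\<lambda>k. V k y) \<longlonglongrightarrow> v y" and r: "0 < r"
  shows "(\<lambda>k. V k y powr r) \<longlonglongrightarrow> v y powr r"
  using V r by (intro tendsto_powr' lim tendsto_const) (auto simp: admissible_def)

text \<open>Dominated convergence: the uniform bound \<open>M\<close> yields the majorant, and
  positivity of \<open>p\<close> makes the power continuous at 0.\<close>

lemma riesz_conv_tendsto:
  assumes V: "\<And>k. admissible M (V k)" and v: "admissible M v"
    and lim: "\<And>y. (\<lambda>k. V k y) \<longlonglongrightarrow> v y" and x: "x \<in> \<Omega>"
  shows "(\<lambda>k. riesz_conv \<mu> (\<lambda>y. V k y powr p) x) \<longlonglongrightarrow> riesz_conv \<mu> (\<lambda>y. v y powr p) x"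
  unfolding riesz_conv_powr[OF V] riesz_conv_powr[OF v]
proof (rule integral_dominated_convergence)
  have [measurable]: "v \<in> borel_measurable borel" "V k \<in> borel_measurable borel" for k
    using v V by (auto intro: admissible_measurable)
  show "integrable lborel (\<lambda>y. M powr p * (norm (x - y) powr (- \<mu>) * indicator \<Omega> y))"
    by (intro integrable_mult_right riesz_bound(2) x)
  show "AE y in lborel. (\<lambda>k. norm (x - y) powr (- \<mu>) * V k y powr p) \<longlonglongrightarrow> norm (x - y) powr (- \<mu>) * v y powr p"
    using p by (intro AE_I2 tendsto_mult tendsto_const tendsto_powr_admissible[OF V lim]) auto
  show "AE y in lborel. norm (norm (x - y) powr (- \<mu>) * V k y powr p)
      \<le> M powr p * (norm (x - y) powr (- \<mu>) * indicator \<Omega> y)" for k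
    by (intro AE_I2) (simp add: abs_mult riesz_integrand_le[OF V])
  show "(\<lambda>y. norm (x - y) powr (- \<mu>) * v y powr p) \<in> borel_measurable lborel"
    "(\<lambda>y. norm (x - y) powr (- \<mu>) * V k y powr p) \<in> borel_measurable lborel" for k
    by measurable
qed

lemma riesz_conv_measurable:
  assumes v: "admissible M v"
  shows "(\<lambda>x. riesz_conv \<mu> (\<lambda>y. v y powr p) x) \<in> borel_measurable borel"
proof -
  have [measurable]: "v \<in> borel_measurable borel" using v by (rule admissible_measurable)
  have "(\<lambda>x. \<integral>y. norm (x - y) powr (- \<mu>) * v y powr p \<partial>lborel) \<in> borel_measurable lborel"
    by (rule lborel.borel_measurable_lebesgue_integral) measurable
  then show ?thesis by (simp add: riesz_conv_powr[OF v])
qed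

section \<open>Order properties of the nonlinearity\<close>

lemma nonlin_measurable:
  assumes "admissible M u" "admissible M v"
  shows "nonlin c u v \<in> borel_measurable borel"
proof -
  have [measurable]: "u \<in> borel_measurable borel" using assms(1) by (rule admissible_measurable)
  note riesz_conv_measurable[OF assms(2), measurable]
  show ?thesis unfolding nonlin_def[abs_def] by measurable
qed

lemma nonlin_nonneg:
  assumes "0 \<le> c" "admissible M u" "admissible M v"
  shows "0 \<le> nonlin c u v x"
  unfolding nonlin_def using assms C riesz_conv_nonneg[OF assms(3)]
  by (intro divide_nonneg_nonneg add_nonneg_nonneg mult_nonneg_nonneg) auto

lemma nonlin_mono:
  assumes c: "0 \<le> c" and adm: "admissible M u" "admissible M v" "admissible M u'" "admissible M v'"
    and le: "\<And>y. u' y \<le> u y" "\<And>y. v' y \<le> v y" and x: "x \<in> \<Omega>"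
  shows "nonlin c u' v' x \<le> nonlin c u v x"
proof -
  have "u' x powr r \<le> u x powr r" if "0 \<le> r" for r
    using that adm le by (intro powr_mono2) (auto simp: admissible_def)
  then show ?thesis
    unfolding nonlin_def using c C q p
    by (intro divide_right_mono add_mono mult_mono mult_left_mono riesz_conv_mono[OF adm(2,4) le(2) x]
      riesz_conv_nonneg[OF adm(2)]) auto
qed

lemma nonlin_le:
  assumes c: "0 \<le> c" and adm: "admissible M u" "admissible M v" and x: "x \<in> \<Omega>"
  shows "nonlin c u v x \<le> (c * M powr (q - 1) + riesz_bound * M powr p * M powr (p - 1)) / C"
proof -
  have u: "0 \<le> u x" "u x \<le> M" using adm by (auto simp: admissible_def)
  have pw: "u x powr r \<le> M powr r" if "0 \<le> r" for r using that u by (intro powr_mono2) auto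
  have "0 \<le> riesz_bound * M powr p" using riesz_bound(1) by simp
  then show ?thesis
    unfolding nonlin_def using c C q p
    by (intro divide_right_mono add_mono mult_mono mult_left_mono riesz_conv_le adm x pw) auto
qed

lemma nonlin_tendsto:
  assumes "\<And>k. admissible M (U k)" "\<And>k. admissible M (V k)" "admissible M u" "admissible M v"
    and "\<And>y. (\<lambda>k. U k y) \<longlonglongrightarrow> u y" "\<And>y. (\<lambda>k. V k y) \<longlonglongrightarrow> v y" and x: "x \<in> \<Omega>"
  shows "(\<lambda>k. nonlin c (U k) (V k) x) \<longlonglongrightarrow> nonlin c u v x"
  unfolding nonlin_def using q p C
  by (intro tendsto_divide tendsto_add tendsto_mult tendsto_const
      tendsto_powr_admissible[OF assms(1) assms(5)] riesz_conv_tendsto[OF assms(2,4,6) x]) auto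

text \<open>The convolution term is nonnegative and is discarded; near zero the concave term alone
  suffices.\<close>

lemma nonlin_ge:
  assumes c: "0 \<le> c" and adm: "admissible M u" "admissible M v" and z: "0 \<le> z" "z \<le> u x"
  shows "c / C * z powr (q - 1) \<le> nonlin c u v x"
proof -
  have "z powr (q - 1) \<le> u x powr (q - 1)" using z q by (intro powr_mono2) auto
  then have "c * z powr (q - 1) \<le> c * u x powr (q - 1)" using c by (intro mult_left_mono)
  moreover have "0 \<le> riesz_conv \<mu> (\<lambda>y. v y powr p) x * u x powr (p - 1)"
    using riesz_conv_nonneg[OF adm(2)] by (intro mult_nonneg_nonneg) auto
  ultimately have "c * z powr (q - 1) \<le> c * u x powr (q - 1) + riesz_conv \<mu> (\<lambda>y. v y powr p) x * u x powr (p - 1)"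
    by linarith
  from divide_right_mono[OF this, of C] show ?thesis unfolding nonlin_def using C by simp
qed

text \<open>The exponent \<open>m + 1\<close> of the bump is so large that \<open>m \<ge> (m + 1) (q - 1)\<close>; hence the
  second-difference bound \<open>bump ^ m\<close> is absorbed by the concave term \<open>(bump ^ (m + 1)) powr (q - 1)\<close>.\<close>

lemma bump_subsolution:
  assumes m: "real (Suc m) * (q - 1) \<le> real m" "0 < m"
    and \<epsilon>: "0 < \<epsilon>" "2 * kernel_mass * real (Suc m) * \<epsilon> \<le> c / C * \<epsilon> powr (q - 1)" and c: "0 \<le> c"
    and r: "0 < r" "r \<le> 1" "ball d r \<subseteq> \<Omega>"
    and adm: "admissible M u" "admissible M v" and le: "AE x in lborel. \<epsilon> * bump d r x ^ Suc m \<le> u x"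
    and \<phi>: "\<phi> \<in> energy" "\<And>x. 0 \<le> \<phi> x"
  shows "form (\<lambda>x. \<epsilon> * bump d r x ^ Suc m) \<phi> \<le> (\<integral>x. nonlin c u v x * \<phi> x \<partial>lborel)"
proof -
  let ?b = "bump d r"
  let ?B = "(c * M powr (q - 1) + riesz_bound * M powr p * M powr (p - 1)) / C"
  have "form (\<lambda>x. \<epsilon> * ?b x ^ Suc m) \<phi> \<le> (\<integral>x. (2 * kernel_mass * real (Suc m) * \<epsilon> * ?b x ^ m) * \<phi> x \<partial>lborel)"
    using \<epsilon> by (intro form_bump_power_le r \<phi>) auto
  also have "\<dots> \<le> (\<integral>x. nonlin c u v x * \<phi> x \<partial>lborel)"
  proof (rule integral_mono_AE)
    have b: "0 \<le> ?b x ^ m" "?b x ^ m \<le> 1" for x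
      by (simp_all add: power_le_one bump_le_1[OF r(1,2)])
    show "integrable lborel (\<lambda>x. (2 * kernel_mass * real (Suc m) * \<epsilon> * ?b x ^ m) * \<phi> x)"
    proof (rule integrable_bounded_mult[OF _ _ \<phi>(1)])
      show "(\<lambda>x. 2 * kernel_mass * real (Suc m) * \<epsilon> * ?b x ^ m) \<in> borel_measurable borel" by measurable
      show "\<bar>2 * kernel_mass * real (Suc m) * \<epsilon> * ?b x ^ m\<bar> \<le> \<bar>2 * kernel_mass * real (Suc m) * \<epsilon>\<bar>" for x
        using b[of x] unfolding abs_mult[of _ "?b x ^ m"] by (intro mult_left_le) auto
    qed
    show "integrable lborel (\<lambda>x. nonlin c u v x * \<phi> x)"
    proof (rule integrable_bounded_mult[OF nonlin_measurable[OF adm] _ \<phi>(1)])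
      show "\<bar>nonlin c u v x\<bar> \<le> ?B" if "x \<in> \<Omega>" for x
        using nonlin_le[OF c adm that] nonlin_nonneg[OF c adm, of x] by simp
    qed
    show "AE x in lborel. (2 * kernel_mass * real (Suc m) * \<epsilon> * ?b x ^ m) * \<phi> x \<le> nonlin c u v x * \<phi> x"
      using le
    proof eventually_elim
      case (elim x)
      \<comment> \<open>As the bump is at most 1, the smaller exponent gives the larger power. Where
        the bump is 0, positivity of \<open>m\<close> makes the left side 0.\<close>
      have "?b x ^ m \<le> (?b x ^ Suc m) powr (q - 1)"
      proof (cases "?b x = 0")
        case False
        then have pos: "0 < ?b x" using bump_nonneg[of d r x] by linarith
        have "(?b x ^ Suc m) powr (q - 1) = ?b x powr (real (Suc m) * (q - 1))"
          using pos by (simp add: powr_powr del: power_Suc of_nat_Suc flip: powr_realpow)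
        moreover have "?b x ^ m = ?b x powr real m" using pos by (simp add: powr_realpow)
        moreover have "?b x powr real m \<le> ?b x powr (real (Suc m) * (q - 1))"
          using m pos bump_le_1[OF r(1,2), of d x] by (intro powr_mono') auto
        ultimately show ?thesis by simp
      next
        case True
        then show ?thesis using m(2) by (simp add: power_0_left)
      qed
      moreover have "0 \<le> c / C * \<epsilon> powr (q - 1)" using c C by simp
      ultimately have "2 * kernel_mass * real (Suc m) * \<epsilon> * ?b x ^ m
          \<le> c / C * \<epsilon> powr (q - 1) * (?b x ^ Suc m) powr (q - 1)"
        using mult_mono[OF \<epsilon>(2) _ _ b(1)[of x]] by blast
      also have "\<dots> = c / C * (\<epsilon> * ?b x ^ Suc m) powr (q - 1)"
        using \<epsilon> by (simp add: powr_mult del: power_Suc)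
      also have "\<dots> \<le> nonlin c u v x"
        using elim \<epsilon> by (intro nonlin_ge[OF c adm]) auto
      finally show ?case using \<phi>(2) by (intro mult_right_mono)
    qed
  qed
  finally show ?thesis .
qed

text \<open>After division by \<open>\<epsilon> powr (q - 1)\<close> the claim reads
  \<open>A * \<epsilon> powr (2 - q) \<le> t\<close>, which holds for small \<epsilon> because q <
  2. Using \<open>A + 1\<close> avoids a division by 0.\<close>

lemma small_scale:
  assumes "0 < t" "0 < M" "0 \<le> A"
  obtains \<epsilon> where "0 < \<epsilon>" "\<epsilon> \<le> M" "A * \<epsilon> \<le> t * \<epsilon> powr (q - 1)"
proof
  define \<epsilon> where "\<epsilon> = min M ((t / (A + 1)) powr (1 / (2 - q)))"
  have pos: "0 < t / (A + 1)" using assms by simp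
  show \<epsilon>: "0 < \<epsilon>" unfolding \<epsilon>_def using assms pos by simp
  show "\<epsilon> \<le> M" unfolding \<epsilon>_def by simp
  have "\<epsilon> powr (2 - q) \<le> ((t / (A + 1)) powr (1 / (2 - q))) powr (2 - q)"
    unfolding \<epsilon>_def using q assms pos by (intro powr_mono2) auto
  also have "\<dots> = (t / (A + 1)) powr 1" using q by (simp only: powr_powr) simp
  also have "\<dots> = t / (A + 1)" using pos by (intro powr_one) simp
  finally have "(A + 1) * \<epsilon> powr (2 - q) \<le> t" using assms by (simp add: field_simps)
  moreover have "A * \<epsilon> powr (2 - q) \<le> (A + 1) * \<epsilon> powr (2 - q)" by (intro mult_right_mono) auto
  ultimately have "A * \<epsilon> powr (2 - q) \<le> t" by linarith
  then have "A * \<epsilon> powr (2 - q) * \<epsilon> powr (q - 1) \<le> t * \<epsilon> powr (q - 1)" by (intro mult_right_mono) auto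
  moreover have "\<epsilon> powr (2 - q) * \<epsilon> powr (q - 1) = \<epsilon>"
    using \<epsilon> by (simp flip: powr_add)
  ultimately show "A * \<epsilon> \<le> t * \<epsilon> powr (q - 1)" by (simp only: mult.assoc)
qed

text \<open>Each ball brings its own null set and there are uncountably many balls, so Lindelof's
  theorem is used to pass to a countable subcover.\<close>

lemma AE_positive_if_above_bumps:
  assumes ab: "\<And>d r. 0 < r \<Longrightarrow> r \<le> 1 \<Longrightarrow> ball d r \<subseteq> \<Omega> \<Longrightarrow> AE x in lborel. \<epsilon> * bump d r x ^ k \<le> u x"
    and \<epsilon>: "0 < \<epsilon>"
  shows "AE x in lborel. x \<in> \<Omega> \<longrightarrow> 0 < u x"
proof -
  define F where "F = {ball d r |d r. 0 < r \<and> r \<le> 1 \<and> ball d r \<subseteq> \<Omega>}"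
  have "\<Omega> \<subseteq> \<Union>F"
  proof
    fix x assume "x \<in> \<Omega>"
    then obtain e where e: "0 < e" "ball x e \<subseteq> \<Omega>" using open_domain by (auto simp: open_contains_ball)
    have "ball x (min e 1) \<subseteq> \<Omega>" using e(2) by (auto simp: subset_eq)
    moreover have "0 < min e 1" "min e 1 \<le> 1" using e(1) by auto
    ultimately have "ball x (min e 1) \<in> F" unfolding F_def by blast
    moreover have "x \<in> ball x (min e 1)" using e(1) by simp
    ultimately show "x \<in> \<Union>F" by blast
  qed
  moreover have "\<And>S. S \<in> F \<Longrightarrow> open S" unfolding F_def by auto
  then obtain F' where F': "F' \<subseteq> F" "countable F'" "\<Union>F' = \<Union>F" by (rule Lindelof)
  have "AE x in lborel. \<forall>S\<in>F'. x \<in> S \<longrightarrow> 0 < u x"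
  proof (rule AE_ball_countable'[OF _ F'(2)])
    fix S assume "S \<in> F'"
    then obtain d r where S: "S = ball d r" and r: "0 < r" "r \<le> 1" "ball d r \<subseteq> \<Omega>"
      using F'(1) unfolding F_def by auto
    show "AE x in lborel. x \<in> S \<longrightarrow> 0 < u x"
      using ab[OF r]
    proof eventually_elim
      case (elim x)
      show ?case
      proof
        assume "x \<in> S"
        then have "0 < \<epsilon> * bump d r x ^ k" using \<epsilon> bump_pos_iff[OF r(1), of d x] S by simp
        with elim show "0 < u x" by linarith
      qed
    qed
  qed
  then show ?thesis
    by eventually_elim (use \<open>\<Omega> \<subseteq> \<Union>F\<close> F'(3) in blast)
qed

lemma positive_solution_exists:
  obtains T where "0 < T" "\<And>lam del. 0 < lam \<Longrightarrow> lam < T \<Longrightarrow> 0 < del \<Longrightarrow> del < T \<Longrightarrow>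
    \<exists>M u v. admissible M u \<and> admissible M v \<and> solves u (nonlin lam u v) \<and> solves v (nonlin del v u) \<and>
      (AE x in lborel. x \<in> \<Omega> \<longrightarrow> 0 < u x \<and> 0 < v x)"
proof -
  \<comment> \<open>Multiplied by \<open>C\<close>, the allowance \<open>2 * M * killing\<close> is
    \<open>2 * (a * M)\<close>. \<open>M\<close> is chosen so that the convolution term at height
    \<open>M\<close> takes exactly one half of it; \<open>T\<close> below reserves the other half
    for the concave term.\<close>
  define a where "a = C * killing"
  have a: "0 < a" unfolding a_def using C killing_pos by simp
  define M where "M = (a / riesz_bound) powr (1 / (2 * p - 2))"
  have M: "0 < M" unfolding M_def using a riesz_bound(1) by simp
  have M_eq: "riesz_bound * M powr (2 * p - 2) = a"
  proof -
    have pos: "0 < a / riesz_bound" using a riesz_bound(1) by simp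
    have "M powr (2 * p - 2) = (a / riesz_bound) powr 1"
      unfolding M_def using p by (simp only: powr_powr) simp
    also have "\<dots> = a / riesz_bound" using pos by (intro powr_one) simp
    finally show ?thesis using riesz_bound(1) by simp
  qed
  define T where "T = a * M powr (2 - q)"
  have T: "0 < T" unfolding T_def using a M by simp
  have cap: "(c * M powr (q - 1) + riesz_bound * M powr p * M powr (p - 1)) / C \<le> 2 * M * killing"
    if "c < T" for c
  proof -
    have "c * M powr (q - 1) \<le> T * M powr (q - 1)" using that by (intro mult_right_mono) auto
    also have "\<dots> = a * (M powr (2 - q) * M powr (q - 1))" unfolding T_def by simp
    also have "M powr (2 - q) * M powr (q - 1) = M" using M by (simp flip: powr_add)
    finally have 1: "c * M powr (q - 1) \<le> a * M" .
    have "M powr p * M powr (p - 1) = M powr (2 * p - 2) * M powr 1"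
      unfolding powr_add[symmetric] by simp
    then have "riesz_bound * M powr p * M powr (p - 1) = (riesz_bound * M powr (2 * p - 2)) * M"
      using M by (simp add: mult.assoc)
    then have "riesz_bound * M powr p * M powr (p - 1) = a * M" unfolding M_eq .
    with 1 have "c * M powr (q - 1) + riesz_bound * M powr p * M powr (p - 1) \<le> 2 * (a * M)" by linarith
    from divide_right_mono[OF this, of C] show ?thesis using C unfolding a_def by (simp add: ac_simps)
  qed
  \<comment> \<open>The inequality is equivalent to \<open>q - 1 \<le> real m * (2 - q)\<close>,
    solvable since q < 2; q > 1 forces \<open>m\<close> to be positive.\<close>
  obtain m :: nat where m: "0 < m" "real (Suc m) * (q - 1) \<le> real m"
  proof -
    obtain m :: nat where "(q - 1) / (2 - q) < real m" using reals_Archimedean2 by blast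
    then have "q - 1 \<le> real m * (2 - q)" using q by (simp add: field_simps)
    then have "real (Suc m) * (q - 1) \<le> real m" by (simp add: algebra_simps)
    moreover have "0 < m"
    proof (rule ccontr)
      assume "\<not> 0 < m"
      with \<open>q - 1 \<le> real m * (2 - q)\<close> q show False by simp
    qed
    ultimately show ?thesis using that by blast
  qed
  show ?thesis
  proof (rule that[OF T])
    fix lam del :: real
    assume lam: "0 < lam" "lam < T" and del: "0 < del" "del < T"
    \<comment> \<open>The smaller parameter is taken so that one \<epsilon>, and with it one family
      of subsolutions, serves both equations.\<close>
    have t: "0 < min lam del / C" using lam del C by simp
    have A: "0 \<le> 2 * kernel_mass * real (Suc m)" using kernel_mass_nonneg by simp
    obtain \<epsilon> where \<epsilon>: "0 < \<epsilon>" "\<epsilon> \<le> M"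
      "2 * kernel_mass * real (Suc m) * \<epsilon> \<le> min lam del / C * \<epsilon> powr (q - 1)"
      by (rule small_scale[OF t M A]) blast
    have \<epsilon>_c: "2 * kernel_mass * real (Suc m) * \<epsilon> \<le> c / C * \<epsilon> powr (q - 1)" if "c \<in> {lam, del}" for c
    proof -
      have "min lam del / C * \<epsilon> powr (q - 1) \<le> c / C * \<epsilon> powr (q - 1)"
        using that C by (intro mult_right_mono divide_right_mono) auto
      with \<epsilon>(3) show ?thesis by linarith
    qed
    define Z where "Z = {\<lambda>x. \<epsilon> * bump d r x ^ Suc m |d r. 0 < r \<and> r \<le> 1 \<and> ball d r \<subseteq> \<Omega>}"
    have N: "\<exists>c. N = nonlin c \<and> c \<in> {lam, del} \<and> 0 \<le> c \<and> c < T" if "N \<in> {nonlin lam, nonlin del}" for N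
      using that lam del by auto
    obtain u v where uv: "admissible M u" "admissible M v" "solves u (nonlin lam u v)" "solves v (nonlin del v u)"
      "\<And>z. z \<in> Z \<Longrightarrow> AE x in lborel. z x \<le> u x" "\<And>z. z \<in> Z \<Longrightarrow> AE x in lborel. z x \<le> v x"
    proof (rule monotone_iteration[of M "nonlin lam" "nonlin del" Z])
      show "0 \<le> M" using M by simp
      show "N u v \<in> borel_measurable borel"
        if "N \<in> {nonlin lam, nonlin del}" "admissible M u" "admissible M v" for N u v
        using N[OF that(1)] nonlin_measurable[OF that(2,3)] by auto
      show "0 \<le> N u v x"
        if "N \<in> {nonlin lam, nonlin del}" "admissible M u" "admissible M v" "x \<in> \<Omega>" for N u v x
        using N[OF that(1)] nonlin_nonneg[OF _ that(2,3)] by auto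
      show "N u v x \<le> 2 * M * killing"
        if "N \<in> {nonlin lam, nonlin del}" "admissible M u" "admissible M v" "x \<in> \<Omega>" for N u v x
        using N[OF that(1)] nonlin_le[OF _ that(2,3,4)] cap by (auto intro: order.trans)
      show "N u' v' x \<le> N u v x"
        if "N \<in> {nonlin lam, nonlin del}" "admissible M u" "admissible M v" "admissible M u'" "admissible M v'"
          "\<And>y. u' y \<le> u y" "\<And>y. v' y \<le> v y" "x \<in> \<Omega>" for N u v u' v' x
        using N[OF that(1)] nonlin_mono[OF _ that(2-8)] by auto
      show "(\<lambda>k. N (U k) (V k) x) \<longlonglongrightarrow> N u v x"
        if "N \<in> {nonlin lam, nonlin del}" "\<And>k. admissible M (U k)" "\<And>k. admissible M (V k)"
          "admissible M u" "admissible M v" "\<And>y. (\<lambda>k. U k y) \<longlonglongrightarrow> u y" "\<And>y. (\<lambda>k. V k y) \<longlonglongrightarrow> v y" "x \<in> \<Omega>"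
        for N U V u v x
        using N[OF that(1)] nonlin_tendsto[OF that(2-8)] by auto
      show "z \<in> energy" if "z \<in> Z" for z using that unfolding Z_def by (auto intro: bump_power_energy simp del: power_Suc)
      show "z x \<le> M" if zZ: "z \<in> Z" for z x
      proof -
        obtain d r where z: "z = (\<lambda>x. \<epsilon> * bump d r x ^ Suc m)" and r: "0 < r" "r \<le> 1"
          using zZ unfolding Z_def by blast
        have "bump d r x ^ Suc m \<le> 1" using bump_le_1[OF r] by (intro power_le_one) auto
        then have "z x \<le> \<epsilon>" unfolding z using \<epsilon> by (intro mult_left_le) auto
        then show ?thesis using \<epsilon> by linarith
      qed
      show "form z \<phi> \<le> (\<integral>x. N u v x * \<phi> x \<partial>lborel)"
        if NN: "N \<in> {nonlin lam, nonlin del}" and z: "z \<in> Z" and adm: "admissible M u" "admissible M v"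
          and le: "AE x in lborel. z x \<le> u x" and \<phi>: "\<phi> \<in> energy" "\<And>x. 0 \<le> \<phi> x" for N z u v \<phi>
      proof -
        obtain d r where zz: "z = (\<lambda>x. \<epsilon> * bump d r x ^ Suc m)" and r: "0 < r" "r \<le> 1" "ball d r \<subseteq> \<Omega>"
          using z unfolding Z_def by blast
        obtain c where c: "N = nonlin c" "c \<in> {lam, del}" "0 \<le> c" using N[OF NN] by blast
        show ?thesis
          using bump_subsolution[OF m(2,1) \<epsilon>(1) \<epsilon>_c[OF c(2)] c(3) r adm _ \<phi>] le unfolding zz c(1) by blast
      qed
    qed (rule that)
    have "AE x in lborel. x \<in> \<Omega> \<longrightarrow> 0 < u x"
      by (rule AE_positive_if_above_bumps[of \<epsilon> "Suc m", OF uv(5) \<epsilon>(1)]) (unfold Z_def, blast)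
    moreover have "AE x in lborel. x \<in> \<Omega> \<longrightarrow> 0 < v x"
      by (rule AE_positive_if_above_bumps[of \<epsilon> "Suc m", OF uv(6) \<epsilon>(1)]) (unfold Z_def, blast)
    ultimately have "AE x in lborel. x \<in> \<Omega> \<longrightarrow> 0 < u x \<and> 0 < v x" by eventually_elim simp
    with uv show "\<exists>M u v. admissible M u \<and> admissible M v \<and> solves u (nonlin lam u v) \<and> solves v (nonlin del v u) \<and>
      (AE x in lborel. x \<in> \<Omega> \<longrightarrow> 0 < u x \<and> 0 < v x)" by blast
  qed
qed

end

section \<open>Weak solutions\<close>

lemma measurable_lebesgue_if_AE_eq_borel:
  fixes f g :: "'a::euclidean_space \<Rightarrow> real"
  assumes g: "g \<in> borel_measurable borel" and eq: "AE x in lborel. f x = g x"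
  shows "f \<in> borel_measurable lebesgue"
proof (rule measurableI)
  fix A :: "real set" assume A: "A \<in> sets borel"
  show "f -` A \<inter> space lebesgue \<in> sets lebesgue"
  proof (rule completion.in_sets_AE)
    have "AE x in lebesgue. f x = g x" using eq by (rule AE_completion)
    then show "AE x in lebesgue. x \<in> g -` A \<inter> space lebesgue \<longleftrightarrow> x \<in> f -` A \<inter> space lebesgue"
      by eventually_elim auto
    have "g -` A \<in> sets borel" using measurable_sets[OF g A] by simp
    then show "g -` A \<inter> space lebesgue \<in> sets lebesgue" by (auto intro: sets_completionI_sets)
  qed simp
qed simp

text \<open>The bridge from the Lebesgue integrals of the problem to the Borel integrals of the
  construction; it is applied both to functions on the space and to integrands on pairs.\<close>

lemma lebesgue_AE_eq_borel:
  fixes f g :: "'a::euclidean_space \<Rightarrow> real"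
  assumes g: "g \<in> borel_measurable borel" and eq: "AE x in lborel. f x = g x"
  shows "integral\<^sup>L lebesgue f = integral\<^sup>L lborel g"
    and "integrable lebesgue f \<longleftrightarrow> integrable lborel g"
proof -
  have f: "f \<in> borel_measurable lebesgue" by (rule measurable_lebesgue_if_AE_eq_borel[OF g eq])
  have g': "g \<in> borel_measurable lborel" using g by simp
  have "AE x in lebesgue. f x = g x" using eq by (rule AE_completion)
  then show "integral\<^sup>L lebesgue f = integral\<^sup>L lborel g"
    "integrable lebesgue f \<longleftrightarrow> integrable lborel g"
    using integral_cong_AE[OF f measurable_completion[OF g']] integrable_cong_AE[OF f measurable_completion[OF g']]
    by (simp_all add: integral_completion[OF g'] integrable_completion[OF g'])
qed

lemma abs_powr_mult_self: "0 < u \<Longrightarrow> \<bar>u\<bar> powr (r - 2) * u = u powr (r - 1)" for u r :: real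
  using powr_add[of u "r - 2" 1] by simp

context frac_domain
begin

lemma indicator_Q_set: "indicator (Q_set \<Omega>) z = (if fst z \<in> \<Omega> \<or> snd z \<in> \<Omega> then 1 else 0 :: real)"
  by (cases z) (auto simp: Q_set_def)

text \<open>Multiplication by the indicator restores the exterior condition at every point, which a
  representative given only almost everywhere may violate.\<close>

lemma X0_borel_representative:
  assumes u: "u \<in> X0 s \<Omega>"
  obtains u' where "u' \<in> borel_measurable borel" "\<And>x. x \<notin> \<Omega> \<Longrightarrow> u' x = 0" "AE x in lborel. u x = u' x"
proof -
  have "u \<in> borel_measurable lebesgue" using u by (simp add: X0_def)
  then obtain w where w: "w \<in> borel_measurable lborel" "AE x in lborel. u x = w x"
    using completion_ex_borel_measurable_real by blast
  show ?thesis
  proof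
    have [measurable]: "w \<in> borel_measurable borel" using w(1) by simp
    show "(\<lambda>x. indicator \<Omega> x * w x) \<in> borel_measurable borel" by measurable
    show "AE x in lborel. u x = indicator \<Omega> x * w x"
      using w(2)
    proof eventually_elim
      case (elim x)
      then show ?case using u by (cases "x \<in> \<Omega>") (auto simp: X0_def)
    qed
  qed simp
qed

lemma pair_AE:
  assumes "AE x in lborel. P (x::'a)"
  shows "AE z in lborel. P (fst z) \<and> P (snd z)"
  using AE_lborel_pair[OF assms] unfolding lborel_prod .

lemma X0_inner_eq_form:
  assumes u: "u \<in> energy" and \<phi>: "\<phi> \<in> energy" and \<phi>': "AE x in lborel. \<phi>' x = \<phi> x" "\<And>x. x \<notin> \<Omega> \<Longrightarrow> \<phi>' x = 0"
  shows "X0_inner s \<Omega> u \<phi>' = form u \<phi>"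
proof -
  have [measurable]: "u \<in> borel_measurable borel" "\<phi> \<in> borel_measurable borel"
    using u \<phi> by (auto intro: energy_measurable)
  let ?G = "\<lambda>z. (u (fst z) - u (snd z)) * (\<phi> (fst z) - \<phi> (snd z)) * pair_kernel z"
  have meas: "?G \<in> borel_measurable borel"
    unfolding borel_prod[symmetric] by measurable
  have "AE z in lborel. indicator (Q_set \<Omega>) z *\<^sub>R
      (case z of (x, y) \<Rightarrow> (u x - u y) * (\<phi>' x - \<phi>' y) / norm (x - y) powr (real DIM('a) + 2 * s)) = ?G z"
    using pair_AE[OF \<phi>'(1)]
  proof eventually_elim
    case (elim z)
    then show ?case
      using energy_outside[OF u] by (auto simp: indicator_Q_set frac_kernel_def split_beta)
  qed
  from lebesgue_AE_eq_borel(1)[OF meas this] show ?thesis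
    unfolding X0_inner_def set_lebesgue_integral_def form_def lborel_prod .
qed

lemma X0_imp_energy:
  assumes u: "u \<in> X0 s \<Omega>" and u' [measurable]: "u' \<in> borel_measurable borel"
    and out: "\<And>x. x \<notin> \<Omega> \<Longrightarrow> u' x = 0" and eq: "AE x in lborel. u x = u' x"
  shows "u' \<in> energy"
proof -
  let ?G = "\<lambda>z. (u' (fst z) - u' (snd z))\<^sup>2 * pair_kernel z"
  have meas: "?G \<in> borel_measurable borel"
    unfolding borel_prod[symmetric] by measurable
  have "AE z in lborel. indicator (Q_set \<Omega>) z *\<^sub>R
      (case z of (x, y) \<Rightarrow> \<bar>u x - u y\<bar>\<^sup>2 / norm (x - y) powr (real DIM('a) + 2 * s)) = ?G z"
    using pair_AE[OF eq]
  proof eventually_elim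
    case (elim z)
    then show ?case
      using out by (auto simp: indicator_Q_set frac_kernel_def split_beta)
  qed
  from lebesgue_AE_eq_borel(2)[OF meas this] have "integrable lborel ?G"
    using u unfolding X0_def set_integrable_def by simp
  then show ?thesis using u' out by (simp add: energy_def lborel_prod)
qed

lemma energy_imp_X0:
  assumes u: "u \<in> energy"
  shows "u \<in> X0 s \<Omega>"
proof -
  have u_meas [measurable]: "u \<in> borel_measurable borel" using u by (rule energy_measurable)
  let ?G = "\<lambda>z. (u (fst z) - u (snd z))\<^sup>2 * pair_kernel z"
  have meas: "?G \<in> borel_measurable borel"
    unfolding borel_prod[symmetric] by measurable
  have "AE z in lborel. indicator (Q_set \<Omega>) z *\<^sub>R
      (case z of (x, y) \<Rightarrow> \<bar>u x - u y\<bar>\<^sup>2 / norm (x - y) powr (real DIM('a) + 2 * s)) = ?G z"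
    using energy_outside[OF u] by (auto simp: indicator_Q_set frac_kernel_def split_beta)
  from lebesgue_AE_eq_borel(2)[OF meas this] have "set_integrable lebesgue (Q_set \<Omega>)
      (\<lambda>(x, y). \<bar>u x - u y\<bar>\<^sup>2 / norm (x - y) powr (real DIM('a) + 2 * s))"
    using energy_integrable[OF u] unfolding set_integrable_def lborel_prod by simp
  moreover have "set_integrable lebesgue \<Omega> (\<lambda>x. (u x)\<^sup>2)"
  proof -
    have "(\<lambda>x. (u x)\<^sup>2) \<in> borel_measurable borel" by measurable
    moreover have "AE x in lborel. indicator \<Omega> x *\<^sub>R (u x)\<^sup>2 = (u x)\<^sup>2"
      using energy_outside[OF u] by (intro AE_I2) (simp split: split_indicator)
    ultimately have "integrable lebesgue (\<lambda>x. indicator \<Omega> x *\<^sub>R (u x)\<^sup>2) \<longleftrightarrow> integrable lborel (\<lambda>x. (u x)\<^sup>2)"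
      by (rule lebesgue_AE_eq_borel(2))
    then show ?thesis using poincare(1)[OF u] unfolding set_integrable_def by simp
  qed
  moreover have "u \<in> borel_measurable lebesgue"
    using u_meas by (auto intro: measurable_completion)
  ultimately show ?thesis using energy_outside[OF u] by (simp add: X0_def)
qed

end

context concave_convex
begin

text \<open>Two versions of the pair are kept apart: \<open>u\<close> and \<open>v\<close> obey the
  bounds that control the nonlinear terms, while \<open>U\<close> and \<open>V\<close> are positive
  throughout \<Omega>, so that \<open>\<bar>U x\<bar> powr (q - 2) * U x\<close> collapses to a
  single power. They agree almost everywhere, which no integral detects.\<close>

lemma weak_solution_if_solves:
  assumes C_eq: "C = frac_const (real DIM('a)) s" and p_eq: "p = crit_exp (real DIM('a)) s \<mu>"
    and c: "0 \<le> lam" "0 \<le> del"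
    and adm: "admissible M u" "admissible M v"
    and U: "solves U (nonlin lam u v)" "AE x in lborel. U x = u x" "\<And>x. x \<in> \<Omega> \<Longrightarrow> 0 < U x"
    and V: "solves V (nonlin del v u)" "AE x in lborel. V x = v x" "\<And>x. x \<in> \<Omega> \<Longrightarrow> 0 < V x"
  shows "weak_solution s q \<mu> \<Omega> lam del (U, V)"
proof -
  have energy: "U \<in> energy" "V \<in> energy" using U V by (simp_all add: solves_def)
  have [measurable]: "u \<in> borel_measurable borel" "v \<in> borel_measurable borel"
    using adm by (auto intro: admissible_measurable)
  have [measurable]: "U \<in> borel_measurable borel" "V \<in> borel_measurable borel"
    using energy by (auto intro: energy_measurable)
  note [measurable] = riesz_conv_measurable[OF adm(1)] riesz_conv_measurable[OF adm(2)]
  let ?W = "\<lambda>w x. riesz_conv \<mu> (\<lambda>y. w y powr p) x"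
  have conv: "riesz_conv \<mu> (\<lambda>y. \<bar>W y\<bar> powr p) x = ?W w x"
    if [measurable]: "W \<in> borel_measurable borel" "w \<in> borel_measurable borel"
      and eq: "AE x in lborel. W x = w x" and adm: "admissible M w" for W w x
  proof -
    have "AE y in lborel. norm (x - y) powr (- \<mu>) * \<bar>W y\<bar> powr p = norm (x - y) powr (- \<mu>) * w y powr p"
      using eq by eventually_elim (use adm in \<open>simp add: admissible_def\<close>)
    moreover have "(\<lambda>y. norm (x - y) powr (- \<mu>) * w y powr p) \<in> borel_measurable borel" by measurable
    ultimately show ?thesis
      unfolding riesz_conv_powr[OF adm] unfolding riesz_conv_def by (intro lebesgue_AE_eq_borel(1))
  qed
  have eqn: "C * (X0_inner s \<Omega> U \<phi> + X0_inner s \<Omega> V \<psi>) =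
          (LINT x:\<Omega>|lebesgue. lam * \<bar>U x\<bar> powr (q - 2) * U x * \<phi> x
                             + del * \<bar>V x\<bar> powr (q - 2) * V x * \<psi> x)
        + (LINT x:\<Omega>|lebesgue. riesz_conv \<mu> (\<lambda>y. \<bar>V y\<bar> powr p) x
                             * \<bar>U x\<bar> powr (p - 2) * U x * \<phi> x)
        + (LINT x:\<Omega>|lebesgue. riesz_conv \<mu> (\<lambda>y. \<bar>U y\<bar> powr p) x
                             * \<bar>V x\<bar> powr (p - 2) * V x * \<psi> x)"
    if X: "\<phi> \<in> X0 s \<Omega>" "\<psi> \<in> X0 s \<Omega>" for \<phi> \<psi>
  proof -
    obtain \<phi>' where \<phi>': "\<phi>' \<in> borel_measurable borel" "\<And>x. x \<notin> \<Omega> \<Longrightarrow> \<phi>' x = 0" "AE x in lborel. \<phi> x = \<phi>' x"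
      using X0_borel_representative[OF X(1)] by metis
    obtain \<psi>' where \<psi>': "\<psi>' \<in> borel_measurable borel" "\<And>x. x \<notin> \<Omega> \<Longrightarrow> \<psi>' x = 0" "AE x in lborel. \<psi> x = \<psi>' x"
      using X0_borel_representative[OF X(2)] by metis
    note [measurable] = \<phi>'(1) \<psi>'(1)
    have en: "\<phi>' \<in> energy" "\<psi>' \<in> energy"
      by (rule X0_imp_energy[OF X(1) \<phi>'], assumption) (rule X0_imp_energy[OF X(2) \<psi>'], assumption)
    define a1 a2 b1 b2 where "a1 x = lam * u x powr (q - 1)" and "a2 x = ?W v x * u x powr (p - 1)"
      and "b1 x = del * v x powr (q - 1)" and "b2 x = ?W u x * v x powr (p - 1)" for x
    have [measurable]: "a1 \<in> borel_measurable borel" "a2 \<in> borel_measurable borel"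
      "b1 \<in> borel_measurable borel" "b2 \<in> borel_measurable borel"
      unfolding a1_def[abs_def] a2_def[abs_def] b1_def[abs_def] b2_def[abs_def] by measurable
    have pow: "w x powr r \<le> M powr r" "0 \<le> w x" if "admissible M w" "0 \<le> r" for w x r
      using that by (auto simp: admissible_def intro: powr_mono2)
    have int1: "integrable lborel (\<lambda>x. c * w x powr (q - 1) * \<eta> x)"
      if [measurable]: "w \<in> borel_measurable borel" and "admissible M w" "\<eta> \<in> energy" "0 \<le> c" for w \<eta> and c :: real
    proof (rule integrable_bounded_mult[OF _ _ that(3), where B = "c * M powr (q - 1)"])
      show "\<bar>c * w x powr (q - 1)\<bar> \<le> c * M powr (q - 1)" for x
        using pow(1)[OF that(2), of "q - 1" x] q that(4) by (simp add: abs_mult mult_left_mono)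
    qed measurable
    have int2: "integrable lborel (\<lambda>x. ?W w' x * w x powr (p - 1) * \<eta> x)"
      if w: "admissible M w" "admissible M w'" "\<eta> \<in> energy" for w w' \<eta>
    proof (rule integrable_bounded_mult[OF _ _ that(3), where B = "riesz_bound * M powr p * M powr (p - 1)"])
      have [measurable]: "w \<in> borel_measurable borel" using w(1) by (rule admissible_measurable)
      note [measurable] = riesz_conv_measurable[OF w(2)]
      show "(\<lambda>x. ?W w' x * w x powr (p - 1)) \<in> borel_measurable borel" by measurable
      show "\<bar>?W w' x * w x powr (p - 1)\<bar> \<le> riesz_bound * M powr p * M powr (p - 1)" if "x \<in> \<Omega>" for x
      proof -
        have "?W w' x * w x powr (p - 1) \<le> (riesz_bound * M powr p) * M powr (p - 1)"
          using riesz_bound(1) p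
          by (intro mult_mono riesz_conv_le[OF w(2) that] pow(1)[OF w(1)]) auto
        then show ?thesis using riesz_conv_nonneg[OF w(2), of x] by (simp add: abs_mult)
      qed
    qed
    have ints: "integrable lborel (\<lambda>x. a1 x * \<phi>' x)" "integrable lborel (\<lambda>x. b1 x * \<psi>' x)"
      "integrable lborel (\<lambda>x. a2 x * \<phi>' x)" "integrable lborel (\<lambda>x. b2 x * \<psi>' x)"
      unfolding a1_def a2_def b1_def b2_def by (intro int1 int2 adm en c; measurable)+
    have R1: "(LINT x:\<Omega>|lebesgue. lam * \<bar>U x\<bar> powr (q - 2) * U x * \<phi> x
                             + del * \<bar>V x\<bar> powr (q - 2) * V x * \<psi> x)
        = (\<integral>x. a1 x * \<phi>' x \<partial>lborel) + (\<integral>x. b1 x * \<psi>' x \<partial>lborel)"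
    proof -
      have "(\<lambda>x. a1 x * \<phi>' x + b1 x * \<psi>' x) \<in> borel_measurable borel" by measurable
      moreover have "AE x in lborel. indicator \<Omega> x *\<^sub>R (lam * \<bar>U x\<bar> powr (q - 2) * U x * \<phi> x
                             + del * \<bar>V x\<bar> powr (q - 2) * V x * \<psi> x) = a1 x * \<phi>' x + b1 x * \<psi>' x"
        using U(2) V(2) \<phi>'(3) \<psi>'(3)
      proof eventually_elim
        case (elim x)
        show ?case
        proof (cases "x \<in> \<Omega>")
          case True
          have "\<bar>U x\<bar> powr (q - 2) * U x = u x powr (q - 1)" "\<bar>V x\<bar> powr (q - 2) * V x = v x powr (q - 1)"
            using abs_powr_mult_self[OF U(3)[OF True]] abs_powr_mult_self[OF V(3)[OF True]] elim by simp_all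
          then show ?thesis using True elim(3,4) by (simp add: a1_def b1_def mult.assoc)
        qed (simp add: \<phi>' \<psi>')
      qed
      ultimately have "(LINT x:\<Omega>|lebesgue. lam * \<bar>U x\<bar> powr (q - 2) * U x * \<phi> x
          + del * \<bar>V x\<bar> powr (q - 2) * V x * \<psi> x) = (\<integral>x. a1 x * \<phi>' x + b1 x * \<psi>' x \<partial>lborel)"
        unfolding set_lebesgue_integral_def by (rule lebesgue_AE_eq_borel(1))
      then show ?thesis using Bochner_Integration.integral_add[OF ints(1,2)] by simp
    qed
    \<comment> \<open>Stated once for general arguments because the two convolution terms differ
      only by exchanging the roles of the unknowns.\<close>
    have R23: "(LINT x:\<Omega>|lebesgue. riesz_conv \<mu> (\<lambda>y. \<bar>Y y\<bar> powr p) x * \<bar>X x\<bar> powr (p - 2) * X x * \<eta> x)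
        = (\<integral>x. ?W w' x * w x powr (p - 1) * \<eta>' x \<partial>lborel)"
      if [measurable]: "Y \<in> borel_measurable borel" "X \<in> borel_measurable borel"
        and adm: "admissible M w" "admissible M w'"
        and eq: "AE x in lborel. Y x = w' x" "AE x in lborel. X x = w x"
        and pos: "\<And>x. x \<in> \<Omega> \<Longrightarrow> 0 < X x"
        and \<eta>': "\<eta>' \<in> borel_measurable borel" "\<And>x. x \<notin> \<Omega> \<Longrightarrow> \<eta>' x = 0" "AE x in lborel. \<eta> x = \<eta>' x"
      for X Y w w' \<eta> \<eta>'
    proof -
      have [measurable]: "w \<in> borel_measurable borel" "w' \<in> borel_measurable borel"
        using adm by (auto intro: admissible_measurable)
      note [measurable] = \<eta>'(1) riesz_conv_measurable[OF adm(2)]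
      have "(\<lambda>x. ?W w' x * w x powr (p - 1) * \<eta>' x) \<in> borel_measurable borel" by measurable
      moreover have "AE x in lborel. indicator \<Omega> x *\<^sub>R (riesz_conv \<mu> (\<lambda>y. \<bar>Y y\<bar> powr p) x
          * \<bar>X x\<bar> powr (p - 2) * X x * \<eta> x) = ?W w' x * w x powr (p - 1) * \<eta>' x"
        using eq(2) \<eta>'(3)
      proof eventually_elim
        case (elim x)
        have W: "riesz_conv \<mu> (\<lambda>y. \<bar>Y y\<bar> powr p) x = ?W w' x" by (rule conv[OF _ _ eq(1) adm(2)]) measurable
        show ?case
        proof (cases "x \<in> \<Omega>")
          case True
          have "\<bar>X x\<bar> powr (p - 2) * X x = w x powr (p - 1)"
            using abs_powr_mult_self[OF pos[OF True]] elim by simp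
          then show ?thesis using True elim(2) W by (simp add: mult.assoc)
        qed (simp add: \<eta>')
      qed
      ultimately show ?thesis
        unfolding set_lebesgue_integral_def by (rule lebesgue_AE_eq_borel(1))
    qed
    have R2: "(LINT x:\<Omega>|lebesgue. riesz_conv \<mu> (\<lambda>y. \<bar>V y\<bar> powr p) x * \<bar>U x\<bar> powr (p - 2) * U x * \<phi> x)
        = (\<integral>x. a2 x * \<phi>' x \<partial>lborel)"
      unfolding a2_def by (rule R23) (use adm U V \<phi>' in auto)
    have R3: "(LINT x:\<Omega>|lebesgue. riesz_conv \<mu> (\<lambda>y. \<bar>U y\<bar> powr p) x * \<bar>V x\<bar> powr (p - 2) * V x * \<psi> x)
        = (\<integral>x. b2 x * \<psi>' x \<partial>lborel)"
      unfolding b2_def by (rule R23) (use adm U V \<psi>' in auto)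
    have L1: "C * X0_inner s \<Omega> U \<phi> = (\<integral>x. a1 x * \<phi>' x \<partial>lborel) + (\<integral>x. a2 x * \<phi>' x \<partial>lborel)"
    proof -
      have "X0_inner s \<Omega> U \<phi> = form U \<phi>'"
        using X by (intro X0_inner_eq_form energy en \<phi>') (simp add: X0_def)
      also have "\<dots> = (\<integral>x. nonlin lam u v x * \<phi>' x \<partial>lborel)" using U(1) en by (simp add: solves_def)
      finally have "C * X0_inner s \<Omega> U \<phi> = (\<integral>x. C * (nonlin lam u v x * \<phi>' x) \<partial>lborel)" by simp
      also have "\<dots> = (\<integral>x. a1 x * \<phi>' x + a2 x * \<phi>' x \<partial>lborel)"
        using C unfolding nonlin_def a1_def a2_def by (simp add: distrib_right)
      finally show ?thesis using Bochner_Integration.integral_add[OF ints(1,3)] by simp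
    qed
    have L2: "C * X0_inner s \<Omega> V \<psi> = (\<integral>x. b1 x * \<psi>' x \<partial>lborel) + (\<integral>x. b2 x * \<psi>' x \<partial>lborel)"
    proof -
      have "X0_inner s \<Omega> V \<psi> = form V \<psi>'"
        using X by (intro X0_inner_eq_form energy en \<psi>') (simp add: X0_def)
      also have "\<dots> = (\<integral>x. nonlin del v u x * \<psi>' x \<partial>lborel)" using V(1) en by (simp add: solves_def)
      finally have "C * X0_inner s \<Omega> V \<psi> = (\<integral>x. C * (nonlin del v u x * \<psi>' x) \<partial>lborel)" by simp
      also have "\<dots> = (\<integral>x. b1 x * \<psi>' x + b2 x * \<psi>' x \<partial>lborel)"
        using C unfolding nonlin_def b1_def b2_def by (simp add: distrib_right)
      finally show ?thesis using Bochner_Integration.integral_add[OF ints(2,4)] by simp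
    qed
    show ?thesis unfolding R1 R2 R3 distrib_left L1 L2 by simp
  qed
  show ?thesis
    unfolding weak_solution_def Let_def C_eq[symmetric] p_eq[symmetric]
    using eqn energy_imp_X0[OF energy(1)] energy_imp_X0[OF energy(2)]
    by (auto simp: Y_space_def)
qed

lemma positive_weak_solution:
  assumes C_eq: "C = frac_const (real DIM('a)) s" and p_eq: "p = crit_exp (real DIM('a)) s \<mu>"
  obtains T where "0 < T" "\<And>lam del. 0 < lam \<Longrightarrow> lam < T \<Longrightarrow> 0 < del \<Longrightarrow> del < T \<Longrightarrow>
    positive_solution s q \<mu> \<Omega> lam del"
proof -
  obtain T where T: "0 < T" and ex: "\<And>lam del. 0 < lam \<Longrightarrow> lam < T \<Longrightarrow> 0 < del \<Longrightarrow> del < T \<Longrightarrow>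
    \<exists>M u v. admissible M u \<and> admissible M v \<and> solves u (nonlin lam u v) \<and> solves v (nonlin del v u) \<and>
      (AE x in lborel. x \<in> \<Omega> \<longrightarrow> 0 < u x \<and> 0 < v x)"
    using positive_solution_exists by blast
  show ?thesis
  proof (rule that[OF T])
    fix lam del :: real assume par: "0 < lam" "lam < T" "0 < del" "del < T"
    obtain M u v where uv: "admissible M u" "admissible M v" "solves u (nonlin lam u v)" "solves v (nonlin del v u)"
      and pos: "AE x in lborel. x \<in> \<Omega> \<longrightarrow> 0 < u x \<and> 0 < v x"
      using ex[OF par] by blast
    have [measurable]: "u \<in> borel_measurable borel" "v \<in> borel_measurable borel"
      using uv(1,2) by (auto intro: admissible_measurable)
    \<comment> \<open>The value 1 is an arbitrary positive number placed on the null set of points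
      of \<Omega> where positivity fails.\<close>
    define U V where "U x = (if x \<in> \<Omega> \<and> u x \<le> 0 then 1 else u x)"
      and "V x = (if x \<in> \<Omega> \<and> v x \<le> 0 then 1 else v x)" for x
    have AE: "AE x in lborel. U x = u x" "AE x in lborel. V x = v x"
      using pos by (eventually_elim, auto simp: U_def V_def)+
    have solves: "solves U (nonlin lam u v)" "solves V (nonlin del v u)"
    proof -
      show "solves U (nonlin lam u v)"
      proof (rule solves_cong_AE[OF uv(3) _ _ AE(1)])
        show "U \<in> borel_measurable borel" unfolding U_def[abs_def] by measurable
      qed (use uv in \<open>simp add: U_def admissible_def\<close>)
      show "solves V (nonlin del v u)"
      proof (rule solves_cong_AE[OF uv(4) _ _ AE(2)])
        show "V \<in> borel_measurable borel" unfolding V_def[abs_def] by measurable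
      qed (use uv in \<open>simp add: V_def admissible_def\<close>)
    qed
    have posUV: "0 < U x" "0 < V x" if "x \<in> \<Omega>" for x using that by (auto simp: U_def V_def)
    have "weak_solution s q \<mu> \<Omega> lam del (U, V)"
      using par by (intro weak_solution_if_solves[OF C_eq p_eq _ _ uv(1,2) solves(1) AE(1) posUV(1) solves(2) AE(2) posUV(2)]) auto
    with posUV show "positive_solution s q \<mu> \<Omega> lam del"
      unfolding positive_solution_def by blast
  qed
qed

end

section \<open>From one positive solution to the theorem\<close>

lemma weak_solution_uminus:
  assumes "weak_solution s q \<mu> \<Omega> lam del (u, v)"
  shows "weak_solution s q \<mu> \<Omega> lam del (\<lambda>x. - u x, \<lambda>x. - v x)"
proof -
  have X0: "(\<lambda>x. - w x) \<in> X0 s \<Omega>" if "w \<in> X0 s \<Omega>" for w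
  proof -
    have "\<bar>- w x - - w y\<bar> = \<bar>w x - w y\<bar>" for x y by linarith
    moreover have "(\<lambda>x. - w x) \<in> borel_measurable lebesgue"
      using that by (intro borel_measurable_uminus) (simp add: X0_def)
    ultimately show ?thesis
      using that unfolding X0_def mem_Collect_eq power2_minus by simp
  qed
  have inner: "X0_inner s \<Omega> (\<lambda>x. - w x) \<phi> = - X0_inner s \<Omega> w \<phi>" for w \<phi>
  proof -
    have "(\<lambda>(x, y). (- w x - - w y) * (\<phi> x - \<phi> y) / norm (x - y) powr (real DIM('a) + 2 * s))
      = (\<lambda>z. - (case z of (x, y) \<Rightarrow> (w x - w y) * (\<phi> x - \<phi> y) / norm (x - y) powr (real DIM('a) + 2 * s)))"
      by (auto simp: fun_eq_iff minus_divide_left algebra_simps)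
    then show ?thesis
      unfolding X0_inner_def set_lebesgue_integral_def by simp
  qed
  have R1: "(LINT x:\<Omega>|lebesgue. lam * \<bar>- u x\<bar> powr (q - 2) * - u x * \<phi> x
      + del * \<bar>- v x\<bar> powr (q - 2) * - v x * \<psi> x)
    = - (LINT x:\<Omega>|lebesgue. lam * \<bar>u x\<bar> powr (q - 2) * u x * \<phi> x
      + del * \<bar>v x\<bar> powr (q - 2) * v x * \<psi> x)" for \<phi> \<psi>
    unfolding set_lebesgue_integral_def by (subst Bochner_Integration.integral_minus[symmetric]) (simp add: algebra_simps)
  have R2: "(LINT x:\<Omega>|lebesgue. riesz_conv \<mu> (\<lambda>y. \<bar>- w' y\<bar> powr p) x * \<bar>- w x\<bar> powr (p - 2) * - w x * \<phi> x)
    = - (LINT x:\<Omega>|lebesgue. riesz_conv \<mu> (\<lambda>y. \<bar>w' y\<bar> powr p) x * \<bar>w x\<bar> powr (p - 2) * w x * \<phi> x)"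
    for w w' \<phi> and p :: real
    unfolding set_lebesgue_integral_def by (subst Bochner_Integration.integral_minus[symmetric]) simp
  let ?p = "crit_exp (real DIM('a)) s \<mu>"
  have uv: "u \<in> X0 s \<Omega>" "v \<in> X0 s \<Omega>"
    using assms by (simp_all add: weak_solution_def Y_space_def)
  have eq: "frac_const (real DIM('a)) s * (X0_inner s \<Omega> u \<phi> + X0_inner s \<Omega> v \<psi>) =
          (LINT x:\<Omega>|lebesgue. lam * \<bar>u x\<bar> powr (q - 2) * u x * \<phi> x + del * \<bar>v x\<bar> powr (q - 2) * v x * \<psi> x)
        + (LINT x:\<Omega>|lebesgue. riesz_conv \<mu> (\<lambda>y. \<bar>v y\<bar> powr ?p) x * \<bar>u x\<bar> powr (?p - 2) * u x * \<phi> x)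
        + (LINT x:\<Omega>|lebesgue. riesz_conv \<mu> (\<lambda>y. \<bar>u y\<bar> powr ?p) x * \<bar>v x\<bar> powr (?p - 2) * v x * \<psi> x)"
      if "\<phi> \<in> X0 s \<Omega>" "\<psi> \<in> X0 s \<Omega>" for \<phi> \<psi>
    using assms that unfolding weak_solution_def Y_space_def Let_def by blast
  have neg: "c * (- a + - b) = - d + - e + - f" if "c * (a + b) = d + e + f" for a b c d e f :: real
  proof -
    have "c * (- a + - b) = - (c * (a + b))" by (simp add: algebra_simps)
    then show ?thesis using that by linarith
  qed
  show ?thesis
    unfolding weak_solution_def Let_def Y_space_def split_def prod.sel R1 R2 inner
    by (intro conjI ballI neg[OF eq]) (auto intro: X0 uv)
qed

text \<open>The three distinctness claims follow from \<open>u > 0\<close> on \<Omega> alone: there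
  u, - u and 0 differ at every point, and a nonempty open set is not negligible.\<close>

lemma two_nontrivial_solutions_if_positive:
  fixes \<Omega> :: "'a::euclidean_space set"
  assumes pos: "positive_solution s q \<mu> \<Omega> lam del" and \<Omega>: "open \<Omega>" "\<Omega> \<noteq> {}"
  shows "two_nontrivial_solutions s q \<mu> \<Omega> lam del"
proof -
  obtain u v where sol: "weak_solution s q \<mu> \<Omega> lam del (u, v)" and uv: "\<And>x. x \<in> \<Omega> \<Longrightarrow> 0 < u x"
    using pos unfolding positive_solution_def by blast
  have ne: "\<not> (AE x in lebesgue. x \<notin> \<Omega>)"
  proof
    assume "AE x in lebesgue. x \<notin> \<Omega>"
    then have "negligible \<Omega>"
      by (metis (mono_tags, lifting) AE_iff_null_sets negligible_iff_null_sets \<Omega>(1) borel_open sets_completionI_sets sets_lborel)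
    then show False using \<Omega> open_not_negligible by blast
  qed
  have neq: "\<not> ae_equal_pair (a, b) (a', b')" if "\<And>x. x \<in> \<Omega> \<Longrightarrow> a x \<noteq> a' x" for a a' b b' :: "'a \<Rightarrow> real"
  proof
    assume "ae_equal_pair (a, b) (a', b')"
    then have "AE x in lebesgue. a x = a' x" by (simp add: ae_equal_pair_def)
    then have "AE x in lebesgue. x \<notin> \<Omega>" by eventually_elim (use that in auto)
    with ne show False ..
  qed
  show ?thesis
    unfolding two_nontrivial_solutions_def nontrivial_pair_def
  proof (intro exI conjI)
    show "weak_solution s q \<mu> \<Omega> lam del (u, v)" by (rule sol)
    show "weak_solution s q \<mu> \<Omega> lam del (\<lambda>x. - u x, \<lambda>x. - v x)" by (rule weak_solution_uminus[OF sol])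
  qed (rule neq; use uv in force)+
qed

lemma frac_const_pos:
  assumes "0 < s" "s < 1" "0 < n"
  shows "0 < frac_const n s"
  unfolding frac_const_def using assms by (intro mult_pos_pos divide_pos_pos Gamma_real_pos) auto

theorem theorem1p1:
  fixes s q \<mu> :: real and \<Omega> :: "'a::euclidean_space set"
  assumes "0 < s" "s < 1"
    and "2 * s < real DIM('a)"
    and "bounded_C2_domain \<Omega>"
    and "1 < q" "q < 2"
    and "0 < \<mu>" "\<mu> < real DIM('a)"
  shows "\<exists>\<Theta>>0. \<exists>\<Theta>\<^sub>0>0. \<forall>lam>0. \<forall>del>0.
    (\<mu> \<le> 4 * s \<and> 0 < lam powr (2 / (2 - q)) + del powr (2 / (2 - q)) \<and>
       lam powr (2 / (2 - q)) + del powr (2 / (2 - q)) < \<Theta> \<longrightarrow>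
       two_nontrivial_solutions s q \<mu> \<Omega> lam del \<and> positive_solution s q \<mu> \<Omega> lam del) \<and>
    (\<mu> > 4 * s \<and> 0 < lam powr (2 / (2 - q)) + del powr (2 / (2 - q)) \<and>
       lam powr (2 / (2 - q)) + del powr (2 / (2 - q)) < \<Theta>\<^sub>0 \<longrightarrow>
       two_nontrivial_solutions s q \<mu> \<Omega> lam del \<and> positive_solution s q \<mu> \<Omega> lam del)"
proof -
  define n where "n = real DIM('a)"
  define p where "p = crit_exp n s \<mu>"
  define C where "C = frac_const n s"
  have \<Omega>: "open \<Omega>" "bounded \<Omega>" "\<Omega> \<noteq> {}" using assms(4) by (auto simp: bounded_C2_domain_def)
  \<comment> \<open>The numerator satisfies 2n - \<mu> > n > n - 2s, and the denominator is
    positive.\<close>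
  have p: "1 < p"
    unfolding p_def crit_exp_def n_def using assms by (simp add: field_simps)
  have C: "0 < C" unfolding C_def n_def using assms by (intro frac_const_pos) auto
  interpret concave_convex s \<Omega> q \<mu> p C
    by unfold_locales (use assms \<Omega> p C in auto)
  obtain T where T: "0 < T" and sol: "\<And>lam del. 0 < lam \<Longrightarrow> lam < T \<Longrightarrow> 0 < del \<Longrightarrow> del < T \<Longrightarrow>
    positive_solution s q \<mu> \<Omega> lam del"
    using positive_weak_solution unfolding C_def p_def n_def by blast
  define r where "r = 2 / (2 - q)"
  have r: "0 < r" unfolding r_def using assms by simp
  \<comment> \<open>Smallness of the sum of powers forces each parameter below \<open>T\<close>.
    Thus \<open>T powr r\<close> serves as both thresholds.\<close>
  have lt: "x < T" if "x powr r + y powr r < T powr r" for x y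
  proof (rule ccontr)
    assume "\<not> x < T"
    then have "T powr r \<le> x powr r" using T r by (intro powr_mono2) auto
    moreover have "0 \<le> y powr r" by simp
    ultimately show False using that by linarith
  qed
  have main: "two_nontrivial_solutions s q \<mu> \<Omega> lam del \<and> positive_solution s q \<mu> \<Omega> lam del"
    if "0 < lam" "0 < del" "lam powr r + del powr r < T powr r" for lam del
  proof -
    have "positive_solution s q \<mu> \<Omega> lam del"
      using that lt[of lam del] lt[of del lam] by (intro sol) (simp_all add: add.commute)
    with two_nontrivial_solutions_if_positive[OF this \<Omega>(1,3)] show ?thesis by simp
  qed
  have "0 < T powr r" using T by simp
  then show ?thesis
    unfolding r_def[symmetric] using main by blast
qed

end
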